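(* Let $k$ be a commutative ring, let $\mathcal{A}$ be a unital associative $k$-algebra, let $r\ge 1$ be an integer, and let $\mathcal{M}_r(\mathcal{A})$ be the algebra of $r\times r$ matrices over $\mathcal{A}$. Then there exists an isomorphism of $k$-modules $\Psi:\varepsilon(\mathcal{A})\to\varepsilon(\mathcal{M}_r(\mathcal{A}))$ that preserves the induced Courant brackets and preserves the induced bilinear forms up to an isomorphism $\phi:H_0(\mathcal{A},\mathcal{A})\to H_0(\mathcal{M}_r(\mathcal{A}),\mathcal{M}_r(\mathcal{A}))$, i.e. $(\Psi(e_1),\Psi(e_2))=\phi((e_1,e_2))$ for all $e_1,e_2\in\varepsilon(\mathcal{A})$. Consequently, $L\mapsto\Psi(L)$ is a bijection between the Dirac structures on $\mathcal{A}$ and the Dirac structures on $\mathcal{M}_r(\mathcal{A})$.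
   Context: For a unital associative $k$-algebra $\mathcal{A}$ (not necessarily commutative) let $C_n(\mathcal{A},\mathcal{A})=\mathcal{A}\otimes_k\mathcal{A}^{\otimes n}$ with Hochschild boundary $b(a_0\otimes\dots\otimes a_n)=\sum_{i=0}^{n-1}(-1)^i a_0\otimes\dots\otimes a_ia_{i+1}\otimes\dots\otimes a_n+(-1)^n a_na_0\otimes a_1\otimes\dots\otimes a_{n-1}$, and let $H_n(\mathcal{A},\mathcal{A})$ be its homology; in particular $H_0(\mathcal{A},\mathcal{A})=\mathcal{A}/[\mathcal{A},\mathcal{A}]$. Let $H^1(\mathcal{A},\mathcal{A})=\mathrm{Der}_k(\mathcal{A})/\{[a,\cdot]:a\in\mathcal{A}\}$ (derivations modulo inner derivations), with the Lie bracket induced by the commutator of derivations. For $X\in H^1(\mathcal{A},\mathcal{A})$, represented by a derivation again denoted $X$, the following operations, given on the level of chains, are well defined on homology: the Lie derivative $\mathcal{L}_X(a_0\otimes a_1)=X(a_0)\otimes a_1+a_0\otimes X(a_1)$ on $H_1$; the interior product $i_X:H_1(\mathcal{A},\mathcal{A})\to H_0(\mathcal{A},\mathcal{A})$, $i_X(a_0\otimes a_1)=X(a_1)a_0$; and Connes' map $B:H_0(\mathcal{A},\mathcal{A})\to H_1(\mathcal{A},\mathcal{A})$, $B(a)=1\otimes a+a\otimes 1$ (homologous to $1\otimes a$). The pairing is $\langle X,\alpha\rangle:=i_X\alpha\in H_0(\mathcal{A},\mathcal{A})$. Let $E(\mathcal{A}):=H^1(\mathcal{A},\mathcal{A})\oplus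 H_1(\mathcal{A},\mathcal{A})$. The Courant bracket on $\mathcal{A}$ is the bracket on $E(\mathcal{A})$ given by $[\![(X_1,\alpha_1),(X_2,\alpha_2)]\!]=([X_1,X_2],\ \mathcal{L}_{X_1}\alpha_2-\mathcal{L}_{X_2}\alpha_1+B\langle X_2,\alpha_1\rangle)$, and the $H_0(\mathcal{A},\mathcal{A})$-valued symmetric bilinear form on $E(\mathcal{A})$ is $((X_1,\alpha_1),(X_2,\alpha_2))=\langle X_2,\alpha_1\rangle+\langle X_1,\alpha_2\rangle$. Let $J=\{e\in E(\mathcal{A}): (e,e')=0\text{ for all }e'\in E(\mathcal{A})\}$; it is an ideal for the Courant bracket. Put $\varepsilon(\mathcal{A}):=E(\mathcal{A})/J$ with the induced Courant bracket and induced nondegenerate bilinear form. A submodule $L\subset\varepsilon(\mathcal{A})$ is isotropic if the form vanishes on $L\times L$; an isotropic $L$ is maximally isotropic if every $e\in\varepsilon(\mathcal{A})$ with $(e,l)=0$ for all $l\in L$ lies in $L$. If $\varepsilon(\mathcal{A})\ne0$, a Dirac structure on $\mathcal{A}$ is a maximally isotropic submodule $L$ of $\varepsilon(\mathcal{A})$ that is closed under the induced Courant bracket. (If $\varepsilon(\mathcal{A})=0$, there are by convention no Dirac structures on $\mathcal{A}$.) *)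

theory Defs
  imports "HOL-Algebra.Module" "HOL-Algebra.AbelCoset" "HOL-Algebra.Free_Abelian_Groups"
begin

locale assoc_algebra = module R A + ring A
  for R :: "('k, 'x) ring_scheme" (structure) and A :: "('k, 'a, 'y) module_scheme" (structure) +
  assumes smult_mult_left:
      "\<lbrakk>c \<in> carrier R; x \<in> carrier A; y \<in> carrier A\<rbrakk> \<Longrightarrow>
        (c \<odot>\<^bsub>A\<^esub> x) \<otimes>\<^bsub>A\<^esub> y = c \<odot>\<^bsub>A\<^esub> (x \<otimes>\<^bsub>A\<^esub> y)"
    and smult_mult_right:
      "\<lbrakk>c \<in> carrier R; x \<in> carrier A; y \<in> carrier A\<rbrakk> \<Longrightarrow>
        x \<otimes>\<^bsub>A\<^esub> (c \<odot>\<^bsub>A\<^esub> y) = c \<odot>\<^bsub>A\<^esub> (x \<otimes>\<^bsub>A\<^esub> y)"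

text \<open>Matrices over \<open>A\<close> are extensional functions on pairs of indices below \<open>r\<close>.\<close>

definition matrix_algebra :: "('k, 'a) module \<Rightarrow> nat \<Rightarrow> ('k, nat \<times> nat \<Rightarrow> 'a) module" where
  "matrix_algebra A r = \<lparr>
     carrier = ({..<r} \<times> {..<r}) \<rightarrow>\<^sub>E carrier A,
     monoid.mult = (\<lambda>M N. \<lambda>(i, j)\<in>{..<r} \<times> {..<r}. \<Oplus>\<^bsub>A\<^esub>l\<in>{..<r}. M (i, l) \<otimes>\<^bsub>A\<^esub> N (l, j)),
     one = (\<lambda>(i, j)\<in>{..<r} \<times> {..<r}. if i = j then \<one>\<^bsub>A\<^esub> else \<zero>\<^bsub>A\<^esub>),
     ring.zero = (\<lambda>_\<in>{..<r} \<times> {..<r}. \<zero>\<^bsub>A\<^esub>),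
     ring.add = (\<lambda>M N. \<lambda>p\<in>{..<r} \<times> {..<r}. M p \<oplus>\<^bsub>A\<^esub> N p),
     smult = (\<lambda>c M. \<lambda>p\<in>{..<r} \<times> {..<r}. c \<odot>\<^bsub>A\<^esub> M p) \<rparr>"


section \<open>Modules\<close>

text \<open>HOL-Algebra represents modules by records that extend rings. In the modules built here the
  fields \<open>mult\<close> and \<open>one\<close> play no role and are left \<open>undefined\<close>.\<close>

definition module_hom ::
    "('k, 'x) ring_scheme \<Rightarrow> ('k, 'm) module \<Rightarrow> ('k, 'n) module \<Rightarrow> ('m \<Rightarrow> 'n) set" where
  "module_hom R M N = {h \<in> carrier M \<rightarrow> carrier N.
     (\<forall>x\<in>carrier M. \<forall>y\<in>carrier M. h (x \<oplus>\<^bsub>M\<^esub> y) = h x \<oplus>\<^bsub>N\<^esub> h y) \<and>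
     (\<forall>c\<in>carrier R. \<forall>x\<in>carrier M. h (c \<odot>\<^bsub>M\<^esub> x) = c \<odot>\<^bsub>N\<^esub> h x)}"

definition module_iso ::
    "('k, 'x) ring_scheme \<Rightarrow> ('k, 'm) module \<Rightarrow> ('k, 'n) module \<Rightarrow> ('m \<Rightarrow> 'n) set" where
  "module_iso R M N = {h \<in> module_hom R M N. bij_betw h (carrier M) (carrier N)}"

definition quotient_module :: "('k, 'm) module \<Rightarrow> 'm set \<Rightarrow> ('k, 'm set) module" where
  "quotient_module M N = \<lparr>
     carrier = a_rcosets\<^bsub>M\<^esub> N,
     monoid.mult = undefined,
     one = undefined,
     ring.zero = N,
     ring.add = (\<lambda>X Y. X <+>\<^bsub>M\<^esub> Y),
     smult = (\<lambda>c X. \<Union>x\<in>X. N +>\<^bsub>M\<^esub> (c \<odot>\<^bsub>M\<^esub> x)) \<rparr>"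

definition direct_sum :: "('k, 'm) module \<Rightarrow> ('k, 'n) module \<Rightarrow> ('k, 'm \<times> 'n) module" where
  "direct_sum M N = \<lparr>
     carrier = carrier M \<times> carrier N,
     monoid.mult = undefined,
     one = undefined,
     ring.zero = (\<zero>\<^bsub>M\<^esub>, \<zero>\<^bsub>N\<^esub>),
     ring.add = (\<lambda>(x, y) (x', y'). (x \<oplus>\<^bsub>M\<^esub> x', y \<oplus>\<^bsub>N\<^esub> y')),
     smult = (\<lambda>c (x, y). (c \<odot>\<^bsub>M\<^esub> x, c \<odot>\<^bsub>N\<^esub> y)) \<rparr>"

text \<open>The value on a coset (or pair of cosets) of a function that is constant on cosets;
  unspecified if the function is not constant there.\<close>

definition descend :: "('a \<Rightarrow> 'b) \<Rightarrow> 'a set \<Rightarrow> 'b" where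
  "descend f X = the_elem (f ` X)"

definition descend2 :: "('a \<Rightarrow> 'b \<Rightarrow> 'c) \<Rightarrow> 'a set \<Rightarrow> 'b set \<Rightarrow> 'c" where
  "descend2 f X Y = the_elem ((\<lambda>(x, y). f x y) ` (X \<times> Y))"


section \<open>Tensor products\<close>

text \<open>The tensor product of two modules over the commutative ring \<open>R\<close> is the free abelian group on
  pairs modulo biadditivity and the balancing relation, with scalars acting on the left factor.
  The scalar action of \<open>pair_module\<close> becomes a module structure only in the quotient.\<close>

definition pair_module ::
    "('k, 'm) module \<Rightarrow> ('k, 'n) module \<Rightarrow> ('k, ('m \<times> 'n) \<Rightarrow>\<^sub>0 int) module" where
  "pair_module M N = \<lparr>
     carrier = carrier (free_Abelian_group (carrier M \<times> carrier N)),
     monoid.mult = undefined,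
     one = undefined,
     ring.zero = 0,
     ring.add = (+),
     smult = (\<lambda>c. frag_extend (\<lambda>(x, y). frag_of (c \<odot>\<^bsub>M\<^esub> x, y))) \<rparr>"

definition tensor_relations ::
    "('k, 'x) ring_scheme \<Rightarrow> ('k, 'm) module \<Rightarrow> ('k, 'n) module \<Rightarrow> (('m \<times> 'n) \<Rightarrow>\<^sub>0 int) set" where
  "tensor_relations R M N = generate (free_Abelian_group (carrier M \<times> carrier N))
    ({frag_of (x \<oplus>\<^bsub>M\<^esub> x', y) - frag_of (x, y) - frag_of (x', y) | x x' y.
        x \<in> carrier M \<and> x' \<in> carrier M \<and> y \<in> carrier N} \<union>
     {frag_of (x, y \<oplus>\<^bsub>N\<^esub> y') - frag_of (x, y) - frag_of (x, y') | x y y'.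
        x \<in> carrier M \<and> y \<in> carrier N \<and> y' \<in> carrier N} \<union>
     {frag_of (c \<odot>\<^bsub>M\<^esub> x, y) - frag_of (x, c \<odot>\<^bsub>N\<^esub> y) | c x y.
        c \<in> carrier R \<and> x \<in> carrier M \<and> y \<in> carrier N})"

definition tensor_module ::
    "('k, 'x) ring_scheme \<Rightarrow> ('k, 'm) module \<Rightarrow> ('k, 'n) module \<Rightarrow>
     ('k, (('m \<times> 'n) \<Rightarrow>\<^sub>0 int) set) module" where
  "tensor_module R M N = quotient_module (pair_module M N) (tensor_relations R M N)"

definition tensor ::
    "('k, 'x) ring_scheme \<Rightarrow> ('k, 'm) module \<Rightarrow> ('k, 'n) module \<Rightarrow> 'm \<Rightarrow> 'n \<Rightarrow>
     (('m \<times> 'n) \<Rightarrow>\<^sub>0 int) set" where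
  "tensor R M N x y = tensor_relations R M N +>\<^bsub>pair_module M N\<^esub> frag_of (x, y)"

text \<open>For \<open>f\<close> bilinear with values in \<open>G\<close>, \<open>tensor_lift G f\<close> is the linear map on the tensor
  product that sends each pure tensor of \<open>x\<close> and \<open>y\<close> to \<open>f x y\<close>.\<close>

definition free_lift ::
    "('g, 'y) ring_scheme \<Rightarrow> ('b \<Rightarrow> 'g) \<Rightarrow> ('b \<Rightarrow>\<^sub>0 int) \<Rightarrow> 'g" where
  "free_lift G f w = (\<Oplus>\<^bsub>G\<^esub>p\<in>Poly_Mapping.keys w. [Poly_Mapping.lookup w p] \<cdot>\<^bsub>G\<^esub> f p)"

definition tensor_lift ::
    "('g, 'y) ring_scheme \<Rightarrow> ('m \<Rightarrow> 'n \<Rightarrow> 'g) \<Rightarrow> (('m \<times> 'n) \<Rightarrow>\<^sub>0 int) set \<Rightarrow> 'g" where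
  "tensor_lift G f = descend (free_lift G (\<lambda>(x, y). f x y))"


section \<open>Hochschild homology in degrees 0 and 1\<close>

text \<open>Degrees 0 and 1 involve only the chain modules \<open>C\<^sub>0 = A\<close>, \<open>C1\<close> and \<open>C2\<close>. \<open>Z1\<close> are the
  cycles in degree 1; \<open>B0\<close> (the commutators \<open>[A, A]\<close>) and \<open>B1\<close> are the boundaries.\<close>

type_synonym 'a chain1 = "(('a \<times> 'a) \<Rightarrow>\<^sub>0 int) set"
type_synonym 'a chain2 = "(('a \<times> 'a chain1) \<Rightarrow>\<^sub>0 int) set"

definition C1 :: "('k, 'x) ring_scheme \<Rightarrow> ('k, 'a) module \<Rightarrow> ('k, 'a chain1) module" where
  "C1 R A = tensor_module R A A"

definition C2 :: "('k, 'x) ring_scheme \<Rightarrow> ('k, 'a) module \<Rightarrow> ('k, 'a chain2) module" where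
  "C2 R A = tensor_module R A (tensor_module R A A)"

definition boundary1 :: "('k, 'a) module \<Rightarrow> 'a chain1 \<Rightarrow> 'a" where
  "boundary1 A = tensor_lift A (\<lambda>a0 a1. a0 \<otimes>\<^bsub>A\<^esub> a1 \<ominus>\<^bsub>A\<^esub> a1 \<otimes>\<^bsub>A\<^esub> a0)"

definition boundary2 ::
    "('k, 'x) ring_scheme \<Rightarrow> ('k, 'a) module \<Rightarrow> 'a chain2 \<Rightarrow> 'a chain1" where
  "boundary2 R A = tensor_lift (C1 R A) (\<lambda>a0. tensor_lift (C1 R A) (\<lambda>a1 a2.
     tensor R A A (a0 \<otimes>\<^bsub>A\<^esub> a1) a2 \<ominus>\<^bsub>C1 R A\<^esub> tensor R A A a0 (a1 \<otimes>\<^bsub>A\<^esub> a2)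
       \<oplus>\<^bsub>C1 R A\<^esub> tensor R A A (a2 \<otimes>\<^bsub>A\<^esub> a0) a1))"

definition B0 :: "('k, 'x) ring_scheme \<Rightarrow> ('k, 'a) module \<Rightarrow> 'a set" where
  "B0 R A = boundary1 A ` carrier (C1 R A)"

definition B1 :: "('k, 'x) ring_scheme \<Rightarrow> ('k, 'a) module \<Rightarrow> 'a chain1 set" where
  "B1 R A = boundary2 R A ` carrier (C2 R A)"

definition Z1 :: "('k, 'x) ring_scheme \<Rightarrow> ('k, 'a) module \<Rightarrow> ('k, 'a chain1) module" where
  "Z1 R A = (C1 R A) \<lparr>carrier := {c \<in> carrier (C1 R A). boundary1 A c = \<zero>\<^bsub>A\<^esub>}\<rparr>"

definition HH0 :: "('k, 'x) ring_scheme \<Rightarrow> ('k, 'a) module \<Rightarrow> ('k, 'a set) module" where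
  "HH0 R A = quotient_module A (B0 R A)"

definition HH1 :: "('k, 'x) ring_scheme \<Rightarrow> ('k, 'a) module \<Rightarrow> ('k, 'a chain1 set) module" where
  "HH1 R A = quotient_module (Z1 R A) (B1 R A)"


section \<open>Derivations and first Hochschild cohomology\<close>

text \<open>Derivations are extensional on \<open>carrier A\<close>, so that they are determined by their values there.\<close>

definition Der :: "('k, 'x) ring_scheme \<Rightarrow> ('k, 'a) module \<Rightarrow> ('k, 'a \<Rightarrow> 'a) module" where
  "Der R A = \<lparr>
     carrier = {X \<in> module_hom R A A \<inter> extensional (carrier A).
       \<forall>a\<in>carrier A. \<forall>b\<in>carrier A. X (a \<otimes>\<^bsub>A\<^esub> b) = X a \<otimes>\<^bsub>A\<^esub> b \<oplus>\<^bsub>A\<^esub> a \<otimes>\<^bsub>A\<^esub> X b},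
     monoid.mult = undefined,
     one = undefined,
     ring.zero = (\<lambda>_\<in>carrier A. \<zero>\<^bsub>A\<^esub>),
     ring.add = (\<lambda>X Y. \<lambda>a\<in>carrier A. X a \<oplus>\<^bsub>A\<^esub> Y a),
     smult = (\<lambda>c X. \<lambda>a\<in>carrier A. c \<odot>\<^bsub>A\<^esub> X a) \<rparr>"

definition inner_derivation :: "('k, 'a) module \<Rightarrow> 'a \<Rightarrow> 'a \<Rightarrow> 'a" where
  "inner_derivation A a = (\<lambda>x\<in>carrier A. a \<otimes>\<^bsub>A\<^esub> x \<ominus>\<^bsub>A\<^esub> x \<otimes>\<^bsub>A\<^esub> a)"

definition Inn :: "('k, 'a) module \<Rightarrow> ('a \<Rightarrow> 'a) set" where
  "Inn A = inner_derivation A ` carrier A"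

definition der_commutator :: "('k, 'a) module \<Rightarrow> ('a \<Rightarrow> 'a) \<Rightarrow> ('a \<Rightarrow> 'a) \<Rightarrow> 'a \<Rightarrow> 'a" where
  "der_commutator A X Y = (\<lambda>a\<in>carrier A. X (Y a) \<ominus>\<^bsub>A\<^esub> Y (X a))"

definition HC1 :: "('k, 'x) ring_scheme \<Rightarrow> ('k, 'a) module \<Rightarrow> ('k, ('a \<Rightarrow> 'a) set) module" where
  "HC1 R A = quotient_module (Der R A) (Inn A)"

definition lie_bracket ::
    "('k, 'x) ring_scheme \<Rightarrow> ('k, 'a) module \<Rightarrow> ('a \<Rightarrow> 'a) set \<Rightarrow> ('a \<Rightarrow> 'a) set \<Rightarrow> ('a \<Rightarrow> 'a) set" where
  "lie_bracket R A = descend2 (\<lambda>X Y. Inn A +>\<^bsub>Der R A\<^esub> der_commutator A X Y)"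


section \<open>Operations on homology\<close>

definition lie_chain ::
    "('k, 'x) ring_scheme \<Rightarrow> ('k, 'a) module \<Rightarrow> ('a \<Rightarrow> 'a) \<Rightarrow> 'a chain1 \<Rightarrow> 'a chain1" where
  "lie_chain R A X = tensor_lift (C1 R A)
     (\<lambda>a0 a1. tensor R A A (X a0) a1 \<oplus>\<^bsub>C1 R A\<^esub> tensor R A A a0 (X a1))"

definition lie_derivative ::
    "('k, 'x) ring_scheme \<Rightarrow> ('k, 'a) module \<Rightarrow> ('a \<Rightarrow> 'a) set \<Rightarrow> 'a chain1 set \<Rightarrow> 'a chain1 set" where
  "lie_derivative R A = descend2 (\<lambda>X c. B1 R A +>\<^bsub>Z1 R A\<^esub> lie_chain R A X c)"

definition interior_chain :: "('k, 'a) module \<Rightarrow> ('a \<Rightarrow> 'a) \<Rightarrow> 'a chain1 \<Rightarrow> 'a" where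
  "interior_chain A X = tensor_lift A (\<lambda>a0 a1. X a1 \<otimes>\<^bsub>A\<^esub> a0)"

definition pairing ::
    "('k, 'x) ring_scheme \<Rightarrow> ('k, 'a) module \<Rightarrow> ('a \<Rightarrow> 'a) set \<Rightarrow> 'a chain1 set \<Rightarrow> 'a set" where
  "pairing R A = descend2 (\<lambda>X c. B0 R A +>\<^bsub>A\<^esub> interior_chain A X c)"

definition connes_B ::
    "('k, 'x) ring_scheme \<Rightarrow> ('k, 'a) module \<Rightarrow> 'a set \<Rightarrow> 'a chain1 set" where
  "connes_B R A = descend (\<lambda>a. B1 R A +>\<^bsub>Z1 R A\<^esub>
     (tensor R A A \<one>\<^bsub>A\<^esub> a \<oplus>\<^bsub>C1 R A\<^esub> tensor R A A a \<one>\<^bsub>A\<^esub>))"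


section \<open>The Courant bracket and Dirac structures\<close>

type_synonym 'a courant = "('a \<Rightarrow> 'a) set \<times> 'a chain1 set"

definition E :: "('k, 'x) ring_scheme \<Rightarrow> ('k, 'a) module \<Rightarrow> ('k, 'a courant) module" where
  "E R A = direct_sum (HC1 R A) (HH1 R A)"

definition E_bracket ::
    "('k, 'x) ring_scheme \<Rightarrow> ('k, 'a) module \<Rightarrow> 'a courant \<Rightarrow> 'a courant \<Rightarrow> 'a courant" where
  "E_bracket R A = (\<lambda>(X1, \<alpha>1) (X2, \<alpha>2).
     (lie_bracket R A X1 X2,
      lie_derivative R A X1 \<alpha>2 \<ominus>\<^bsub>HH1 R A\<^esub> lie_derivative R A X2 \<alpha>1
        \<oplus>\<^bsub>HH1 R A\<^esub> connes_B R A (pairing R A X2 \<alpha>1)))"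

definition E_form ::
    "('k, 'x) ring_scheme \<Rightarrow> ('k, 'a) module \<Rightarrow> 'a courant \<Rightarrow> 'a courant \<Rightarrow> 'a set" where
  "E_form R A = (\<lambda>(X1, \<alpha>1) (X2, \<alpha>2). pairing R A X2 \<alpha>1 \<oplus>\<^bsub>HH0 R A\<^esub> pairing R A X1 \<alpha>2)"

definition J :: "('k, 'x) ring_scheme \<Rightarrow> ('k, 'a) module \<Rightarrow> 'a courant set" where
  "J R A = {e \<in> carrier (E R A). \<forall>e'\<in>carrier (E R A). E_form R A e e' = \<zero>\<^bsub>HH0 R A\<^esub>}"

definition eps :: "('k, 'x) ring_scheme \<Rightarrow> ('k, 'a) module \<Rightarrow> ('k, 'a courant set) module" where
  "eps R A = quotient_module (E R A) (J R A)"

definition eps_bracket ::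
    "('k, 'x) ring_scheme \<Rightarrow> ('k, 'a) module \<Rightarrow>
     'a courant set \<Rightarrow> 'a courant set \<Rightarrow> 'a courant set" where
  "eps_bracket R A = descend2 (\<lambda>e e'. J R A +>\<^bsub>E R A\<^esub> E_bracket R A e e')"

definition eps_form ::
    "('k, 'x) ring_scheme \<Rightarrow> ('k, 'a) module \<Rightarrow> 'a courant set \<Rightarrow> 'a courant set \<Rightarrow> 'a set" where
  "eps_form R A = descend2 (E_form R A)"

definition isotropic ::
    "('k, 'x) ring_scheme \<Rightarrow> ('k, 'a) module \<Rightarrow> 'a courant set set \<Rightarrow> bool" where
  "isotropic R A L \<longleftrightarrow> (\<forall>l\<in>L. \<forall>l'\<in>L. eps_form R A l l' = \<zero>\<^bsub>HH0 R A\<^esub>)"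

definition maximally_isotropic ::
    "('k, 'x) ring_scheme \<Rightarrow> ('k, 'a) module \<Rightarrow> 'a courant set set \<Rightarrow> bool" where
  "maximally_isotropic R A L \<longleftrightarrow> isotropic R A L \<and>
     (\<forall>e\<in>carrier (eps R A). (\<forall>l\<in>L. eps_form R A e l = \<zero>\<^bsub>HH0 R A\<^esub>) \<longrightarrow> e \<in> L)"

definition dirac_structures ::
    "('k, 'x) ring_scheme \<Rightarrow> ('k, 'a) module \<Rightarrow> 'a courant set set set" where
  "dirac_structures R A = {L. carrier (eps R A) \<noteq> {\<zero>\<^bsub>eps R A\<^esub>} \<and>
     submodule L R (eps R A) \<and> maximally_isotropic R A L \<and>
     (\<forall>l\<in>L. \<forall>l'\<in>L. eps_bracket R A l l' \<in> L)}"

end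

theory Submission
  imports Defs
begin

text \<open>
  Hochschild homology and cohomology are Morita invariant. For the corner embedding
  \<open>inc\<close> of \<open>A\<close> into its matrix algebra, \<open>a \<mapsto> a E\<^sub>0\<^sub>0\<close>, and the entrywise extension
  \<open>ext\<close> of derivations, the map \<open>(X, \<alpha>) \<mapsto> (ext X, inc \<alpha>)\<close> commutes strictly with the commutator of
  derivations, the Lie derivative and the interior product, already on chains. Connes' map is
  the one operation that involves the unit, which \<open>inc\<close> does not preserve; it is
  compatible up to an explicit boundary (\<open>connes_inc\<close>). Hence the map preserves the Courant bracket, and it
  preserves the form up to the map \<open>\<phi>\<close> that \<open>inc\<close> induces in degree 0.

  The operations on homology are bilinear, so they are well defined once they vanish when one
  representative is a boundary or an inner derivation (\<open>descend2_bilinear\<close>). The radical \<open>J\<close> is an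
  ideal (\<open>J_ideal\<close>) because of Cartan's formula \<open>i_[X,Y] = L_X i_Y - i_Y L_X\<close>, where \<open>L_X = i_X B\<close> in
  degree 0 (\<open>cartan\<close>). Injectivity on the quotients by the radicals is a consequence of
  nondegeneracy: if \<open>\<phi>\<close> is injective and the image pairs to zero with everything, then so does the
  original element (\<open>\<Psi>E_J_iff\<close>). The remaining content is therefore surjectivity on both
  summands, and bijectivity of \<open>\<phi>\<close>.

  Surjectivity on homology comes from the decomposition \<open>1 = \<Sum>j. u\<^sub>j v\<^sub>j\<close> with \<open>u\<^sub>j = E\<^sub>j\<^sub>0\<close> and
  \<open>v\<^sub>j = E\<^sub>0\<^sub>j\<close>: inserting it twice into \<open>m \<otimes> n\<close> gives, modulo boundaries, a tensor of matrix entries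
  \<open>v\<^sub>k m u\<^sub>j\<close>, which lie in the corner, and a term that depends only on the commutator
  of \<open>m\<close> and \<open>n\<close> (\<open>chain_into_corner\<close>). Surjectivity on derivations holds because every derivation \<open>Y\<close>
  of matrices becomes entrywise after subtracting the inner derivation by \<open>\<Sum>j. Y(u\<^sub>j) v\<^sub>j\<close>,
  which agrees with \<open>Y\<close> on all matrix units (\<open>ext_surj\<close>). The trace, a left inverse of \<open>inc\<close> that
  respects commutators, makes \<open>\<phi>\<close> injective (\<open>inc_reflects\<close>).
\<close>

section \<open>Linear maps and quotient modules\<close>

lemma (in abelian_group) diff_eq_iff:
  "x \<in> carrier G \<Longrightarrow> y \<in> carrier G \<Longrightarrow> z \<in> carrier G \<Longrightarrow> x \<ominus> y = z \<longleftrightarrow> x = z \<oplus> y"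
  by (auto simp: a_minus_def a_assoc l_neg r_neg)

lemma (in abelian_group) diff_eq_zero_iff:
  "x \<in> carrier G \<Longrightarrow> y \<in> carrier G \<Longrightarrow> x \<ominus> y = \<zero> \<longleftrightarrow> x = y"
  by (simp add: diff_eq_iff)

lemma (in abelian_group) neg_zero: "\<ominus> \<zero> = \<zero>"
  by (rule minus_equality) auto

text \<open>This lets the proof method \<open>algebra\<close> normalise sums in chain modules and homology modules, which
  are abelian groups without a meaningful product.\<close>

lemmas (in abelian_group) abelian_group_simprules
  [algebra abelian_group "ring.zero G" "ring.add G" "a_inv G" "a_minus G"] =
  a_closed zero_closed a_inv_closed minus_closed a_assoc l_zero l_neg a_comm minus_eq
  r_zero r_neg r_neg2 r_neg1 minus_add minus_minus neg_zero a_lcomm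

locale linear_map = M: module R M + N: module R N
  for R :: "'k ring" and M :: "('k, 'm) module" and N :: "('k, 'n) module" and h +
  assumes hom: "h \<in> module_hom R M N"
begin

lemma closed [simp]: "x \<in> carrier M \<Longrightarrow> h x \<in> carrier N"
  using hom by (auto simp: module_hom_def)

lemma add: "x \<in> carrier M \<Longrightarrow> y \<in> carrier M \<Longrightarrow> h (x \<oplus>\<^bsub>M\<^esub> y) = h x \<oplus>\<^bsub>N\<^esub> h y"
  using hom by (auto simp: module_hom_def)

lemma smult: "c \<in> carrier R \<Longrightarrow> x \<in> carrier M \<Longrightarrow> h (c \<odot>\<^bsub>M\<^esub> x) = c \<odot>\<^bsub>N\<^esub> h x"
  using hom by (auto simp: module_hom_def)

lemma abelian_group_hom: "abelian_group_hom M N h"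
proof (rule abelian_group_homI)
  show "group_hom (add_monoid M) (add_monoid N) h"
    by (auto simp: group_hom_def group_hom_axioms_def add intro!: homI M.add.is_group N.add.is_group)
qed (rule M.abelian_group_axioms N.abelian_group_axioms)+

lemma zero: "h \<zero>\<^bsub>M\<^esub> = \<zero>\<^bsub>N\<^esub>"
  using abelian_group_hom.hom_zero[OF abelian_group_hom] .

lemma neg: "x \<in> carrier M \<Longrightarrow> h (\<ominus>\<^bsub>M\<^esub> x) = \<ominus>\<^bsub>N\<^esub> h x"
  using abelian_group_hom.hom_a_inv[OF abelian_group_hom] .

lemma diff: "x \<in> carrier M \<Longrightarrow> y \<in> carrier M \<Longrightarrow> h (x \<ominus>\<^bsub>M\<^esub> y) = h x \<ominus>\<^bsub>N\<^esub> h y"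
  by (simp add: a_minus_def add neg)

lemma finsum: "f \<in> I \<rightarrow> carrier M \<Longrightarrow> finite I \<Longrightarrow> h (finsum M f I) = finsum N (\<lambda>i. h (f i)) I"
proof (induction I rule: infinite_finite_induct)
  case (insert i I)
  then have "f i \<in> carrier M" "f \<in> I \<rightarrow> carrier M" by auto
  moreover from this have "(\<lambda>i. h (f i)) \<in> I \<rightarrow> carrier N" by (auto simp: Pi_iff)
  ultimately show ?case using insert
    by (simp add: add M.finsum_closed M.finsum_insert N.finsum_insert)
qed (auto simp: zero M.finsum_empty N.finsum_empty)

lemma image_submodule: "submodule (h ` carrier M) R N"
proof (rule N.submoduleI)
  show "\<zero>\<^bsub>N\<^esub> \<in> h ` carrier M" by (metis zero M.zero_closed imageI)
qed (auto simp flip: add neg smult)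

end

lemma linear_mapI:
  assumes "module R M" "module R N" "\<And>x. x \<in> carrier M \<Longrightarrow> h x \<in> carrier N"
    "\<And>x y. x \<in> carrier M \<Longrightarrow> y \<in> carrier M \<Longrightarrow> h (x \<oplus>\<^bsub>M\<^esub> y) = h x \<oplus>\<^bsub>N\<^esub> h y"
    "\<And>c x. c \<in> carrier R \<Longrightarrow> x \<in> carrier M \<Longrightarrow> h (c \<odot>\<^bsub>M\<^esub> x) = c \<odot>\<^bsub>N\<^esub> h x"
  shows "linear_map R M N h"
  using assms by (simp add: linear_map_def linear_map_axioms_def module_hom_def)

lemma linear_map_comp:
  assumes "linear_map R M N f" "linear_map R N P g"
  shows "linear_map R M P (\<lambda>x. g (f x))"
proof -
  interpret f: linear_map R M N f by fact
  interpret g: linear_map R N P g by fact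
  show ?thesis
    by (rule linear_mapI) (auto simp: f.add g.add f.smult g.smult
        intro: f.M.module_axioms g.N.module_axioms)
qed

lemma linear_bijI:
  assumes "linear_map R M N f" "\<And>x. x \<in> carrier M \<Longrightarrow> f x = \<zero>\<^bsub>N\<^esub> \<Longrightarrow> x = \<zero>\<^bsub>M\<^esub>"
    "\<And>y. y \<in> carrier N \<Longrightarrow> \<exists>x\<in>carrier M. f x = y"
  shows "bij_betw f (carrier M) (carrier N)"
proof -
  interpret f: linear_map R M N f by fact
  have "inj_on f (carrier M)"
  proof (rule inj_onI)
    fix x y assume xy: "x \<in> carrier M" "y \<in> carrier M" "f x = f y"
    then have "x \<ominus>\<^bsub>M\<^esub> y = \<zero>\<^bsub>M\<^esub>"
      by (intro assms(2)) (simp_all add: f.diff f.N.M.diff_eq_zero_iff)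
    then show "x = y" using xy by (simp add: f.M.M.diff_eq_zero_iff)
  qed
  then show ?thesis using assms(3) f.closed by (fastforce simp: bij_betw_def)
qed

text \<open>The quotient construction applied to a group with an additive scalar action that need not
  satisfy the module axioms; this generality covers the tensor product, whose scalar action is a
  module structure only modulo the relations.\<close>

locale quot = M: abelian_group M + sub: abelian_subgroup N M
  for K :: "'k set" and M :: "('k, 'm) module" and N +
  assumes smult_closed: "c \<in> K \<Longrightarrow> x \<in> carrier M \<Longrightarrow> c \<odot>\<^bsub>M\<^esub> x \<in> carrier M"
    and smult_r_distr: "c \<in> K \<Longrightarrow> x \<in> carrier M \<Longrightarrow> y \<in> carrier M \<Longrightarrow>
      c \<odot>\<^bsub>M\<^esub> (x \<oplus>\<^bsub>M\<^esub> y) = c \<odot>\<^bsub>M\<^esub> x \<oplus>\<^bsub>M\<^esub> c \<odot>\<^bsub>M\<^esub> y"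
    and smult_sub: "c \<in> K \<Longrightarrow> x \<in> N \<Longrightarrow> c \<odot>\<^bsub>M\<^esub> x \<in> N"
begin

abbreviation cls where "cls x \<equiv> N +>\<^bsub>M\<^esub> x"
abbreviation Q where "Q \<equiv> quotient_module M N"

lemma cls_eq_iff: "x \<in> carrier M \<Longrightarrow> y \<in> carrier M \<Longrightarrow> cls x = cls y \<longleftrightarrow> x \<ominus>\<^bsub>M\<^esub> y \<in> N"
  unfolding a_minus_def
  by (metis sub.a_rcos_module sub.a_repr_independence' sub.a_repr_independenceD)

lemma cls_self: "x \<in> carrier M \<Longrightarrow> x \<in> cls x"
  by (rule sub.a_rcos_self)

lemma mem_cls: "x \<in> carrier M \<Longrightarrow> y \<in> cls x \<longleftrightarrow> y \<in> carrier M \<and> cls y = cls x"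
  by (metis sub.a_elemrcos_carrier sub.a_repr_independence' sub.a_repr_independenceD)

lemma cls_zero_iff: "x \<in> carrier M \<Longrightarrow> cls x = N \<longleftrightarrow> x \<in> N"
  by (metis cls_self sub.a_rcos_const)

lemma carrier_Q: "carrier Q = cls ` carrier M"
  by (auto simp: quotient_module_def A_RCOSETS_def')

lemma cls_closed [simp]: "x \<in> carrier M \<Longrightarrow> cls x \<in> carrier Q"
  by (simp add: carrier_Q)

lemma zero_Q: "\<zero>\<^bsub>Q\<^esub> = cls \<zero>\<^bsub>M\<^esub>"
  by (simp add: quotient_module_def sub.a_rcos_const)

lemma add_cls: "x \<in> carrier M \<Longrightarrow> y \<in> carrier M \<Longrightarrow> cls x \<oplus>\<^bsub>Q\<^esub> cls y = cls (x \<oplus>\<^bsub>M\<^esub> y)"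
  by (simp add: quotient_module_def sub.a_rcos_sum)

lemma smult_cls:
  assumes "c \<in> K" "x \<in> carrier M"
  shows "c \<odot>\<^bsub>Q\<^esub> cls x = cls (c \<odot>\<^bsub>M\<^esub> x)"
proof -
  have "cls (c \<odot>\<^bsub>M\<^esub> y) = cls (c \<odot>\<^bsub>M\<^esub> x)" if "y \<in> cls x" for y
  proof -
    from that assms have y: "y \<in> carrier M" "y \<ominus>\<^bsub>M\<^esub> x \<in> N" by (auto simp: mem_cls cls_eq_iff)
    have "c \<odot>\<^bsub>M\<^esub> y = c \<odot>\<^bsub>M\<^esub> (y \<ominus>\<^bsub>M\<^esub> x \<oplus>\<^bsub>M\<^esub> x)"
      using y assms by (simp add: a_minus_def M.a_assoc M.l_neg)
    also have "\<dots> = c \<odot>\<^bsub>M\<^esub> (y \<ominus>\<^bsub>M\<^esub> x) \<oplus>\<^bsub>M\<^esub> c \<odot>\<^bsub>M\<^esub> x"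
      using y assms by (simp add: smult_r_distr)
    finally have "c \<odot>\<^bsub>M\<^esub> y \<ominus>\<^bsub>M\<^esub> c \<odot>\<^bsub>M\<^esub> x = c \<odot>\<^bsub>M\<^esub> (y \<ominus>\<^bsub>M\<^esub> x)"
      using y assms by (simp add: a_minus_def M.a_assoc M.r_neg smult_closed)
    then show ?thesis using y assms by (simp add: cls_eq_iff smult_closed smult_sub)
  qed
  then have "(\<Union>y\<in>cls x. cls (c \<odot>\<^bsub>M\<^esub> y)) = cls (c \<odot>\<^bsub>M\<^esub> x)"
    using cls_self[OF assms(2)] by blast
  then show ?thesis by (simp add: quotient_module_def)
qed

lemma abelian_group_Q: "abelian_group Q"
proof (rule abelian_groupI)
  fix X assume "X \<in> carrier Q"
  then obtain x where "x \<in> carrier M" "X = cls x" by (auto simp: carrier_Q)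
  then show "\<exists>Y\<in>carrier Q. Y \<oplus>\<^bsub>Q\<^esub> X = \<zero>\<^bsub>Q\<^esub>"
    by (intro bexI[of _ "cls (\<ominus>\<^bsub>M\<^esub> x)"]) (auto simp: add_cls zero_Q M.l_neg)
qed (auto simp: carrier_Q add_cls zero_Q M.a_ac)

lemma zero_Q': "\<zero>\<^bsub>Q\<^esub> = N"
  by (simp add: quotient_module_def)

lemma cls_eq_zero_iff: "x \<in> carrier M \<Longrightarrow> cls x = \<zero>\<^bsub>Q\<^esub> \<longleftrightarrow> x \<in> N"
  by (simp add: zero_Q' cls_zero_iff)

lemma descend_cls:
  assumes "x \<in> carrier M" "\<And>y. y \<in> carrier M \<Longrightarrow> cls y = cls x \<Longrightarrow> f y = f x"
  shows "descend f (cls x) = f x"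
proof -
  have "f y = f x" if "y \<in> cls x" for y
    using that assms mem_cls[OF assms(1)] by blast
  then have "f ` cls x = {f x}" using cls_self[OF assms(1)] by blast
  then show ?thesis by (simp add: descend_def)
qed

end

lemma descend2_cls:
  assumes "quot K M N" "quot K' M' N'" "x \<in> carrier M" "y \<in> carrier M'"
    and "\<And>x' y'. x' \<in> carrier M \<Longrightarrow> y' \<in> carrier M' \<Longrightarrow> N +>\<^bsub>M\<^esub> x' = N +>\<^bsub>M\<^esub> x \<Longrightarrow>
      N' +>\<^bsub>M'\<^esub> y' = N' +>\<^bsub>M'\<^esub> y \<Longrightarrow> f x' y' = f x y"
  shows "descend2 f (N +>\<^bsub>M\<^esub> x) (N' +>\<^bsub>M'\<^esub> y) = f x y"
proof -
  interpret one: quot K M N by fact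
  interpret two: quot K' M' N' by fact
  have "f x' y' = f x y" if "x' \<in> N +>\<^bsub>M\<^esub> x" "y' \<in> N' +>\<^bsub>M'\<^esub> y" for x' y'
    using that assms(3-) one.mem_cls[of x x'] two.mem_cls[of y y'] by blast
  then have "(\<lambda>(x, y). f x y) ` ((N +>\<^bsub>M\<^esub> x) \<times> (N' +>\<^bsub>M'\<^esub> y)) =
      (\<lambda>_. f x y) ` ((N +>\<^bsub>M\<^esub> x) \<times> (N' +>\<^bsub>M'\<^esub> y))"
    by (intro image_cong) auto
  also have "\<dots> = {f x y}"
    using one.cls_self[OF assms(3)] two.cls_self[OF assms(4)] by (simp add: image_constant_conv) blast
  finally show ?thesis by (simp add: descend2_def)
qed

locale module_quot = module R M + quot "carrier R" M N
  for R :: "'k ring" and M :: "('k, 'm) module" and N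
begin

lemma module_quotient: "module R Q"
  by (rule moduleI[OF R.cring_axioms abelian_group_Q])
     (auto simp: carrier_Q smult_cls add_cls smult_l_distr smult_r_distr smult_assoc1)

lemma cls_linear: "linear_map R M Q (\<lambda>x. cls x)"
  by (rule linear_mapI) (auto simp: add_cls smult_cls intro: module_axioms module_quotient)

lemma N_submodule: "submodule N R M"
  by (rule submoduleI) (auto simp: sub.a_Hcarr smult_sub)

sublocale proj: linear_map R M Q "\<lambda>x. cls x"
  by (rule cls_linear)

lemma linear_descend:
  assumes "linear_map R M P f" "\<And>x. x \<in> N \<Longrightarrow> f x = \<zero>\<^bsub>P\<^esub>"
  shows "\<And>x. x \<in> carrier M \<Longrightarrow> descend f (cls x) = f x" "linear_map R Q P (descend f)"
proof -
  interpret f: linear_map R M P f by fact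
  show *: "descend f (cls x) = f x" if "x \<in> carrier M" for x
  proof (rule descend_cls[OF that])
    fix y assume y: "y \<in> carrier M" "cls y = cls x"
    then have "f (y \<ominus>\<^bsub>M\<^esub> x) = \<zero>\<^bsub>P\<^esub>" using that by (simp add: cls_eq_iff assms)
    then show "f y = f x" using y that by (simp add: f.diff f.N.diff_eq_zero_iff)
  qed
  show "linear_map R Q P (descend f)"
    by (rule linear_mapI)
       (auto simp: carrier_Q * f.add f.smult add_cls smult_cls module_quotient f.N.module_axioms)
qed

end

lemma module_quotI:
  assumes "module R M" "submodule N R M"
  shows "module_quot R M N"
proof -
  interpret M: module R M by fact
  interpret N: submodule N R M by fact
  have "abelian_subgroup N M"
    by (rule abelian_subgroupI3)
       (auto intro: additive_subgroupI N.subgroup_axioms M.abelian_group_axioms)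
  then show ?thesis
    unfolding module_quot_def quot_def quot_axioms_def
    by (auto simp: M.module_axioms M.abelian_group_axioms M.smult_r_distr)
qed

section \<open>Tensor products\<close>

definition bilinear ::
    "('k, 'x) ring_scheme \<Rightarrow> ('k, 'm) module \<Rightarrow> ('k, 'n) module \<Rightarrow> ('k, 'p) module \<Rightarrow>
     ('m \<Rightarrow> 'n \<Rightarrow> 'p) \<Rightarrow> bool" where
  "bilinear R M N P f \<longleftrightarrow>
     (\<forall>x\<in>carrier M. f x \<in> module_hom R N P) \<and> (\<forall>y\<in>carrier N. (\<lambda>x. f x y) \<in> module_hom R M P)"

lemma bilinearI:
  assumes "\<And>x y. x \<in> carrier M \<Longrightarrow> y \<in> carrier N \<Longrightarrow> f x y \<in> carrier P"
    "\<And>x x' y. x \<in> carrier M \<Longrightarrow> x' \<in> carrier M \<Longrightarrow> y \<in> carrier N \<Longrightarrow>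
      f (x \<oplus>\<^bsub>M\<^esub> x') y = f x y \<oplus>\<^bsub>P\<^esub> f x' y"
    "\<And>x y y'. x \<in> carrier M \<Longrightarrow> y \<in> carrier N \<Longrightarrow> y' \<in> carrier N \<Longrightarrow>
      f x (y \<oplus>\<^bsub>N\<^esub> y') = f x y \<oplus>\<^bsub>P\<^esub> f x y'"
    "\<And>c x y. c \<in> carrier R \<Longrightarrow> x \<in> carrier M \<Longrightarrow> y \<in> carrier N \<Longrightarrow> f (c \<odot>\<^bsub>M\<^esub> x) y = c \<odot>\<^bsub>P\<^esub> f x y"
    "\<And>c x y. c \<in> carrier R \<Longrightarrow> x \<in> carrier M \<Longrightarrow> y \<in> carrier N \<Longrightarrow> f x (c \<odot>\<^bsub>N\<^esub> y) = c \<odot>\<^bsub>P\<^esub> f x y"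
  shows "bilinear R M N P f"
  using assms by (auto simp: bilinear_def module_hom_def)

lemma bilinearD:
  assumes "bilinear R M N P f"
  shows "\<And>x y. x \<in> carrier M \<Longrightarrow> y \<in> carrier N \<Longrightarrow> f x y \<in> carrier P"
    "\<And>x x' y. x \<in> carrier M \<Longrightarrow> x' \<in> carrier M \<Longrightarrow> y \<in> carrier N \<Longrightarrow>
      f (x \<oplus>\<^bsub>M\<^esub> x') y = f x y \<oplus>\<^bsub>P\<^esub> f x' y"
    "\<And>x y y'. x \<in> carrier M \<Longrightarrow> y \<in> carrier N \<Longrightarrow> y' \<in> carrier N \<Longrightarrow>
      f x (y \<oplus>\<^bsub>N\<^esub> y') = f x y \<oplus>\<^bsub>P\<^esub> f x y'"
    "\<And>c x y. c \<in> carrier R \<Longrightarrow> x \<in> carrier M \<Longrightarrow> y \<in> carrier N \<Longrightarrow> f (c \<odot>\<^bsub>M\<^esub> x) y = c \<odot>\<^bsub>P\<^esub> f x y"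
    "\<And>c x y. c \<in> carrier R \<Longrightarrow> x \<in> carrier M \<Longrightarrow> y \<in> carrier N \<Longrightarrow> f x (c \<odot>\<^bsub>N\<^esub> y) = c \<odot>\<^bsub>P\<^esub> f x y"
  using assms by (auto simp: bilinear_def module_hom_def)

lemma keys_diff_subset [simp]:
  "Poly_Mapping.keys v \<subseteq> S \<Longrightarrow> Poly_Mapping.keys w \<subseteq> S \<Longrightarrow> Poly_Mapping.keys (v - w) \<subseteq> S"
  for v w :: "'c \<Rightarrow>\<^sub>0 int"
  using keys_diff[of v w] by blast

lemma keys_add_subset [simp]:
  "Poly_Mapping.keys v \<subseteq> S \<Longrightarrow> Poly_Mapping.keys w \<subseteq> S \<Longrightarrow> Poly_Mapping.keys (v + w) \<subseteq> S"
  for v w :: "'c \<Rightarrow>\<^sub>0 int"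
  using keys_add[of v w] by blast

locale two_modules = M: module R M + N: module R N
  for R :: "'k ring" and M :: "('k, 'm) module" and N :: "('k, 'n) module"
begin

abbreviation F where "F \<equiv> free_Abelian_group (carrier M \<times> carrier N)"
abbreviation P where "P \<equiv> pair_module M N"
abbreviation Rel where "Rel \<equiv> tensor_relations R M N"
abbreviation T where "T \<equiv> tensor_module R M N"
abbreviation tens (infixl "\<otimes>t" 70) where "x \<otimes>t y \<equiv> tensor R M N x y"

interpretation F: group F by simp

lemma abelian_group_P: "abelian_group P"
proof (rule abelian_groupI)
  fix w assume "w \<in> carrier P"
  then show "\<exists>v\<in>carrier P. v \<oplus>\<^bsub>P\<^esub> w = \<zero>\<^bsub>P\<^esub>"
    by (intro bexI[of _ "- w"]) (auto simp: pair_module_def)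
qed (use keys_add in \<open>fastforce simp: pair_module_def add_ac\<close>)+

interpretation P: abelian_group P by (rule abelian_group_P)

lemma P_simps [simp]:
  "w \<in> carrier P \<longleftrightarrow> Poly_Mapping.keys w \<subseteq> carrier M \<times> carrier N"
  "v \<oplus>\<^bsub>P\<^esub> w = v + w" "\<zero>\<^bsub>P\<^esub> = 0"
  by (auto simp: pair_module_def)

lemma P_neg [simp]: "w \<in> carrier P \<Longrightarrow> \<ominus>\<^bsub>P\<^esub> w = - w"
  by (rule P.minus_equality) auto

lemma P_diff [simp]: "v \<in> carrier P \<Longrightarrow> w \<in> carrier P \<Longrightarrow> v \<ominus>\<^bsub>P\<^esub> w = v - w"
  by (simp add: a_minus_def)

definition gens where "gens =
    {frag_of (x \<oplus>\<^bsub>M\<^esub> x', y) - frag_of (x, y) - frag_of (x', y) | x x' y.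
        x \<in> carrier M \<and> x' \<in> carrier M \<and> y \<in> carrier N} \<union>
     {frag_of (x, y \<oplus>\<^bsub>N\<^esub> y') - frag_of (x, y) - frag_of (x, y') | x y y'.
        x \<in> carrier M \<and> y \<in> carrier N \<and> y' \<in> carrier N} \<union>
     {frag_of (c \<odot>\<^bsub>M\<^esub> x, y) - frag_of (x, c \<odot>\<^bsub>N\<^esub> y) | c x y.
        c \<in> carrier R \<and> x \<in> carrier M \<and> y \<in> carrier N}"

lemma gens_subset: "gens \<subseteq> carrier F"
  unfolding gens_def
  by (rule subsetI, elim UnE CollectE exE conjE;
      hypsubst; simp only: carrier_free_Abelian_group_iff; intro keys_diff_subset; simp)

lemma Rel_eq: "Rel = generate F gens"
  by (simp add: tensor_relations_def gens_def)

lemma smult_P_closed: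
  assumes "c \<in> carrier R" "w \<in> carrier P"
  shows "c \<odot>\<^bsub>P\<^esub> w \<in> carrier P"
  using assms keys_frag_extend[of "\<lambda>(x, y). frag_of (c \<odot>\<^bsub>M\<^esub> x, y)" w]
  by (fastforce simp: pair_module_def split: prod.splits)

lemma smult_P_add: "c \<odot>\<^bsub>P\<^esub> (v + w) = c \<odot>\<^bsub>P\<^esub> v + c \<odot>\<^bsub>P\<^esub> w"
  by (simp add: pair_module_def frag_extend_add)

lemma smult_P_diff: "c \<odot>\<^bsub>P\<^esub> (v - w) = c \<odot>\<^bsub>P\<^esub> v - c \<odot>\<^bsub>P\<^esub> w"
  by (simp add: pair_module_def frag_extend_diff)

lemma smult_P_of: "c \<odot>\<^bsub>P\<^esub> frag_of (x, y) = frag_of (c \<odot>\<^bsub>M\<^esub> x, y)"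
  by (simp add: pair_module_def)

lemma smult_P_zero: "c \<odot>\<^bsub>P\<^esub> 0 = 0"
  by (simp add: pair_module_def)

text \<open>Scaling the left factor turns each generating relation into another one; for the balancing
  relation this uses that the scalars commute.\<close>

lemma Rel_smult:
  assumes c: "c \<in> carrier R" and "w \<in> Rel"
  shows "c \<odot>\<^bsub>P\<^esub> w \<in> Rel"
proof -
  have gen: "c \<odot>\<^bsub>P\<^esub> w \<in> gens" if "w \<in> gens" for w
  proof -
    from that consider
        (1) x x' y where "w = frag_of (x \<oplus>\<^bsub>M\<^esub> x', y) - frag_of (x, y) - frag_of (x', y)"
          "x \<in> carrier M" "x' \<in> carrier M" "y \<in> carrier N"
      | (2) x y y' where "w = frag_of (x, y \<oplus>\<^bsub>N\<^esub> y') - frag_of (x, y) - frag_of (x, y')"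
          "x \<in> carrier M" "y \<in> carrier N" "y' \<in> carrier N"
      | (3) d x y where "w = frag_of (d \<odot>\<^bsub>M\<^esub> x, y) - frag_of (x, d \<odot>\<^bsub>N\<^esub> y)"
          "d \<in> carrier R" "x \<in> carrier M" "y \<in> carrier N"
      unfolding gens_def by blast
    then show ?thesis
    proof cases
      case 1
      then show ?thesis unfolding gens_def using c
        by (intro UnI1, simp add: smult_P_diff smult_P_of M.smult_r_distr) blast
    next
      case 2
      then show ?thesis unfolding gens_def using c
        by (intro UnI1 UnI2, simp add: smult_P_diff smult_P_of) blast
    next
      case 3
      have "c \<odot>\<^bsub>M\<^esub> (d \<odot>\<^bsub>M\<^esub> x) = d \<odot>\<^bsub>M\<^esub> (c \<odot>\<^bsub>M\<^esub> x)"
        using 3 c by (metis M.smult_assoc1 M.R.m_comm)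
      then show ?thesis unfolding gens_def using c 3
        by (intro UnI2, simp add: smult_P_diff smult_P_of) blast
    qed
  qed
  from \<open>w \<in> Rel\<close> show ?thesis
    unfolding Rel_eq
  proof (induction rule: generate.induct)
    case (inv h)
    have "h \<in> carrier F" "c \<odot>\<^bsub>P\<^esub> h \<in> carrier F" using gens_subset inv gen by blast+
    then have "inv\<^bsub>F\<^esub> h = 0 - h" "inv\<^bsub>F\<^esub> (c \<odot>\<^bsub>P\<^esub> h) = 0 - c \<odot>\<^bsub>P\<^esub> h" by simp_all
    then show ?case using generate.inv[OF gen[OF inv], of F] by (simp add: smult_P_diff smult_P_zero del: diff_0)
  next
    case (eng v w)
    then show ?case using generate.eng[of "c \<odot>\<^bsub>P\<^esub> v" F gens "c \<odot>\<^bsub>P\<^esub> w"] by (simp add: smult_P_add)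
  next
    case one
    then show ?case using generate.one[of F gens] by (simp add: smult_P_zero)
  qed (blast intro: generate.incl gen)
qed

sublocale tq: quot "carrier R" P Rel
proof -
  have Rel: "subgroup Rel F"
    unfolding Rel_eq by (rule F.generate_is_subgroup[OF gens_subset])
  have "subgroup Rel (add_monoid P)"
  proof (rule P.add.subgroupI)
    show "Rel \<subseteq> carrier P" using subgroup.subset[OF Rel] by auto
    show "Rel \<noteq> {}" using subgroup.one_closed[OF Rel] by auto
    fix v w assume vw: "v \<in> Rel" "w \<in> Rel"
    then show "v \<oplus>\<^bsub>P\<^esub> w \<in> Rel" using subgroup.m_closed[OF Rel] by auto
    have "v \<in> carrier F" using subgroup.subset[OF Rel] vw by blast
    then show "\<ominus>\<^bsub>P\<^esub> v \<in> Rel" using subgroup.m_inv_closed[OF Rel vw(1)] by auto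
  qed
  then have "abelian_subgroup Rel P"
    by (intro abelian_subgroupI3 additive_subgroupI P.abelian_group_axioms)
  then show "quot (carrier R) P Rel"
    unfolding quot_def quot_axioms_def
    by (auto simp: P.abelian_group_axioms smult_P_add Rel_smult simp del: P_simps(1) intro: smult_P_closed)
qed

lemma T_eq: "T = tq.Q" by (simp add: tensor_module_def)

lemma T_cases:
  assumes "u \<in> carrier T"
  obtains w where "w \<in> carrier P" "u = tq.cls w"
proof -
  from assms have "u \<in> tq.cls ` carrier P" by (simp only: T_eq tq.carrier_Q)
  then show ?thesis
  proof (rule imageE)
    fix w assume "u = tq.cls w" "w \<in> carrier P"
    then show ?thesis by (rule that[rotated])
  qed
qed

lemma tens_closed [simp]: "x \<in> carrier M \<Longrightarrow> y \<in> carrier N \<Longrightarrow> x \<otimes>t y \<in> carrier T"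
  by (auto simp: T_eq tensor_def intro!: tq.cls_closed)

interpretation T: abelian_group T
  using tq.abelian_group_Q by (simp add: T_eq)

lemma cls_diff:
  assumes "v \<in> carrier P" "w \<in> carrier P"
  shows "tq.cls (v - w) = tq.cls v \<ominus>\<^bsub>T\<^esub> tq.cls w"
proof -
  have "v - w \<in> carrier P" using assms by simp
  moreover from this have "tq.cls (v - w) \<oplus>\<^bsub>T\<^esub> tq.cls w = tq.cls v"
    unfolding T_eq using assms by (subst tq.add_cls) auto
  moreover have "tq.cls v \<in> carrier T" "tq.cls w \<in> carrier T" "tq.cls (v - w) \<in> carrier T"
    unfolding T_eq by (rule tq.cls_closed, fact)+
  ultimately show ?thesis
    using T.diff_eq_iff by metis
qed

lemma relation_eq:
  assumes "frag_of a - frag_of b - frag_of c \<in> gens"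
     "a \<in> carrier M \<times> carrier N" "b \<in> carrier M \<times> carrier N" "c \<in> carrier M \<times> carrier N"
  shows "tq.cls (frag_of a) = tq.cls (frag_of b) \<oplus>\<^bsub>T\<^esub> tq.cls (frag_of c)"
proof -
  have "frag_of a - (frag_of b + frag_of c) \<in> Rel"
    unfolding Rel_eq by (rule generate.incl) (use assms(1) in \<open>simp add: diff_diff_eq\<close>)
  then have "tq.cls (frag_of a) = tq.cls (frag_of b + frag_of c)"
    using assms by (subst tq.cls_eq_iff) simp_all
  then show ?thesis
    unfolding T_eq using assms by (subst tq.add_cls) auto
qed

lemma tens_add_left: "x \<in> carrier M \<Longrightarrow> x' \<in> carrier M \<Longrightarrow> y \<in> carrier N \<Longrightarrow>
    (x \<oplus>\<^bsub>M\<^esub> x') \<otimes>t y = x \<otimes>t y \<oplus>\<^bsub>T\<^esub> x' \<otimes>t y"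
  unfolding tensor_def by (rule relation_eq) (unfold gens_def, blast, auto)

lemma tens_add_right: "x \<in> carrier M \<Longrightarrow> y \<in> carrier N \<Longrightarrow> y' \<in> carrier N \<Longrightarrow>
    x \<otimes>t (y \<oplus>\<^bsub>N\<^esub> y') = x \<otimes>t y \<oplus>\<^bsub>T\<^esub> x \<otimes>t y'"
  unfolding tensor_def by (rule relation_eq) (unfold gens_def, blast, auto)

lemma tens_smult_left: "c \<in> carrier R \<Longrightarrow> x \<in> carrier M \<Longrightarrow> y \<in> carrier N \<Longrightarrow>
    (c \<odot>\<^bsub>M\<^esub> x) \<otimes>t y = c \<odot>\<^bsub>T\<^esub> (x \<otimes>t y)"
  unfolding tensor_def T_eq by (subst tq.smult_cls) (auto simp: smult_P_of)

lemma tens_smult_right: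
  assumes "c \<in> carrier R" "x \<in> carrier M" "y \<in> carrier N"
  shows "x \<otimes>t (c \<odot>\<^bsub>N\<^esub> y) = c \<odot>\<^bsub>T\<^esub> (x \<otimes>t y)"
proof -
  have "frag_of (c \<odot>\<^bsub>M\<^esub> x, y) - frag_of (x, c \<odot>\<^bsub>N\<^esub> y) \<in> Rel"
    unfolding Rel_eq gens_def by (rule generate.incl) (use assms in blast)
  then have "(c \<odot>\<^bsub>M\<^esub> x) \<otimes>t y = x \<otimes>t (c \<odot>\<^bsub>N\<^esub> y)"
    unfolding tensor_def using assms by (subst tq.cls_eq_iff) auto
  with tens_smult_left assms show ?thesis by simp
qed

lemma tens_neg_left:
  assumes "x \<in> carrier M" "y \<in> carrier N"
  shows "(\<ominus>\<^bsub>M\<^esub> x) \<otimes>t y = \<ominus>\<^bsub>T\<^esub> (x \<otimes>t y)"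
proof -
  have z: "\<zero>\<^bsub>M\<^esub> \<otimes>t y = \<zero>\<^bsub>T\<^esub>"
    using tens_add_left[of "\<zero>\<^bsub>M\<^esub>" "\<zero>\<^bsub>M\<^esub>" y] assms by (simp add: T.add.l_cancel_one')
  show ?thesis
    using tens_add_left[of "\<ominus>\<^bsub>M\<^esub> x" x y] assms z by (intro T.minus_equality[symmetric]) (auto simp: M.l_neg)
qed

text \<open>Negatives of pure tensors are pure tensors, so the tensor product consists of finite sums of
  pure tensors.\<close>

lemma tensor_induct [consumes 1, case_names pure add]:
  assumes "u \<in> carrier T"
    and pure: "\<And>x y. x \<in> carrier M \<Longrightarrow> y \<in> carrier N \<Longrightarrow> Q (x \<otimes>t y)"
    and add: "\<And>u v. u \<in> carrier T \<Longrightarrow> v \<in> carrier T \<Longrightarrow> Q u \<Longrightarrow> Q v \<Longrightarrow> Q (u \<oplus>\<^bsub>T\<^esub> v)"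
  shows "Q u"
proof -
  have "Q (tq.cls w) \<and> Q (\<ominus>\<^bsub>T\<^esub> tq.cls w)" if "Poly_Mapping.keys w \<subseteq> carrier M \<times> carrier N" for w
    using that
  proof (induction rule: free_Abelian_group_induct[consumes 1, case_names zero diff of])
    case zero
    have "\<zero>\<^bsub>M\<^esub> \<otimes>t \<zero>\<^bsub>N\<^esub> = \<zero>\<^bsub>T\<^esub>"
      using tens_add_left[of "\<zero>\<^bsub>M\<^esub>" "\<zero>\<^bsub>M\<^esub>" "\<zero>\<^bsub>N\<^esub>"] by (simp add: T.add.l_cancel_one')
    then have "Q \<zero>\<^bsub>T\<^esub>" "tq.cls 0 = \<zero>\<^bsub>T\<^esub>"
      using pure[of "\<zero>\<^bsub>M\<^esub>" "\<zero>\<^bsub>N\<^esub>"] tq.zero_Q by (simp_all add: T_eq)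
    then show ?case by (simp add: T.neg_zero)
  next
    case (diff v w)
    then have cl: "tq.cls v \<in> carrier T" "tq.cls w \<in> carrier T"
      by (auto simp: T_eq intro!: tq.cls_closed)
    have "Q (tq.cls v \<oplus>\<^bsub>T\<^esub> (\<ominus>\<^bsub>T\<^esub> tq.cls w))" "Q (\<ominus>\<^bsub>T\<^esub> tq.cls v \<oplus>\<^bsub>T\<^esub> tq.cls w)"
      using diff cl by (auto intro: add)
    then show ?case using diff cl by (auto simp: cls_diff a_minus_def T.minus_add)
  next
    case (of a)
    obtain x y where xy: "a = (x, y)" "x \<in> carrier M" "y \<in> carrier N" using of by auto
    then have "Q (x \<otimes>t y)" "Q ((\<ominus>\<^bsub>M\<^esub> x) \<otimes>t y)" using pure by auto
    then show ?case using xy tens_neg_left[of x y] by (simp add: tensor_def)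
  qed
  with assms(1) show ?thesis by (auto simp: T_eq tq.carrier_Q)
qed

lemma smult_T:
  assumes "c \<in> carrier R" "u \<in> carrier T"
  shows "c \<odot>\<^bsub>T\<^esub> u \<in> carrier T"
    and "v \<in> carrier T \<Longrightarrow> c \<odot>\<^bsub>T\<^esub> (u \<oplus>\<^bsub>T\<^esub> v) = c \<odot>\<^bsub>T\<^esub> u \<oplus>\<^bsub>T\<^esub> c \<odot>\<^bsub>T\<^esub> v"
proof -
  obtain w where w: "w \<in> carrier P" "u = tq.cls w" using assms(2) by (rule T_cases)
  then show "c \<odot>\<^bsub>T\<^esub> u \<in> carrier T"
    using assms by (simp add: T_eq tq.smult_cls tq.smult_closed del: P_simps)
  assume "v \<in> carrier T"
  then obtain w' where "w' \<in> carrier P" "v = tq.cls w'" by (rule T_cases)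
  then show "c \<odot>\<^bsub>T\<^esub> (u \<oplus>\<^bsub>T\<^esub> v) = c \<odot>\<^bsub>T\<^esub> u \<oplus>\<^bsub>T\<^esub> c \<odot>\<^bsub>T\<^esub> v"
    using w assms P.a_closed
    by (simp add: T_eq tq.smult_cls tq.smult_closed tq.add_cls tq.smult_r_distr del: P_simps)
qed

lemma module_T: "module R T"
proof (rule moduleI[OF M.R.cring_axioms T.abelian_group_axioms])
  fix c d u assume cd: "c \<in> carrier R" "d \<in> carrier R" and u: "u \<in> carrier T"
  from u cd show "(c \<oplus>\<^bsub>R\<^esub> d) \<odot>\<^bsub>T\<^esub> u = c \<odot>\<^bsub>T\<^esub> u \<oplus>\<^bsub>T\<^esub> d \<odot>\<^bsub>T\<^esub> u"
  proof (induction rule: tensor_induct)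
    case (pure x y)
    then show ?case by (simp add: M.smult_l_distr tens_add_left flip: tens_smult_left)
  next
    case (add u v)
    then show ?case by (simp add: smult_T T.a_ac)
  qed
  from u cd show "(c \<otimes>\<^bsub>R\<^esub> d) \<odot>\<^bsub>T\<^esub> u = c \<odot>\<^bsub>T\<^esub> (d \<odot>\<^bsub>T\<^esub> u)"
  proof (induction rule: tensor_induct)
    case (pure x y)
    then show ?case by (simp add: M.smult_assoc1 flip: tens_smult_left)
  next
    case (add u v)
    then show ?case by (simp add: smult_T)
  qed
next
  fix u assume "u \<in> carrier T"
  then show "\<one>\<^bsub>R\<^esub> \<odot>\<^bsub>T\<^esub> u = u"
  proof (induction rule: tensor_induct)
    case (pure x y)
    then show ?case by (simp flip: tens_smult_left)
  next
    case (add u v)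
    then show ?case by (simp add: smult_T)
  qed
qed (simp_all add: smult_T)

lemma bilinear_tens: "bilinear R M N T (\<lambda>x y. x \<otimes>t y)"
  by (rule bilinearI) (simp_all add: tens_add_left tens_add_right tens_smult_left tens_smult_right)

end

text \<open>A homomorphism on the free abelian group is determined by its values on the generators, so
  the sum defining \<open>free_lift\<close> computes the homomorphism given by the universal property.\<close>

lemma free_lift_hom:
  assumes "abelian_group G" and f: "\<And>p. p \<in> S \<Longrightarrow> f p \<in> carrier G"
  shows "free_lift G f \<in> hom (free_Abelian_group S) (add_monoid G)"
    and "p \<in> S \<Longrightarrow> free_lift G f (frag_of p) = f p"
proof -
  interpret G: abelian_group G by fact
  interpret F: comm_group "free_Abelian_group S" by (rule abelian_free_Abelian_group)
  have fS: "f ` S \<subseteq> carrier (add_monoid G)" using f by auto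
  obtain h where h: "h \<in> hom (free_Abelian_group S) (add_monoid G)"
      and h_of: "\<And>p. p \<in> S \<Longrightarrow> h (frag_of p) = f p"
    by (rule comm_group.free_Abelian_group_universal[OF G.a_comm_group fS]) auto
  interpret h: group_hom "free_Abelian_group S" "add_monoid G" h
    by (simp add: group_hom_def group_hom_axioms_def h G.add.is_group)
  have cmul: "h (frag_cmul n (frag_of p)) = [n] \<cdot>\<^bsub>G\<^esub> f p" if "p \<in> S" for n p
  proof -
    have "h (frag_of p [^]\<^bsub>free_Abelian_group S\<^esub> n) = h (frag_of p) [^]\<^bsub>add_monoid G\<^esub> n"
      using that by (intro h.hom_int_pow) simp
    then show ?thesis using that by (simp add: add_pow_def h_of)
  qed
  have sum: "h (\<Sum>p\<in>I. frag_cmul (k p) (frag_of p)) = (\<Oplus>\<^bsub>G\<^esub>p\<in>I. [k p] \<cdot>\<^bsub>G\<^esub> f p)"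
    if "finite I" "I \<subseteq> S" for I k
    using that
  proof (induction rule: finite_induct)
    case empty
    then show ?case using h.hom_one by simp
  next
    case (insert p I)
    have c: "frag_cmul (k q) (frag_of q) \<in> carrier (free_Abelian_group S)" if "q \<in> S" for q
      using that by (auto simp: keys_cmul_iff)
    have s: "(\<Sum>p\<in>I. frag_cmul (k p) (frag_of p)) \<in> carrier (free_Abelian_group S)"
      by (rule sum_closed_free_Abelian_group) (use insert c in blast)
    have "h (frag_cmul (k p) (frag_of p) + (\<Sum>p\<in>I. frag_cmul (k p) (frag_of p))) =
        [k p] \<cdot>\<^bsub>G\<^esub> f p \<oplus>\<^bsub>G\<^esub> (\<Oplus>\<^bsub>G\<^esub>p\<in>I. [k p] \<cdot>\<^bsub>G\<^esub> f p)"
      using h.hom_mult[OF c s, of p] insert by (simp add: cmul)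
    moreover have "[n] \<cdot>\<^bsub>G\<^esub> f q \<in> carrier G" if "q \<in> S" for q and n :: int
      using f[OF that] by (simp add: G.add.int_pow_closed)
    ultimately show ?case using insert by (simp add: G.finsum_insert Pi_iff subset_iff)
  qed
  have eq: "free_lift G f w = h w" if "Poly_Mapping.keys w \<subseteq> S" for w
    using sum[OF finite_keys that, of "Poly_Mapping.lookup w"] frag_expansion[of w]
    by (simp add: free_lift_def frag_extend_def)
  show "free_lift G f \<in> hom (free_Abelian_group S) (add_monoid G)"
    using h.hom_closed h.hom_mult by (intro homI) (simp_all add: eq)
  show "p \<in> S \<Longrightarrow> free_lift G f (frag_of p) = f p" by (simp add: eq h_of)
qed

context two_modules begin

text \<open>The relations of the tensor product are the identities satisfied by bilinear maps, so the additive
  extension of such a map from pairs to the free abelian group descends.\<close>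

lemma
  assumes "module R G" and f: "bilinear R M N G f"
  shows tensor_lift_tens: "x \<in> carrier M \<Longrightarrow> y \<in> carrier N \<Longrightarrow> tensor_lift G f (x \<otimes>t y) = f x y"
    and tensor_lift_linear: "linear_map R T G (tensor_lift G f)"
proof -
  interpret G: module R G by fact
  interpret F: group F by simp
  interpret T: module R T by (rule module_T)
  define h where "h = free_lift G (\<lambda>(x, y). f x y)"
  have clG: "(\<lambda>(x, y). f x y) p \<in> carrier G" if "p \<in> carrier M \<times> carrier N" for p
    using that bilinearD(1)[OF f] by auto
  have h: "h \<in> hom F (add_monoid G)"
    unfolding h_def by (rule free_lift_hom(1)[OF G.abelian_group_axioms clG])
  have h_of: "h (frag_of (x, y)) = f x y" if "x \<in> carrier M" "y \<in> carrier N" for x y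
    using free_lift_hom(2)[of G "carrier M \<times> carrier N" "\<lambda>(x, y). f x y" "(x, y)"]
      G.abelian_group_axioms clG that by (simp add: h_def)
  interpret h: group_hom F "add_monoid G" h
    by (simp add: group_hom_def group_hom_axioms_def h G.add.is_group)
  have h_closed: "h v \<in> carrier G" if "v \<in> carrier P" for v
    using h.hom_closed[of v] that by simp
  have h_add: "h (v + w) = h v \<oplus>\<^bsub>G\<^esub> h w" if "v \<in> carrier P" "w \<in> carrier P" for v w
    using h.hom_mult[of v w] that by simp
  have h_neg: "h (- v) = \<ominus>\<^bsub>G\<^esub> h v" if "v \<in> carrier P" for v
    using h.hom_inv[of v] that by (simp add: a_inv_def)
  have h_diff: "h (v - w) = h v \<ominus>\<^bsub>G\<^esub> h w" if "v \<in> carrier P" "w \<in> carrier P" for v w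
    using h_add[of v "- w"] h_neg[of w] that by (simp add: a_minus_def)
  have gens: "h w = \<zero>\<^bsub>G\<^esub>" if "w \<in> gens" for w
    using that unfolding gens_def
    by (elim UnE CollectE exE conjE; hypsubst)
       (simp_all add: h_diff h_of bilinearD[OF f] keys_diff_subset G.diff_eq_iff G.a_comm)
  have Rel: "h w = \<zero>\<^bsub>G\<^esub>" if "w \<in> Rel" for w
    using that unfolding Rel_eq
  proof (induction rule: generate.induct)
    case one
    show ?case using h.hom_one by simp
  next
    case (inv w)
    then have "w \<in> carrier F" using gens_subset by blast
    then show ?case using gens[OF inv] h_neg[of w] by simp
  next
    case (eng v w)
    then have "v \<in> carrier F" "w \<in> carrier F"
      using F.generate_incl[OF gens_subset] by blast+
    then show ?case using eng h_add[of v w] by simp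
  qed (rule gens)
  have lift: "tensor_lift G f (tq.cls w) = h w" if w: "w \<in> carrier P" for w
    unfolding tensor_lift_def h_def[symmetric]
  proof (rule tq.descend_cls[OF w])
    fix v assume v: "v \<in> carrier P" "tq.cls v = tq.cls w"
    then have "h (v - w) = \<zero>\<^bsub>G\<^esub>" using w by (simp add: tq.cls_eq_iff Rel)
    then show "h v = h w" using v w h_closed by (simp add: h_diff G.diff_eq_zero_iff)
  qed
  show tens: "tensor_lift G f (x \<otimes>t y) = f x y" if "x \<in> carrier M" "y \<in> carrier N" for x y
    using that by (simp add: tensor_def lift h_of)
  have closed: "tensor_lift G f u \<in> carrier G" if "u \<in> carrier T" for u
    using that h_closed by (auto simp: T_eq tq.carrier_Q lift simp del: P_simps)
  have tadd: "tensor_lift G f (u \<oplus>\<^bsub>T\<^esub> v) = tensor_lift G f u \<oplus>\<^bsub>G\<^esub> tensor_lift G f v"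
    if uv: "u \<in> carrier T" "v \<in> carrier T" for u v
  proof -
    obtain w where w: "w \<in> carrier P" "u = tq.cls w"
      using uv(1) by (rule T_cases)
    obtain w' where w': "w' \<in> carrier P" "v = tq.cls w'"
      using uv(2) by (rule T_cases)
    have "w + w' \<in> carrier P" using w w' by simp
    with w w' show ?thesis by (simp add: T_eq tq.add_cls lift h_add)
  qed
  show "linear_map R T G (tensor_lift G f)"
  proof (rule linear_mapI[OF module_T assms(1) closed tadd])
    fix c u assume "c \<in> carrier R" "u \<in> carrier T"
    from this(2,1) show "tensor_lift G f (c \<odot>\<^bsub>T\<^esub> u) = c \<odot>\<^bsub>G\<^esub> tensor_lift G f u"
    proof (induction rule: tensor_induct)
      case (pure x y)
      then show ?case by (simp add: tens bilinearD[OF f] flip: tens_smult_left)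
    next
      case (add u v)
      then show ?case by (simp add: T.smult_r_distr G.smult_r_distr closed tadd)
    qed
  qed
qed

end

section \<open>Bilinear maps\<close>

lemma bilinear_swap: "bilinear R M N P f \<Longrightarrow> bilinear R N M P (\<lambda>y x. f x y)"
  by (simp add: bilinear_def)

lemma bilinear_comp:
  assumes "bilinear R M N P f" "linear_map R P Q g"
  shows "bilinear R M N Q (\<lambda>x y. g (f x y))"
  by (rule bilinearI)
    (simp_all add: bilinearD[OF assms(1)] linear_map.closed[OF assms(2)]
      linear_map.add[OF assms(2)] linear_map.smult[OF assms(2)])

lemma bilinear_precomp:
  assumes "bilinear R M N P f" "linear_map R M' M g"
  shows "bilinear R M' N P (\<lambda>x y. f (g x) y)"
  by (rule bilinearI)
    (simp_all add: bilinearD[OF assms(1)] linear_map.closed[OF assms(2)]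
      linear_map.add[OF assms(2)] linear_map.smult[OF assms(2)])

lemma bilinear_precomp2:
  assumes "bilinear R M N P f" "linear_map R N' N g"
  shows "bilinear R M N' P (\<lambda>x y. f x (g y))"
  by (rule bilinearI)
    (simp_all add: bilinearD[OF assms(1)] linear_map.closed[OF assms(2)]
      linear_map.add[OF assms(2)] linear_map.smult[OF assms(2)])

lemma bilinear_add:
  assumes "module R P" "bilinear R M N P f" "bilinear R M N P g"
  shows "bilinear R M N P (\<lambda>x y. f x y \<oplus>\<^bsub>P\<^esub> g x y)"
proof -
  interpret P: module R P by fact
  show ?thesis
    by (rule bilinearI)
      (simp_all add: bilinearD[OF assms(2)] bilinearD[OF assms(3)] P.smult_r_distr P.M.a_ac)
qed

lemma bilinear_diff:
  assumes "module R P" "bilinear R M N P f" "bilinear R M N P g"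
  shows "bilinear R M N P (\<lambda>x y. f x y \<ominus>\<^bsub>P\<^esub> g x y)"
proof -
  interpret P: module R P by fact
  show ?thesis
    by (rule bilinearI)
      (simp_all add: bilinearD[OF assms(2)] bilinearD[OF assms(3)] P.smult_r_distr P.smult_r_minus
         P.M.a_ac P.M.minus_eq P.M.minus_add)
qed

lemma bilinear_left:
  "module R M \<Longrightarrow> module R P \<Longrightarrow> bilinear R M N P f \<Longrightarrow> y \<in> carrier N \<Longrightarrow> linear_map R M P (\<lambda>x. f x y)"
  by (simp add: linear_map_def linear_map_axioms_def bilinear_def)

lemma bilinear_right:
  "module R N \<Longrightarrow> module R P \<Longrightarrow> bilinear R M N P f \<Longrightarrow> x \<in> carrier M \<Longrightarrow> linear_map R N P (f x)"
  by (simp add: linear_map_def linear_map_axioms_def bilinear_def)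

text \<open>Moving one argument within its coset changes the value of a bilinear map by a value with an
  argument in the submodule. The bracket, the Lie derivative and the pairing on homology, and the
  operations modulo the radical, are obtained in this way.\<close>

lemma
  assumes "module_quot R M N" "module_quot R M' N'" "module R P" and f: "bilinear R M M' P f"
    and kill: "\<And>x y. x \<in> N \<Longrightarrow> y \<in> carrier M' \<Longrightarrow> f x y = \<zero>\<^bsub>P\<^esub>"
      "\<And>x y. x \<in> carrier M \<Longrightarrow> y \<in> N' \<Longrightarrow> f x y = \<zero>\<^bsub>P\<^esub>"
  shows descend2_bilinear_cls: "x \<in> carrier M \<Longrightarrow> y \<in> carrier M' \<Longrightarrow>
      descend2 f (N +>\<^bsub>M\<^esub> x) (N' +>\<^bsub>M'\<^esub> y) = f x y"
    and descend2_bilinear: "bilinear R (quotient_module M N) (quotient_module M' N') P (descend2 f)"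
proof -
  interpret one: module_quot R M N by fact
  interpret two: module_quot R M' N' by fact
  interpret P: module R P by fact
  show eq: "descend2 f (N +>\<^bsub>M\<^esub> x) (N' +>\<^bsub>M'\<^esub> y) = f x y"
    if xy: "x \<in> carrier M" "y \<in> carrier M'" for x y
  proof (rule descend2_cls[OF one.quot_axioms two.quot_axioms xy])
    fix x' y'
    assume xy': "x' \<in> carrier M" "y' \<in> carrier M'"
      and e: "N +>\<^bsub>M\<^esub> x' = N +>\<^bsub>M\<^esub> x" "N' +>\<^bsub>M'\<^esub> y' = N' +>\<^bsub>M'\<^esub> y"
    have "f (x' \<ominus>\<^bsub>M\<^esub> x) y' = \<zero>\<^bsub>P\<^esub>" "f x (y' \<ominus>\<^bsub>M'\<^esub> y) = \<zero>\<^bsub>P\<^esub>"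
      using e xy xy' by (simp_all add: kill one.cls_eq_iff two.cls_eq_iff)
    moreover have "f (x' \<ominus>\<^bsub>M\<^esub> x) y' = f x' y' \<ominus>\<^bsub>P\<^esub> f x y'"
      using linear_map.diff[OF bilinear_left[OF one.module_axioms assms(3) f]] xy xy' by simp
    moreover have "f x (y' \<ominus>\<^bsub>M'\<^esub> y) = f x y' \<ominus>\<^bsub>P\<^esub> f x y"
      using linear_map.diff[OF bilinear_right[OF two.module_axioms assms(3) f]] xy xy' by simp
    ultimately show "f x' y' = f x y"
      using xy xy' by (simp add: P.diff_eq_zero_iff bilinearD[OF f])
  qed
  show "bilinear R (quotient_module M N) (quotient_module M' N') P (descend2 f)"
    by (rule bilinearI)
      (auto simp: one.carrier_Q two.carrier_Q one.add_cls two.add_cls one.smult_cls two.smult_cls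
         eq bilinearD[OF f])
qed

text \<open>The parameter will be a derivation, or the outer factor of a triple tensor; pure tensors
  suffice to see the linearity in it.\<close>

lemma (in two_modules) tensor_lift_param:
  assumes G: "module R G" and f: "\<And>y. y \<in> carrier Y \<Longrightarrow> bilinear R M N G (f y)"
    and p: "\<And>a b. a \<in> carrier M \<Longrightarrow> b \<in> carrier N \<Longrightarrow> (\<lambda>y. f y a b) \<in> module_hom R Y G"
    and Y: "module R Y"
  shows "bilinear R Y T G (\<lambda>y w. tensor_lift G (f y) w)"
proof -
  interpret G: module R G by fact
  interpret Y: module R Y by fact
  interpret T: module R T by (rule module_T)
  note l = tensor_lift_linear[OF G f]
  note [simp] = linear_map.closed[OF l] linear_map.add[OF l] linear_map.smult[OF l]
    tensor_lift_tens[OF G f]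
  have p': "f (y \<oplus>\<^bsub>Y\<^esub> y') a b = f y a b \<oplus>\<^bsub>G\<^esub> f y' a b" "c \<in> carrier R \<Longrightarrow> f (c \<odot>\<^bsub>Y\<^esub> y) a b = c \<odot>\<^bsub>G\<^esub> f y a b"
    if "a \<in> carrier M" "b \<in> carrier N" "y \<in> carrier Y" "y' \<in> carrier Y" for y y' a b c
    using p[of a b] that by (auto simp: module_hom_def)
  show ?thesis
  proof (rule bilinearI)
    fix y y' w assume y: "y \<in> carrier Y" "y' \<in> carrier Y" and w: "w \<in> carrier T"
    from w y show "tensor_lift G (f (y \<oplus>\<^bsub>Y\<^esub> y')) w = tensor_lift G (f y) w \<oplus>\<^bsub>G\<^esub> tensor_lift G (f y') w"
      by (induction rule: tensor_induct) (simp_all add: p' G.M.a_ac)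
  next
    fix c y w assume cy: "c \<in> carrier R" "y \<in> carrier Y" and w: "w \<in> carrier T"
    from w cy show "tensor_lift G (f (c \<odot>\<^bsub>Y\<^esub> y)) w = c \<odot>\<^bsub>G\<^esub> tensor_lift G (f y) w"
      by (induction rule: tensor_induct) (simp_all add: p' G.smult_r_distr)
  qed simp_all
qed

section \<open>The Hochschild complex in low degrees\<close>

text \<open>Associative algebras, with the facts about the ring and those about the module kept under separate
  qualifiers.\<close>

locale alg = A: ring A + M: module R A
  for R :: "'k ring" and A :: "('k, 'a) module" +
  assumes smult_mult_left: "c \<in> carrier R \<Longrightarrow> x \<in> carrier A \<Longrightarrow> y \<in> carrier A \<Longrightarrow>
        (c \<odot>\<^bsub>A\<^esub> x) \<otimes>\<^bsub>A\<^esub> y = c \<odot>\<^bsub>A\<^esub> (x \<otimes>\<^bsub>A\<^esub> y)"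
    and smult_mult_right: "c \<in> carrier R \<Longrightarrow> x \<in> carrier A \<Longrightarrow> y \<in> carrier A \<Longrightarrow>
        x \<otimes>\<^bsub>A\<^esub> (c \<odot>\<^bsub>A\<^esub> y) = c \<odot>\<^bsub>A\<^esub> (x \<otimes>\<^bsub>A\<^esub> y)"
begin

abbreviation mul (infixl "\<cdot>" 70) where "x \<cdot> y \<equiv> x \<otimes>\<^bsub>A\<^esub> y"

lemma bilinear_mult: "bilinear R A A A (\<lambda>x y. x \<cdot> y)"
  by (rule bilinearI) (auto simp: smult_mult_left smult_mult_right A.l_distr A.r_distr)

lemma linear_lmult: "a \<in> carrier A \<Longrightarrow> linear_map R A A (\<lambda>x. a \<cdot> x)"
  by (rule bilinear_right[OF M.module_axioms M.module_axioms bilinear_mult])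

lemma linear_rmult: "a \<in> carrier A \<Longrightarrow> linear_map R A A (\<lambda>x. x \<cdot> a)"
  by (rule bilinear_left[OF M.module_axioms M.module_axioms bilinear_mult])

abbreviation C where "C \<equiv> C1 R A"
abbreviation t where "t a b \<equiv> tensor R A A a b"

sublocale AA: two_modules R A A
  by (simp add: two_modules_def M.module_axioms)

lemma C_eq: "AA.T = C" by (simp add: C1_def)

sublocale C: module R C
  using AA.module_T by (simp add: C_eq)

lemmas t_bilinear = AA.bilinear_tens[unfolded C_eq]
lemmas t_closed [simp] = AA.tens_closed[unfolded C_eq]
lemmas t_add_left = AA.tens_add_left[unfolded C_eq]
lemmas t_add_right = AA.tens_add_right[unfolded C_eq]
lemmas C_induct [consumes 1, case_names pure add] = AA.tensor_induct[unfolded C_eq]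
lemmas C_lift_t = AA.tensor_lift_tens[unfolded C_eq]
lemmas C_lift_linear = AA.tensor_lift_linear[unfolded C_eq]
lemmas C_lift_param = AA.tensor_lift_param[unfolded C_eq]

section \<open>Boundaries of pure tensors\<close>

lemma bilinear_commutator: "bilinear R A A A (\<lambda>a0 a1. a0 \<cdot> a1 \<ominus>\<^bsub>A\<^esub> a1 \<cdot> a0)"
  by (intro bilinear_diff M.module_axioms bilinear_mult bilinear_swap[OF bilinear_mult])

sublocale b1: linear_map R C A "boundary1 A"
  unfolding boundary1_def by (rule C_lift_linear[OF M.module_axioms bilinear_commutator])

lemma b1_t: "a \<in> carrier A \<Longrightarrow> b \<in> carrier A \<Longrightarrow> boundary1 A (t a b) = a \<cdot> b \<ominus>\<^bsub>A\<^esub> b \<cdot> a"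
  unfolding boundary1_def by (rule C_lift_t[OF M.module_axioms bilinear_commutator])

text \<open>The Hochschild boundary of the pure tensor of \<open>a\<close>, \<open>b\<close> and \<open>c\<close>.\<close>

definition tri where
  "tri a b c = t (a \<cdot> b) c \<ominus>\<^bsub>C\<^esub> t a (b \<cdot> c) \<oplus>\<^bsub>C\<^esub> t (c \<cdot> a) b"

lemma tri_closed [simp]:
  "a \<in> carrier A \<Longrightarrow> b \<in> carrier A \<Longrightarrow> c \<in> carrier A \<Longrightarrow> tri a b c \<in> carrier C"
  by (simp add: tri_def)

lemma tri_bilinear: "a \<in> carrier A \<Longrightarrow> bilinear R A A C (tri a)"
  unfolding tri_def
  by (intro bilinear_add bilinear_diff C.module_axioms
      bilinear_precomp[OF t_bilinear linear_lmult]
      bilinear_comp[OF bilinear_mult] bilinear_swap[OF bilinear_precomp[OF t_bilinear linear_rmult]]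
      bilinear_right[OF M.module_axioms C.module_axioms t_bilinear])

lemma tri_linear:
  assumes "b \<in> carrier A" "c \<in> carrier A"
  shows "(\<lambda>a. tri a b c) \<in> module_hom R A C"
proof -
  have "bilinear R A A C (\<lambda>a b. tri a b c)"
    unfolding tri_def using assms
    by (intro bilinear_add bilinear_diff C.module_axioms bilinear_precomp2[OF t_bilinear linear_rmult]
      bilinear_comp[OF bilinear_mult] bilinear_precomp[OF t_bilinear linear_lmult]
      bilinear_left[OF M.module_axioms C.module_axioms t_bilinear])
  then show ?thesis using assms by (simp add: bilinear_def)
qed

interpretation AC: two_modules R A C
  by (simp add: two_modules_def M.module_axioms C.module_axioms)

lemma C2_eq: "AC.T = C2 R A" by (simp add: C2_def C1_def)

lemma b2_bilinear: "bilinear R A C C (\<lambda>a. tensor_lift C (tri a))"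
  by (rule C_lift_param[OF C.module_axioms tri_bilinear tri_linear M.module_axioms])

lemma b2_eq: "boundary2 R A = tensor_lift C (\<lambda>a. tensor_lift C (tri a))"
  by (simp add: boundary2_def tri_def[abs_def])

lemma b2_linear: "linear_map R (C2 R A) C (boundary2 R A)"
  using AC.tensor_lift_linear[OF C.module_axioms b2_bilinear] by (simp add: b2_eq C2_eq)

lemma b2_tri:
  "a \<in> carrier A \<Longrightarrow> b \<in> carrier A \<Longrightarrow> c \<in> carrier A \<Longrightarrow>
   boundary2 R A (tensor R A C a (t b c)) = tri a b c"
  by (simp add: b2_eq AC.tensor_lift_tens[OF C.module_axioms b2_bilinear]
      C_lift_t[OF C.module_axioms tri_bilinear])

lemma tri_B1: "a \<in> carrier A \<Longrightarrow> b \<in> carrier A \<Longrightarrow> c \<in> carrier A \<Longrightarrow> tri a b c \<in> B1 R A"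
  unfolding B1_def b2_tri[symmetric] by (intro imageI AC.tens_closed[unfolded C2_eq] t_closed)

text \<open>Triple tensors generate the chains of degree 2, so boundaries are sums of the elements \<open>tri a b c\<close>.\<close>

lemma B1_induct [consumes 1, case_names tri add]:
  assumes "w \<in> B1 R A"
    and tri: "\<And>a b c. a \<in> carrier A \<Longrightarrow> b \<in> carrier A \<Longrightarrow> c \<in> carrier A \<Longrightarrow> Q (tri a b c)"
    and add: "\<And>u v. u \<in> carrier C \<Longrightarrow> v \<in> carrier C \<Longrightarrow> Q u \<Longrightarrow> Q v \<Longrightarrow> Q (u \<oplus>\<^bsub>C\<^esub> v)"
  shows "Q w"
proof -
  interpret b2: linear_map R "C2 R A" C "boundary2 R A" by (rule b2_linear)
  have pure: "Q (boundary2 R A (tensor R A C a u))" if "u \<in> carrier C" "a \<in> carrier A" for a u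
    using that
  proof (induction rule: C_induct)
    case (pure b c)
    then show ?case by (simp add: b2_tri tri)
  next
    case (add u v)
    then show ?case
      using AC.tens_closed[unfolded C2_eq]
      by (simp add: AC.tens_add_right[unfolded C2_eq] b2.add assms(3))
  qed
  obtain z where "z \<in> carrier AC.T" "w = boundary2 R A z"
    using assms(1) by (auto simp: B1_def C2_eq)
  from this(1) have "Q (boundary2 R A z)"
    by (induction rule: AC.tensor_induct) (simp_all add: pure C2_eq b2.add add)
  then show ?thesis using \<open>w = _\<close> by simp
qed

lemma B1_submodule: "submodule (B1 R A) R C"
  unfolding B1_def by (rule linear_map.image_submodule[OF b2_linear])

lemma B0_submodule: "submodule (B0 R A) R A"
  unfolding B0_def by (rule b1.image_submodule)

lemma B0_commutator: "a \<in> carrier A \<Longrightarrow> b \<in> carrier A \<Longrightarrow> a \<cdot> b \<ominus>\<^bsub>A\<^esub> b \<cdot> a \<in> B0 R A"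
  unfolding B0_def b1_t[symmetric] by (intro imageI) simp

lemma linear_kills_B1:
  assumes "linear_map R C P f" "w \<in> B1 R A"
    and "\<And>a b c. a \<in> carrier A \<Longrightarrow> b \<in> carrier A \<Longrightarrow> c \<in> carrier A \<Longrightarrow> f (tri a b c) = \<zero>\<^bsub>P\<^esub>"
  shows "f w = \<zero>\<^bsub>P\<^esub>"
proof -
  interpret f: linear_map R C P f by fact
  show ?thesis using assms(2)
    by (induction rule: B1_induct) (auto simp: f.add assms(3))
qed

lemma b1_B1: "w \<in> B1 R A \<Longrightarrow> boundary1 A w = \<zero>\<^bsub>A\<^esub>"
proof (rule linear_kills_B1[OF b1.linear_map_axioms])
  fix a b c assume "a \<in> carrier A" "b \<in> carrier A" "c \<in> carrier A"
  then show "boundary1 A (tri a b c) = \<zero>\<^bsub>A\<^esub>"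
    by (simp add: tri_def b1.add b1.diff b1_t A.m_assoc A.minus_eq A.minus_add A.a_ac A.r_neg A.r_neg1 A.r_neg2)
qed

section \<open>Hochschild homology in degrees 0 and 1\<close>

abbreviation Z where "Z \<equiv> Z1 R A"

lemma Z_simps [simp]: "u \<in> carrier Z \<longleftrightarrow> u \<in> carrier C \<and> boundary1 A u = \<zero>\<^bsub>A\<^esub>"
  "u \<oplus>\<^bsub>Z\<^esub> v = u \<oplus>\<^bsub>C\<^esub> v" "\<zero>\<^bsub>Z\<^esub> = \<zero>\<^bsub>C\<^esub>" "c \<odot>\<^bsub>Z\<^esub> u = c \<odot>\<^bsub>C\<^esub> u"
  by (simp_all add: Z1_def)

lemma Z_submodule: "submodule {c \<in> carrier C. boundary1 A c = \<zero>\<^bsub>A\<^esub>} R C"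
  by (rule C.submoduleI) (auto simp: b1.add b1.zero b1.neg b1.smult A.minus_zero)

sublocale Z: module R Z
  unfolding Z1_def by (rule submodule.submodule_is_module[OF Z_submodule C.module_axioms])

lemma B1_submodule_Z: "submodule (B1 R A) R Z"
proof -
  note B = C.submoduleE[OF B1_submodule]
  have neg: "\<ominus>\<^bsub>Z\<^esub> w = \<ominus>\<^bsub>C\<^esub> w" if "w \<in> carrier Z" for w
    using that by (intro Z.M.minus_equality) (auto simp: C.M.l_neg b1.neg A.minus_zero)
  have sub: "w \<in> carrier Z" if "w \<in> B1 R A" for w
    using subsetD[OF B(1) that] b1_B1[OF that] by simp
  have "\<zero>\<^bsub>C\<^esub> \<in> B1 R A"
    using submodule.axioms(1)[OF B1_submodule] subgroup.one_closed by fastforce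
  then show ?thesis
    by (intro Z.submoduleI subsetI) (simp_all add: sub neg B del: Z_simps(1))
qed

sublocale H0: module_quot R A "B0 R A"
  by (rule module_quotI[OF M.module_axioms B0_submodule])

sublocale H1: module_quot R Z "B1 R A"
  by (rule module_quotI[OF Z.module_axioms B1_submodule_Z])

sublocale CB: module_quot R C "B1 R A"
  by (rule module_quotI[OF C.module_axioms B1_submodule])

lemma HH0_eq: "HH0 R A = H0.Q" by (simp add: HH0_def)
lemma HH1_eq: "HH1 R A = H1.Q" by (simp add: HH1_def)

lemma cls_Z: "B1 R A +>\<^bsub>Z\<^esub> u = B1 R A +>\<^bsub>C\<^esub> u"
  by (simp add: a_r_coset_def')

end

context alg begin

section \<open>Derivations\<close>

abbreviation D where "D \<equiv> Der R A"

lemma Der_iff: "X \<in> carrier D \<longleftrightarrow> linear_map R A A X \<and> X \<in> extensional (carrier A) \<and>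
    (\<forall>a\<in>carrier A. \<forall>b\<in>carrier A. X (a \<cdot> b) = X a \<cdot> b \<oplus>\<^bsub>A\<^esub> a \<cdot> X b)"
  by (auto simp: Der_def linear_map_def linear_map_axioms_def M.module_axioms)

lemma D_add: "X \<oplus>\<^bsub>D\<^esub> Y = (\<lambda>a\<in>carrier A. X a \<oplus>\<^bsub>A\<^esub> Y a)"
  and D_zero: "\<zero>\<^bsub>D\<^esub> = (\<lambda>a\<in>carrier A. \<zero>\<^bsub>A\<^esub>)"
  and D_smult: "c \<odot>\<^bsub>D\<^esub> X = (\<lambda>a\<in>carrier A. c \<odot>\<^bsub>A\<^esub> X a)"
  by (simp_all add: Der_def)

lemma D_linear: "X \<in> carrier D \<Longrightarrow> linear_map R A A X"
  by (simp add: Der_iff)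

lemmas D_closed [simp] = linear_map.closed[OF D_linear]
lemmas D_map_add = linear_map.add[OF D_linear]
lemmas D_map_diff = linear_map.diff[OF D_linear]
lemmas D_map_smult = linear_map.smult[OF D_linear]

lemma D_mult: "X \<in> carrier D \<Longrightarrow> a \<in> carrier A \<Longrightarrow> b \<in> carrier A \<Longrightarrow>
    X (a \<cdot> b) = X a \<cdot> b \<oplus>\<^bsub>A\<^esub> a \<cdot> X b"
  by (simp add: Der_iff)

lemma D_eqI:
  "X \<in> carrier D \<Longrightarrow> Y \<in> carrier D \<Longrightarrow> (\<And>a. a \<in> carrier A \<Longrightarrow> X a = Y a) \<Longrightarrow> X = Y"
  by (rule extensionalityI[of _ "carrier A"]) (auto simp: Der_iff)

lemma DerI:
  assumes "\<And>a. a \<in> carrier A \<Longrightarrow> f a \<in> carrier A"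
    "\<And>a b. a \<in> carrier A \<Longrightarrow> b \<in> carrier A \<Longrightarrow> f (a \<oplus>\<^bsub>A\<^esub> b) = f a \<oplus>\<^bsub>A\<^esub> f b"
    "\<And>c a. c \<in> carrier R \<Longrightarrow> a \<in> carrier A \<Longrightarrow> f (c \<odot>\<^bsub>A\<^esub> a) = c \<odot>\<^bsub>A\<^esub> f a"
    "\<And>a b. a \<in> carrier A \<Longrightarrow> b \<in> carrier A \<Longrightarrow> f (a \<cdot> b) = f a \<cdot> b \<oplus>\<^bsub>A\<^esub> a \<cdot> f b"
  shows "(\<lambda>a\<in>carrier A. f a) \<in> carrier D"
  unfolding Der_iff using assms by (auto intro!: linear_mapI M.module_axioms)

lemma D_one:
  assumes "X \<in> carrier D"
  shows "X \<one>\<^bsub>A\<^esub> = \<zero>\<^bsub>A\<^esub>"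
proof -
  have "X \<one>\<^bsub>A\<^esub> = X \<one>\<^bsub>A\<^esub> \<oplus>\<^bsub>A\<^esub> X \<one>\<^bsub>A\<^esub>" using D_mult[OF assms, of "\<one>\<^bsub>A\<^esub>" "\<one>\<^bsub>A\<^esub>"] assms by simp
  then show ?thesis using assms by (simp add: A.add.l_cancel_one)
qed

lemma D_add_closed: "X \<in> carrier D \<Longrightarrow> Y \<in> carrier D \<Longrightarrow> X \<oplus>\<^bsub>D\<^esub> Y \<in> carrier D"
  unfolding D_add
  by (rule DerI) (simp_all add: D_map_add D_map_smult D_mult A.l_distr A.r_distr A.a_ac M.smult_r_distr)

lemma D_smult_closed: "c \<in> carrier R \<Longrightarrow> X \<in> carrier D \<Longrightarrow> c \<odot>\<^bsub>D\<^esub> X \<in> carrier D"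
  unfolding D_smult
proof (rule DerI)
  fix d a assume "c \<in> carrier R" "X \<in> carrier D" "d \<in> carrier R" "a \<in> carrier A"
  then show "c \<odot>\<^bsub>A\<^esub> X (d \<odot>\<^bsub>A\<^esub> a) = d \<odot>\<^bsub>A\<^esub> (c \<odot>\<^bsub>A\<^esub> X a)"
    by (simp add: D_map_smult M.R.m_comm flip: M.smult_assoc1)
qed (simp_all add: D_map_add D_mult M.smult_r_distr smult_mult_left smult_mult_right)

lemma D_zero_closed: "\<zero>\<^bsub>D\<^esub> \<in> carrier D"
  unfolding D_zero by (rule DerI) simp_all

sublocale D: module R D
proof (rule moduleI[OF M.R.cring_axioms])
  show "abelian_group D"
  proof (rule abelian_groupI)
    fix X assume X: "X \<in> carrier D"
    have "(\<lambda>a\<in>carrier A. \<ominus>\<^bsub>A\<^esub> X a) \<in> carrier D"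
      using X by (intro DerI)
        (simp_all add: D_map_add D_map_smult D_mult A.minus_add M.smult_r_minus A.l_minus A.r_minus)
    then show "\<exists>Y\<in>carrier D. Y \<oplus>\<^bsub>D\<^esub> X = \<zero>\<^bsub>D\<^esub>"
      using X by (intro bexI) (auto simp: D_add D_zero A.l_neg fun_eq_iff)
  qed (auto intro!: D_eqI simp: D_add_closed D_zero_closed, simp_all add: D_add D_zero A.a_ac)
qed (auto intro!: D_eqI simp: D_add_closed D_smult_closed,
     simp_all add: D_add D_smult M.smult_l_distr M.smult_r_distr M.smult_assoc1)

lemma ev_linear: "a \<in> carrier A \<Longrightarrow> (\<lambda>X. X a) \<in> module_hom R D A"
  by (simp add: module_hom_def D_add D_smult)

lemma D_neg: "X \<in> carrier D \<Longrightarrow> a \<in> carrier A \<Longrightarrow> (\<ominus>\<^bsub>D\<^esub> X) a = \<ominus>\<^bsub>A\<^esub> X a"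
  using linear_map.neg[of R D A "\<lambda>X. X a" X] ev_linear[of a]
  by (simp add: linear_map_def linear_map_axioms_def D.module_axioms M.module_axioms)

lemma inner_apply: "x \<in> carrier A \<Longrightarrow> inner_derivation A a x = a \<cdot> x \<ominus>\<^bsub>A\<^esub> x \<cdot> a"
  by (simp add: inner_derivation_def)

lemma inner_closed: "a \<in> carrier A \<Longrightarrow> inner_derivation A a \<in> carrier D"
  unfolding inner_derivation_def
  by (rule DerI)
    (simp_all add: A.l_distr A.r_distr smult_mult_left smult_mult_right M.smult_r_distr M.smult_r_minus
      A.minus_eq A.minus_add A.a_ac, algebra)

lemma inner_linear: "linear_map R A D (inner_derivation A)"
  by (rule linear_mapI)
    (auto simp: inner_closed M.module_axioms D.module_axioms D_add_closed D_smult_closed intro!: D_eqI,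
     auto simp: inner_apply D_add D_smult A.l_distr A.r_distr smult_mult_left smult_mult_right
       M.smult_r_distr M.smult_r_minus A.minus_eq A.minus_add A.a_ac)

sublocale HD: module_quot R D "Inn A"
  unfolding Inn_def by (rule module_quotI[OF D.module_axioms linear_map.image_submodule[OF inner_linear]])

lemma HC1_eq: "HC1 R A = HD.Q" by (simp add: HC1_def)

lemma comm_apply: "a \<in> carrier A \<Longrightarrow> der_commutator A X Y a = X (Y a) \<ominus>\<^bsub>A\<^esub> Y (X a)"
  by (simp add: der_commutator_def)

lemma comm_closed: "X \<in> carrier D \<Longrightarrow> Y \<in> carrier D \<Longrightarrow> der_commutator A X Y \<in> carrier D"
  unfolding der_commutator_def
  by (rule DerI)
    (simp_all add: D_map_add D_map_smult D_mult M.smult_r_distr M.smult_r_minus A.l_distr A.r_distr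
      A.minus_eq A.minus_add A.l_minus A.r_minus A.a_ac, rule sym, insert D_closed, algebra)

lemma comm_neg: "X \<in> carrier D \<Longrightarrow> Y \<in> carrier D \<Longrightarrow> der_commutator A Y X = \<ominus>\<^bsub>D\<^esub> der_commutator A X Y"
  by (rule D_eqI) (auto simp: comm_closed D_neg comm_apply A.minus_eq A.minus_add A.a_ac)

lemma comm_bilinear: "bilinear R D D D (der_commutator A)"
  by (rule bilinearI)
    (auto simp: comm_closed D_add_closed D_smult_closed intro!: D_eqI,
     auto simp: comm_apply D_add D_smult D_map_add D_map_smult M.smult_r_distr M.smult_r_minus
       A.minus_eq A.minus_add A.a_ac)

text \<open>This makes the inner derivations an ideal in the Lie algebra of derivations.\<close>

lemma comm_inner:
  assumes "X \<in> carrier D" "a \<in> carrier A"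
  shows "der_commutator A X (inner_derivation A a) = inner_derivation A (X a)"
  using assms
  by (intro D_eqI)
    (simp_all add: comm_closed inner_closed inner_apply comm_apply D_map_diff D_mult,
     insert D_closed, algebra)

end

context alg begin

section \<open>The bracket of derivation classes\<close>

lemmas H0_module = H0.module_quotient
lemmas H1_module = H1.module_quotient
lemmas HD_module = HD.module_quotient

lemma lie_bracket_pre:
  "bilinear R D D HD.Q (\<lambda>X Y. HD.cls (der_commutator A X Y))"
  by (rule bilinear_comp[OF comm_bilinear HD.cls_linear])

lemma Inn_D: "X \<in> Inn A \<Longrightarrow> X \<in> carrier D"
  by (rule HD.sub.a_Hcarr)

lemma InnE:
  assumes "X \<in> Inn A" obtains a where "a \<in> carrier A" "X = inner_derivation A a"
  using assms by (auto simp: Inn_def)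

lemma comm_Inn2: "X \<in> carrier D \<Longrightarrow> Y \<in> Inn A \<Longrightarrow> der_commutator A X Y \<in> Inn A"
  by (auto elim!: InnE simp: comm_inner Inn_def)

lemma comm_Inn1: "X \<in> Inn A \<Longrightarrow> Y \<in> carrier D \<Longrightarrow> der_commutator A X Y \<in> Inn A"
  using comm_neg[of Y X] comm_Inn2[of Y X] Inn_D[of X] D.submoduleE(3)[OF HD.N_submodule] by simp

lemma lie_bracket_kill:
  "X \<in> Inn A \<Longrightarrow> Y \<in> carrier D \<Longrightarrow> HD.cls (der_commutator A X Y) = \<zero>\<^bsub>HD.Q\<^esub>"
  "X \<in> carrier D \<Longrightarrow> Y \<in> Inn A \<Longrightarrow> HD.cls (der_commutator A X Y) = \<zero>\<^bsub>HD.Q\<^esub>"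
  by (simp_all add: HD.cls_eq_zero_iff comm_closed Inn_D comm_Inn1 comm_Inn2)

lemma lie_bracket_eq: "X \<in> carrier D \<Longrightarrow> Y \<in> carrier D \<Longrightarrow>
    lie_bracket R A (HD.cls X) (HD.cls Y) = HD.cls (der_commutator A X Y)"
  unfolding lie_bracket_def
  by (rule descend2_bilinear_cls[OF HD.module_quot_axioms HD.module_quot_axioms HD_module lie_bracket_pre lie_bracket_kill])

lemma lie_bracket_bilinear: "bilinear R HD.Q HD.Q HD.Q (lie_bracket R A)"
  unfolding lie_bracket_def
  by (rule descend2_bilinear[OF HD.module_quot_axioms HD.module_quot_axioms HD_module lie_bracket_pre lie_bracket_kill])

section \<open>The Lie derivative\<close>

lemma lie_t_bilinear:
  assumes "X \<in> carrier D"
  shows "bilinear R A A C (\<lambda>a0 a1. t (X a0) a1 \<oplus>\<^bsub>C\<^esub> t a0 (X a1))"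
  using assms by (intro bilinear_add C.module_axioms bilinear_precomp[OF t_bilinear]
      bilinear_precomp2[OF t_bilinear] D_linear)

lemma lie_t_param:
  assumes a: "a \<in> carrier A" "b \<in> carrier A"
  shows "(\<lambda>X. t (X a) b \<oplus>\<^bsub>C\<^esub> t a (X b)) \<in> module_hom R D C"
  using a ev_linear[of a] ev_linear[of b]
  by (auto simp: module_hom_def bilinearD[OF t_bilinear] C.smult_r_distr C.M.a_ac)

lemma lie_chain_bilinear: "bilinear R D C C (\<lambda>X w. lie_chain R A X w)"
  unfolding lie_chain_def
  by (rule C_lift_param[OF C.module_axioms lie_t_bilinear lie_t_param D.module_axioms])

lemma lie_chain_t: "X \<in> carrier D \<Longrightarrow> a \<in> carrier A \<Longrightarrow> b \<in> carrier A \<Longrightarrow>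
    lie_chain R A X (t a b) = t (X a) b \<oplus>\<^bsub>C\<^esub> t a (X b)"
  unfolding lie_chain_def by (rule C_lift_t[OF C.module_axioms lie_t_bilinear])

lemmas lie_chain_linear = bilinear_right[OF C.module_axioms C.module_axioms lie_chain_bilinear]
lemmas lie_chain_closed [simp] = linear_map.closed[OF lie_chain_linear]
lemmas lie_chain_add = linear_map.add[OF lie_chain_linear]
lemmas lie_chain_neg = linear_map.neg[OF lie_chain_linear]

lemma lie_chain_b1:
  assumes X: "X \<in> carrier D" and w: "w \<in> carrier C"
  shows "boundary1 A (lie_chain R A X w) = X (boundary1 A w)"
  using w
proof (induction rule: C_induct)
  case (pure a b)
  then show ?case using X
    by (simp add: lie_chain_t b1.add b1_t D_map_diff D_mult) (insert D_closed, algebra)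
next
  case (add u v)
  then show ?case using X by (simp add: lie_chain_add b1.add D_map_add)
qed

text \<open>This is the Leibniz rule for the Lie derivative in degree 2, transported along the boundary.\<close>

lemma lie_chain_tri:
  assumes "X \<in> carrier D" "a \<in> carrier A" "b \<in> carrier A" "c \<in> carrier A"
  shows "lie_chain R A X (tri a b c) = tri (X a) b c \<oplus>\<^bsub>C\<^esub> tri a (X b) c \<oplus>\<^bsub>C\<^esub> tri a b (X c)"
  using assms
  by (simp add: tri_def lie_chain_add lie_chain_neg lie_chain_t D_mult t_add_left t_add_right
      C.M.minus_eq C.M.minus_add C.M.a_ac)

lemma B1_add: "u \<in> B1 R A \<Longrightarrow> v \<in> B1 R A \<Longrightarrow> u \<oplus>\<^bsub>C\<^esub> v \<in> B1 R A"
  by (rule C.submoduleE(5)[OF B1_submodule])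

lemma lie_chain_B1:
  assumes "X \<in> carrier D" "w \<in> B1 R A"
  shows "lie_chain R A X w \<in> B1 R A"
  using assms(2)
  by (induction rule: B1_induct) (simp_all add: assms(1) lie_chain_tri lie_chain_add B1_add tri_B1)

lemma lie_chain_Z: "X \<in> carrier D \<Longrightarrow> w \<in> carrier Z \<Longrightarrow> lie_chain R A X w \<in> carrier Z"
  by (simp add: lie_chain_b1 linear_map.zero[OF D_linear])

text \<open>The class of a pure tensor modulo boundaries. Homotopy formulas become equations between such
  classes, so that chains of degree 2 need not be written down.\<close>

abbreviation q where "q a b \<equiv> CB.cls (t a b)"

lemma q_bilinear: "bilinear R A A CB.Q (\<lambda>a b. q a b)"
  by (rule bilinear_comp[OF t_bilinear CB.cls_linear])

lemma q_closed [simp]: "a \<in> carrier A \<Longrightarrow> b \<in> carrier A \<Longrightarrow> q a b \<in> carrier CB.Q"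
  by simp

lemmas q_add_left = bilinearD(2)[OF q_bilinear]
lemmas q_add_right = bilinearD(3)[OF q_bilinear]
lemmas q_diff_left = linear_map.diff[OF bilinear_left[OF M.module_axioms CB.module_quotient q_bilinear]]
lemmas q_diff_right = linear_map.diff[OF bilinear_right[OF M.module_axioms CB.module_quotient q_bilinear]]
lemmas q_zero_left = linear_map.zero[OF bilinear_left[OF M.module_axioms CB.module_quotient q_bilinear]]

text \<open>The boundary of a triple tensor read as a cyclic Leibniz rule.\<close>

lemma q_mult_right:
  assumes "a \<in> carrier A" "b \<in> carrier A" "c \<in> carrier A"
  shows "q a (b \<cdot> c) = q (a \<cdot> b) c \<oplus>\<^bsub>CB.Q\<^esub> q (c \<cdot> a) b"
proof -
  have "CB.cls (tri a b c) = \<zero>\<^bsub>CB.Q\<^esub>" using assms by (simp add: CB.cls_eq_zero_iff tri_B1)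
  then have z: "(q (a \<cdot> b) c \<ominus>\<^bsub>CB.Q\<^esub> q a (b \<cdot> c)) \<oplus>\<^bsub>CB.Q\<^esub> q (c \<cdot> a) b = \<zero>\<^bsub>CB.Q\<^esub>"
    using assms by (simp add: tri_def CB.proj.add CB.proj.diff)
  have "x = y \<oplus>\<^bsub>CB.Q\<^esub> z" if "(y \<ominus>\<^bsub>CB.Q\<^esub> x) \<oplus>\<^bsub>CB.Q\<^esub> z = \<zero>\<^bsub>CB.Q\<^esub>"
    "x \<in> carrier CB.Q" "y \<in> carrier CB.Q" "z \<in> carrier CB.Q" for x y z
  proof -
    have "x = x \<oplus>\<^bsub>CB.Q\<^esub> ((y \<ominus>\<^bsub>CB.Q\<^esub> x) \<oplus>\<^bsub>CB.Q\<^esub> z)" using that by simp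
    also have "\<dots> = y \<oplus>\<^bsub>CB.Q\<^esub> z" using that(2-) by algebra
    finally show ?thesis .
  qed
  from this[OF z] assms show ?thesis by simp
qed

lemma B1_iff: "w \<in> carrier C \<Longrightarrow> w \<in> B1 R A \<longleftrightarrow> CB.cls w = \<zero>\<^bsub>CB.Q\<^esub>"
  by (simp add: CB.cls_eq_zero_iff)

text \<open>The Lie derivative along the inner derivation by \<open>c\<close> is homotopic to zero by the homotopy
  \<open>x \<otimes> y \<mapsto> x \<otimes> y \<otimes> c - x \<otimes> c \<otimes> y\<close>; on a cycle the second summand vanishes.\<close>

lemma lie_chain_inner:
  assumes c: "c \<in> carrier A" and w: "w \<in> carrier C"
  shows "CB.cls (lie_chain R A (inner_derivation A c) w) \<oplus>\<^bsub>CB.Q\<^esub> q (boundary1 A w) c = \<zero>\<^bsub>CB.Q\<^esub>"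
  using w
proof (induction rule: C_induct)
  case (pure x y)
  have *: "((p \<ominus>\<^bsub>CB.Q\<^esub> r) \<oplus>\<^bsub>CB.Q\<^esub> ((r \<oplus>\<^bsub>CB.Q\<^esub> s) \<ominus>\<^bsub>CB.Q\<^esub> (u \<oplus>\<^bsub>CB.Q\<^esub> p))) \<oplus>\<^bsub>CB.Q\<^esub> (u \<ominus>\<^bsub>CB.Q\<^esub> s) = \<zero>\<^bsub>CB.Q\<^esub>"
    if "p \<in> carrier CB.Q" "r \<in> carrier CB.Q" "s \<in> carrier CB.Q" "u \<in> carrier CB.Q" for p r s u
    using that by algebra
  show ?case using pure c *[of "q (c \<cdot> x) y" "q (x \<cdot> c) y" "q (y \<cdot> x) c" "q (x \<cdot> y) c"]
    by (simp add: lie_chain_t inner_closed inner_apply b1_t CB.proj.add q_diff_left q_diff_right q_mult_right)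
next
  case (add u v)
  have "CB.cls (lie_chain R A (inner_derivation A c) (u \<oplus>\<^bsub>C\<^esub> v)) \<oplus>\<^bsub>CB.Q\<^esub> q (boundary1 A (u \<oplus>\<^bsub>C\<^esub> v)) c =
    (CB.cls (lie_chain R A (inner_derivation A c) u) \<oplus>\<^bsub>CB.Q\<^esub> q (boundary1 A u) c) \<oplus>\<^bsub>CB.Q\<^esub>
    (CB.cls (lie_chain R A (inner_derivation A c) v) \<oplus>\<^bsub>CB.Q\<^esub> q (boundary1 A v) c)"
    using add(1,2) c by (simp add: lie_chain_add inner_closed CB.proj.add b1.add q_add_left CB.proj.N.M.a_ac)
  then show ?case using add by simp
qed

lemma lie_chain_Inn:
  assumes "X \<in> Inn A" "w \<in> carrier Z"
  shows "lie_chain R A X w \<in> B1 R A"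
proof -
  obtain c where c: "c \<in> carrier A" "X = inner_derivation A c" using assms(1) by (rule InnE)
  then show ?thesis
    using lie_chain_inner[of c w] assms(2) by (simp add: q_zero_left B1_iff inner_closed)
qed

lemma lie_chain_bilinear_Z: "bilinear R D Z Z (\<lambda>X w. lie_chain R A X w)"
  using bilinearD[OF lie_chain_bilinear] by (intro bilinearI) (simp_all add: lie_chain_b1 linear_map.zero[OF D_linear])

lemma lie_derivative_pre: "bilinear R D Z H1.Q (\<lambda>X w. H1.cls (lie_chain R A X w))"
  by (rule bilinear_comp[OF lie_chain_bilinear_Z H1.cls_linear])

lemma lie_derivative_kill:
  "X \<in> Inn A \<Longrightarrow> w \<in> carrier Z \<Longrightarrow> H1.cls (lie_chain R A X w) = \<zero>\<^bsub>H1.Q\<^esub>"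
  "X \<in> carrier D \<Longrightarrow> w \<in> B1 R A \<Longrightarrow> H1.cls (lie_chain R A X w) = \<zero>\<^bsub>H1.Q\<^esub>"
  using lie_chain_Z H1.sub.a_Hcarr Inn_D
  by (auto simp: H1.cls_eq_zero_iff lie_chain_Inn lie_chain_B1 simp del: Z_simps(1))

lemma lie_derivative_eq: "X \<in> carrier D \<Longrightarrow> w \<in> carrier Z \<Longrightarrow>
    lie_derivative R A (HD.cls X) (H1.cls w) = H1.cls (lie_chain R A X w)"
  unfolding lie_derivative_def
  by (rule descend2_bilinear_cls[OF HD.module_quot_axioms H1.module_quot_axioms H1_module lie_derivative_pre lie_derivative_kill])

lemma lie_derivative_bilinear: "bilinear R HD.Q H1.Q H1.Q (lie_derivative R A)"
  unfolding lie_derivative_def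
  by (rule descend2_bilinear[OF HD.module_quot_axioms H1.module_quot_axioms H1_module lie_derivative_pre lie_derivative_kill])

section \<open>The interior product\<close>

lemma interior_t_bilinear: "X \<in> carrier D \<Longrightarrow> bilinear R A A A (\<lambda>a0 a1. X a1 \<cdot> a0)"
  by (rule bilinear_swap[OF bilinear_precomp[OF bilinear_mult D_linear]])

lemma interior_t_param:
  assumes "a \<in> carrier A" "b \<in> carrier A"
  shows "(\<lambda>X. X b \<cdot> a) \<in> module_hom R D A"
  using assms ev_linear[of b] by (auto simp: module_hom_def A.l_distr smult_mult_left)

lemma interior_chain_bilinear: "bilinear R D C A (\<lambda>X w. interior_chain A X w)"
  unfolding interior_chain_def
  by (rule C_lift_param[OF M.module_axioms interior_t_bilinear interior_t_param D.module_axioms])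

lemma interior_chain_t: "X \<in> carrier D \<Longrightarrow> a \<in> carrier A \<Longrightarrow> b \<in> carrier A \<Longrightarrow>
    interior_chain A X (t a b) = X b \<cdot> a"
  unfolding interior_chain_def by (rule C_lift_t[OF M.module_axioms interior_t_bilinear])

lemmas interior_chain_linear = bilinear_right[OF C.module_axioms M.module_axioms interior_chain_bilinear]
lemmas interior_chain_closed [simp] = linear_map.closed[OF interior_chain_linear]
lemmas interior_chain_add = linear_map.add[OF interior_chain_linear]
lemmas interior_chain_diff = linear_map.diff[OF interior_chain_linear]

lemma B0_add: "u \<in> B0 R A \<Longrightarrow> v \<in> B0 R A \<Longrightarrow> u \<oplus>\<^bsub>A\<^esub> v \<in> B0 R A"
  by (rule M.submoduleE(5)[OF B0_submodule])

text \<open>The interior product turns the boundary of the pure tensor of \<open>a\<close>, \<open>b\<close> and \<open>c\<close> into the commutator of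
  \<open>X(c) a\<close> and \<open>b\<close>.\<close>

lemma interior_chain_B1:
  assumes X: "X \<in> carrier D" and "w \<in> B1 R A"
  shows "interior_chain A X w \<in> B0 R A"
  using assms(2)
proof (induction rule: B1_induct)
  case (tri a b c)
  then have "interior_chain A X (tri a b c) = (X c \<cdot> a) \<cdot> b \<ominus>\<^bsub>A\<^esub> b \<cdot> (X c \<cdot> a)"
    using X by (simp add: tri_def interior_chain_add interior_chain_diff interior_chain_t D_mult)
      (insert D_closed, algebra)
  then show ?case using tri X by (simp add: B0_commutator)
next
  case (add u v)
  then show ?case using X by (simp add: interior_chain_add B0_add)
qed

text \<open>For the inner derivation by \<open>c\<close> the sum on a pure tensor of \<open>x\<close> and \<open>y\<close> is the commutator of \<open>c x\<close>
  and \<open>y\<close>; on cycles the second summand vanishes.\<close>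

lemma interior_chain_inner:
  assumes c: "c \<in> carrier A" and w: "w \<in> carrier C"
  shows "interior_chain A (inner_derivation A c) w \<oplus>\<^bsub>A\<^esub> c \<cdot> boundary1 A w \<in> B0 R A"
  using w
proof (induction rule: C_induct)
  case (pure x y)
  then have "interior_chain A (inner_derivation A c) (t x y) \<oplus>\<^bsub>A\<^esub> c \<cdot> boundary1 A (t x y) =
     (c \<cdot> x) \<cdot> y \<ominus>\<^bsub>A\<^esub> y \<cdot> (c \<cdot> x)"
    using c by (simp add: interior_chain_t inner_closed inner_apply b1_t) algebra
  then show ?case using pure c by (simp add: B0_commutator)
next
  case (add u v)
  have "interior_chain A (inner_derivation A c) (u \<oplus>\<^bsub>C\<^esub> v) \<oplus>\<^bsub>A\<^esub> c \<cdot> boundary1 A (u \<oplus>\<^bsub>C\<^esub> v) =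
     (interior_chain A (inner_derivation A c) u \<oplus>\<^bsub>A\<^esub> c \<cdot> boundary1 A u) \<oplus>\<^bsub>A\<^esub>
     (interior_chain A (inner_derivation A c) v \<oplus>\<^bsub>A\<^esub> c \<cdot> boundary1 A v)"
    using add(1,2) c by (simp add: interior_chain_add inner_closed b1.add A.r_distr A.a_ac)
  then show ?case using add by (simp add: B0_add)
qed

lemma interior_chain_Inn:
  assumes "X \<in> Inn A" "w \<in> carrier Z"
  shows "interior_chain A X w \<in> B0 R A"
proof -
  obtain c where c: "c \<in> carrier A" "X = inner_derivation A c" using assms(1) by (rule InnE)
  then show ?thesis
    using interior_chain_inner[of c w] assms(2) by (simp add: inner_closed)
qed

lemma pairing_pre: "bilinear R D Z H0.Q (\<lambda>X w. H0.cls (interior_chain A X w))"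
proof -
  have "bilinear R D Z A (\<lambda>X w. interior_chain A X w)"
    using bilinearD[OF interior_chain_bilinear] by (intro bilinearI) simp_all
  then show ?thesis by (rule bilinear_comp[OF _ H0.cls_linear])
qed

lemma pairing_kill:
  "X \<in> Inn A \<Longrightarrow> w \<in> carrier Z \<Longrightarrow> H0.cls (interior_chain A X w) = \<zero>\<^bsub>H0.Q\<^esub>"
  "X \<in> carrier D \<Longrightarrow> w \<in> B1 R A \<Longrightarrow> H0.cls (interior_chain A X w) = \<zero>\<^bsub>H0.Q\<^esub>"
  using CB.sub.a_Hcarr Inn_D
  by (auto simp: H0.cls_eq_zero_iff interior_chain_Inn interior_chain_B1)

lemma pairing_eq: "X \<in> carrier D \<Longrightarrow> w \<in> carrier Z \<Longrightarrow>
    pairing R A (HD.cls X) (H1.cls w) = H0.cls (interior_chain A X w)"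
  unfolding pairing_def
  by (rule descend2_bilinear_cls[OF HD.module_quot_axioms H1.module_quot_axioms H0_module pairing_pre pairing_kill])

lemma pairing_bilinear: "bilinear R HD.Q H1.Q H0.Q (pairing R A)"
  unfolding pairing_def
  by (rule descend2_bilinear[OF HD.module_quot_axioms H1.module_quot_axioms H0_module pairing_pre pairing_kill])

section \<open>Connes' map\<close>

definition connes_chain where
  "connes_chain a = t \<one>\<^bsub>A\<^esub> a \<oplus>\<^bsub>C\<^esub> t a \<one>\<^bsub>A\<^esub>"

lemma connes_chain_closed [simp]: "a \<in> carrier A \<Longrightarrow> connes_chain a \<in> carrier C"
  by (simp add: connes_chain_def)

lemma connes_chain_b1 [simp]: "a \<in> carrier A \<Longrightarrow> boundary1 A (connes_chain a) = \<zero>\<^bsub>A\<^esub>"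
  by (simp add: connes_chain_def b1.add b1_t A.minus_eq A.r_neg)

lemma q_one_right:
  assumes "a \<in> carrier A"
  shows "q a \<one>\<^bsub>A\<^esub> = \<zero>\<^bsub>CB.Q\<^esub>"
  using q_mult_right[of a "\<one>\<^bsub>A\<^esub>" "\<one>\<^bsub>A\<^esub>"] assms by (simp add: CB.proj.N.M.add.l_cancel_one)

text \<open>By the Leibniz rule the class of \<open>1 \<otimes> a b\<close> is the sum of those of \<open>a \<otimes> b\<close> and \<open>b \<otimes> a\<close>, which is
  symmetric in \<open>a\<close> and \<open>b\<close>, and \<open>a \<otimes> 1\<close> is a boundary.\<close>

lemma connes_B0:
  assumes "a \<in> B0 R A"
  shows "connes_chain a \<in> B1 R A"
proof -
  obtain w where w: "w \<in> carrier C" "a = boundary1 A w" using assms by (auto simp: B0_def)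
  from w(1) have "CB.cls (t \<one>\<^bsub>A\<^esub> (boundary1 A w)) = \<zero>\<^bsub>CB.Q\<^esub>"
  proof (induction rule: C_induct)
    case (pure x y)
    then show ?case
      by (simp add: b1_t q_diff_right q_mult_right) (insert q_closed, algebra)
  next
    case (add u v)
    then show ?case by (simp add: b1.add q_add_right)
  qed
  then show ?thesis using w by (simp add: B1_iff connes_chain_def CB.proj.add q_one_right)
qed

lemma connes_linear_chain: "linear_map R A Z connes_chain"
  unfolding connes_chain_def
  using bilinearD[OF t_bilinear] connes_chain_b1[unfolded connes_chain_def]
  by (intro linear_mapI M.module_axioms Z.module_axioms) (simp_all add: C.M.a_ac C.smult_r_distr)

lemma connes_pre: "linear_map R A H1.Q (\<lambda>a. H1.cls (connes_chain a))"
  by (rule linear_map_comp[OF connes_linear_chain H1.cls_linear])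

lemma connes_B_descend: "connes_B R A = descend (\<lambda>a. H1.cls (connes_chain a))"
  by (simp add: connes_B_def connes_chain_def)

lemma connes_kill: "a \<in> B0 R A \<Longrightarrow> H1.cls (connes_chain a) = \<zero>\<^bsub>H1.Q\<^esub>"
  using connes_B0 H0.sub.a_Hcarr by (subst H1.cls_eq_zero_iff) simp_all

lemma connes_eq: "a \<in> carrier A \<Longrightarrow> connes_B R A (H0.cls a) = H1.cls (connes_chain a)"
  unfolding connes_B_descend by (rule H0.linear_descend(1)[OF connes_pre connes_kill])

lemma connes_linear: "linear_map R H0.Q H1.Q (connes_B R A)"
  unfolding connes_B_descend by (rule H0.linear_descend(2)[OF connes_pre connes_kill])

section \<open>Cartan's formula\<close>

lemma cartan_chain:
  assumes X: "X \<in> carrier D" and Y: "Y \<in> carrier D" and w: "w \<in> carrier C"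
  shows "interior_chain A (der_commutator A X Y) w \<oplus>\<^bsub>A\<^esub> interior_chain A Y (lie_chain R A X w) =
    X (interior_chain A Y w)"
  using w
proof (induction rule: C_induct)
  case (pure a b)
  then show ?case using X Y
    by (simp add: interior_chain_t lie_chain_t interior_chain_add comm_closed comm_apply D_mult)
      (insert D_closed, algebra)
next
  case (add u v)
  then show ?case using X Y
    by (simp add: interior_chain_add lie_chain_add comm_closed D_map_add A.a_ac flip: add(3,4))
qed

lemma interior_connes: "X \<in> carrier D \<Longrightarrow> a \<in> carrier A \<Longrightarrow>
    interior_chain A X (connes_chain a) = X a"
  by (simp add: connes_chain_def interior_chain_add interior_chain_t D_one)

text \<open>In degree 0 the Lie derivative along \<open>\<xi>\<close> is the pairing of \<open>\<xi>\<close> with Connes' map, which is how it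
  appears on the right.\<close>

lemma cartan:
  assumes "\<xi> \<in> carrier HD.Q" "\<eta> \<in> carrier HD.Q" "\<alpha> \<in> carrier H1.Q"
  shows "pairing R A (lie_bracket R A \<xi> \<eta>) \<alpha> \<oplus>\<^bsub>H0.Q\<^esub> pairing R A \<eta> (lie_derivative R A \<xi> \<alpha>) =
    pairing R A \<xi> (connes_B R A (pairing R A \<eta> \<alpha>))"
proof -
  obtain X Y w where [simp]: "\<xi> = HD.cls X" "\<eta> = HD.cls Y" "\<alpha> = H1.cls w"
    and XY: "X \<in> carrier D" "Y \<in> carrier D" "w \<in> carrier Z"
    using assms by (auto simp: HD.carrier_Q H1.carrier_Q)
  then show ?thesis
    using cartan_chain[of X Y w] lie_chain_Z[of X w]
    by (simp add: lie_bracket_eq lie_derivative_eq pairing_eq connes_eq comm_closed H0.add_cls interior_connes)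
qed

end

section \<open>The Courant bracket modulo the radical\<close>

lemma direct_sum_simps [simp]:
  "carrier (direct_sum M N) = carrier M \<times> carrier N"
  "\<zero>\<^bsub>direct_sum M N\<^esub> = (\<zero>\<^bsub>M\<^esub>, \<zero>\<^bsub>N\<^esub>)"
  "(x, y) \<oplus>\<^bsub>direct_sum M N\<^esub> (x', y') = (x \<oplus>\<^bsub>M\<^esub> x', y \<oplus>\<^bsub>N\<^esub> y')"
  "c \<odot>\<^bsub>direct_sum M N\<^esub> (x, y) = (c \<odot>\<^bsub>M\<^esub> x, c \<odot>\<^bsub>N\<^esub> y)"
  by (simp_all add: direct_sum_def)

lemma direct_sum_module:
  assumes "module R M" "module R N"
  shows "module R (direct_sum M N)"
proof -
  interpret M: module R M by fact
  interpret N: module R N by fact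
  show ?thesis
  proof (rule moduleI[OF M.R.cring_axioms])
    show "abelian_group (direct_sum M N)"
    proof (rule abelian_groupI)
      fix p assume "p \<in> carrier (direct_sum M N)"
      then show "\<exists>s\<in>carrier (direct_sum M N). s \<oplus>\<^bsub>direct_sum M N\<^esub> p = \<zero>\<^bsub>direct_sum M N\<^esub>"
        by (intro bexI[of _ "(\<ominus>\<^bsub>M\<^esub> fst p, \<ominus>\<^bsub>N\<^esub> snd p)"]) (auto simp: M.M.l_neg N.M.l_neg)
    qed (auto simp: M.M.a_ac N.M.a_ac)
  qed (auto simp: M.smult_l_distr N.smult_l_distr M.smult_r_distr N.smult_r_distr
      M.smult_assoc1 N.smult_assoc1)
qed

lemma direct_sum_fst: "module R M \<Longrightarrow> module R N \<Longrightarrow> linear_map R (direct_sum M N) M fst"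
  by (rule linear_mapI) (auto intro: direct_sum_module)

lemma direct_sum_snd: "module R M \<Longrightarrow> module R N \<Longrightarrow> linear_map R (direct_sum M N) N snd"
  by (rule linear_mapI) (auto intro: direct_sum_module)

lemma bilinear_pair:
  assumes "bilinear R M M' N f" "bilinear R M M' P g"
  shows "bilinear R M M' (direct_sum N P) (\<lambda>x y. (f x y, g x y))"
  by (rule bilinearI) (simp_all add: bilinearD[OF assms(1)] bilinearD[OF assms(2)])

context alg begin

abbreviation EE where "EE \<equiv> E R A"

lemma E_eq: "EE = direct_sum HD.Q H1.Q"
  by (simp add: E_def HC1_eq HH1_eq)

lemma E_carrier [simp]: "e \<in> carrier EE \<longleftrightarrow> fst e \<in> carrier HD.Q \<and> snd e \<in> carrier H1.Q"
  by (auto simp: E_eq mem_Times_iff)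

sublocale EE: module R EE
  unfolding E_eq by (rule direct_sum_module[OF HD_module H1_module])

lemma E_fst: "linear_map R EE HD.Q fst"
  unfolding E_eq by (rule direct_sum_fst[OF HD_module H1_module])

lemma E_snd: "linear_map R EE H1.Q snd"
  unfolding E_eq by (rule direct_sum_snd[OF HD_module H1_module])

lemma bilinear_E:
  assumes "bilinear R HD.Q H1.Q P f"
  shows "bilinear R EE EE P (\<lambda>e e'. f (fst e) (snd e'))"
  by (rule bilinear_precomp2[OF bilinear_precomp[OF assms E_fst] E_snd])

lemma pair_closed [simp]: "\<xi> \<in> carrier HD.Q \<Longrightarrow> \<alpha> \<in> carrier H1.Q \<Longrightarrow> pairing R A \<xi> \<alpha> \<in> carrier H0.Q"
  by (rule bilinearD(1)[OF pairing_bilinear])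

lemma lie_closed [simp]: "\<xi> \<in> carrier HD.Q \<Longrightarrow> \<alpha> \<in> carrier H1.Q \<Longrightarrow> lie_derivative R A \<xi> \<alpha> \<in> carrier H1.Q"
  by (rule bilinearD(1)[OF lie_derivative_bilinear])

lemma bracket_closed [simp]: "\<xi> \<in> carrier HD.Q \<Longrightarrow> \<eta> \<in> carrier HD.Q \<Longrightarrow> lie_bracket R A \<xi> \<eta> \<in> carrier HD.Q"
  by (rule bilinearD(1)[OF lie_bracket_bilinear])

lemma connes_closed [simp]: "h \<in> carrier H0.Q \<Longrightarrow> connes_B R A h \<in> carrier H1.Q"
  by (rule linear_map.closed[OF connes_linear])

lemma E_form_eq: "E_form R A = (\<lambda>e e'. pairing R A (fst e') (snd e) \<oplus>\<^bsub>H0.Q\<^esub> pairing R A (fst e) (snd e'))"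
  by (simp add: E_form_def HH0_eq fun_eq_iff split: prod.splits)

lemma E_bracket_eq: "E_bracket R A = (\<lambda>e e'. (lie_bracket R A (fst e) (fst e'),
    lie_derivative R A (fst e) (snd e') \<ominus>\<^bsub>H1.Q\<^esub> lie_derivative R A (fst e') (snd e)
      \<oplus>\<^bsub>H1.Q\<^esub> connes_B R A (pairing R A (fst e') (snd e))))"
  by (simp add: E_bracket_def HH1_eq fun_eq_iff split: prod.splits)

lemma E_form_bilinear: "bilinear R EE EE H0.Q (E_form R A)"
  unfolding E_form_eq
  by (intro bilinear_add H0_module bilinear_E pairing_bilinear
      bilinear_swap[OF bilinear_E[OF pairing_bilinear]])

lemma E_bracket_bilinear: "bilinear R EE EE EE (E_bracket R A)"
proof -
  have "bilinear R EE EE (direct_sum HD.Q H1.Q) (E_bracket R A)"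
    unfolding E_bracket_eq
    by (intro bilinear_pair bilinear_add bilinear_diff H1_module
        bilinear_precomp2[OF bilinear_precomp[OF lie_bracket_bilinear E_fst] E_fst]
        bilinear_E lie_derivative_bilinear bilinear_swap[OF bilinear_E[OF lie_derivative_bilinear]]
        bilinear_comp[OF bilinear_swap[OF bilinear_E[OF pairing_bilinear]] connes_linear])
  then show ?thesis by (simp only: E_eq)
qed

text \<open>Testing against pairs with one entry zero splits the radical into two separate conditions.\<close>

lemma J_iff: "e \<in> J R A \<longleftrightarrow> e \<in> carrier EE \<and>
    (\<forall>\<eta>\<in>carrier HD.Q. pairing R A \<eta> (snd e) = \<zero>\<^bsub>H0.Q\<^esub>) \<and>
    (\<forall>\<beta>\<in>carrier H1.Q. pairing R A (fst e) \<beta> = \<zero>\<^bsub>H0.Q\<^esub>)"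
  (is "_ \<longleftrightarrow> ?r")
proof
  assume e: "e \<in> J R A"
  have c: "fst e \<in> carrier HD.Q" "snd e \<in> carrier H1.Q" using e by (simp_all add: J_def)
  have f: "pairing R A (fst e') (snd e) \<oplus>\<^bsub>H0.Q\<^esub> pairing R A (fst e) (snd e') = \<zero>\<^bsub>H0.Q\<^esub>"
    if "e' \<in> carrier EE" for e'
    using e that by (auto simp: J_def E_form_eq HH0_eq)
  have z: "pairing R A \<zero>\<^bsub>HD.Q\<^esub> (snd e) = \<zero>\<^bsub>H0.Q\<^esub>" "pairing R A (fst e) \<zero>\<^bsub>H1.Q\<^esub> = \<zero>\<^bsub>H0.Q\<^esub>"
    using linear_map.zero[OF bilinear_left[OF HD_module H0_module pairing_bilinear c(2)]]
      linear_map.zero[OF bilinear_right[OF H1_module H0_module pairing_bilinear c(1)]] by auto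
  show ?r
  proof (intro conjI ballI)
    show "e \<in> carrier EE" using c by simp
    fix \<eta> assume "\<eta> \<in> carrier HD.Q"
    then show "pairing R A \<eta> (snd e) = \<zero>\<^bsub>H0.Q\<^esub>" using f[of "(\<eta>, \<zero>\<^bsub>H1.Q\<^esub>)"] c z by simp
  next
    fix \<beta> assume "\<beta> \<in> carrier H1.Q"
    then show "pairing R A (fst e) \<beta> = \<zero>\<^bsub>H0.Q\<^esub>" using f[of "(\<zero>\<^bsub>HD.Q\<^esub>, \<beta>)"] c z by simp
  qed
next
  assume ?r
  then show "e \<in> J R A" by (auto simp: J_def E_form_eq HH0_eq)
qed

lemma E_form_sym: "e \<in> carrier EE \<Longrightarrow> e' \<in> carrier EE \<Longrightarrow> E_form R A e e' = E_form R A e' e"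
  by (simp add: E_form_eq H0.proj.N.M.a_comm)

lemma J_form: "e \<in> J R A \<Longrightarrow> e' \<in> carrier EE \<Longrightarrow> E_form R A e e' = \<zero>\<^bsub>H0.Q\<^esub>"
  by (auto simp: J_def HH0_eq)

lemma J_form2: "e \<in> carrier EE \<Longrightarrow> e' \<in> J R A \<Longrightarrow> E_form R A e e' = \<zero>\<^bsub>H0.Q\<^esub>"
  using J_form[of e' e] E_form_sym[of e e'] by (simp add: J_iff)

lemma J_submodule: "submodule (J R A) R EE"
proof -
  note l = bilinear_left[OF EE.module_axioms H0_module E_form_bilinear]
  note [simp del] = E_carrier
  show ?thesis
    by (rule EE.submoduleI)
      (auto simp: J_def HH0_eq linear_map.zero[OF l] linear_map.neg[OF l] linear_map.add[OF l]
        linear_map.smult[OF l] H0.proj.N.M.neg_zero)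
qed

sublocale EJ: module_quot R EE "J R A"
  by (rule module_quotI[OF EE.module_axioms J_submodule])

lemma eps_eq: "eps R A = EJ.Q" by (simp add: eps_def)

lemma lie_bracket_neg:
  assumes "\<xi> \<in> carrier HD.Q" "\<eta> \<in> carrier HD.Q"
  shows "lie_bracket R A \<xi> \<eta> = \<ominus>\<^bsub>HD.Q\<^esub> lie_bracket R A \<eta> \<xi>"
  using assms
  by (auto simp: HD.carrier_Q lie_bracket_eq comm_closed comm_neg[symmetric] simp flip: HD.proj.neg)

text \<open>The radical splits as the vectors pairing to zero with all covectors plus the covectors pairing
  to zero with all vectors. Cartan's formula expresses the pairing with a bracket or a Lie derivative
  through pairings that have a radical entry, so the radical is an ideal on both sides.\<close>

lemma J_ideal:
  assumes j: "j \<in> J R A" and e: "e \<in> carrier EE"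
  shows "E_bracket R A j e \<in> J R A" "E_bracket R A e j \<in> J R A"
proof -
  let ?P = "pairing R A" and ?L = "lie_derivative R A" and ?br = "lie_bracket R A"
  obtain \<xi> \<alpha> \<eta> \<beta> where [simp]: "j = (\<xi>, \<alpha>)" "e = (\<eta>, \<beta>)" by (cases j, cases e) blast
  have c [simp]: "\<xi> \<in> carrier HD.Q" "\<alpha> \<in> carrier H1.Q" "\<eta> \<in> carrier HD.Q" "\<beta> \<in> carrier H1.Q"
    using j e by (auto simp: J_iff)
  have r1 [simp]: "?P \<zeta> \<alpha> = \<zero>\<^bsub>H0.Q\<^esub>" if "\<zeta> \<in> carrier HD.Q" for \<zeta> using j that by (auto simp: J_iff)
  have r2 [simp]: "?P \<xi> \<gamma> = \<zero>\<^bsub>H0.Q\<^esub>" if "\<gamma> \<in> carrier H1.Q" for \<gamma> using j that by (auto simp: J_iff)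
  have r3 [simp]: "?P \<zeta> \<zero>\<^bsub>H1.Q\<^esub> = \<zero>\<^bsub>H0.Q\<^esub>" if "\<zeta> \<in> carrier HD.Q" for \<zeta>
    using linear_map.zero[OF bilinear_right[OF H1_module H0_module pairing_bilinear that]] .
  have B0 [simp]: "connes_B R A \<zero>\<^bsub>H0.Q\<^esub> = \<zero>\<^bsub>H1.Q\<^esub>"
    by (rule linear_map.zero[OF connes_linear])
  have br2: "?P (?br \<zeta> \<xi>) \<gamma> = \<zero>\<^bsub>H0.Q\<^esub>" if "\<zeta> \<in> carrier HD.Q" "\<gamma> \<in> carrier H1.Q" for \<zeta> \<gamma>
    using cartan[of \<zeta> \<xi> \<gamma>] that by simp
  have br1: "?P (?br \<xi> \<zeta>) \<gamma> = \<zero>\<^bsub>H0.Q\<^esub>" if "\<zeta> \<in> carrier HD.Q" "\<gamma> \<in> carrier H1.Q" for \<zeta> \<gamma>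
    using that lie_bracket_neg[of \<xi> \<zeta>] br2
      linear_map.neg[OF bilinear_left[OF HD_module H0_module pairing_bilinear that(2)], of "?br \<zeta> \<xi>"]
    by (simp add: H0.proj.N.M.neg_zero)
  have L1: "?P \<zeta> (?L \<xi> \<gamma>) = \<zero>\<^bsub>H0.Q\<^esub>" if "\<zeta> \<in> carrier HD.Q" "\<gamma> \<in> carrier H1.Q" for \<zeta> \<gamma>
    using cartan[of \<xi> \<zeta> \<gamma>] that by (simp add: br1)
  have L2: "?P \<zeta> (?L \<eta> \<alpha>) = \<zero>\<^bsub>H0.Q\<^esub>" if "\<zeta> \<in> carrier HD.Q" for \<zeta>
    using cartan[of \<eta> \<zeta> \<alpha>] that by simp
  have d: "?P \<zeta> (\<beta>1 \<ominus>\<^bsub>H1.Q\<^esub> \<beta>2) = ?P \<zeta> \<beta>1 \<ominus>\<^bsub>H0.Q\<^esub> ?P \<zeta> \<beta>2"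
    if "\<zeta> \<in> carrier HD.Q" "\<beta>1 \<in> carrier H1.Q" "\<beta>2 \<in> carrier H1.Q" for \<zeta> \<beta>1 \<beta>2
    using linear_map.diff[OF bilinear_right[OF H1_module H0_module pairing_bilinear that(1)]] that by blast
  show "E_bracket R A j e \<in> J R A" "E_bracket R A e j \<in> J R A"
    by (simp_all add: J_iff E_bracket_eq br1 br2 d L1 L2 a_minus_def[of H0.Q] H0.proj.N.M.neg_zero)
qed

lemma eps_form_kill:
  "e \<in> J R A \<Longrightarrow> e' \<in> carrier EE \<Longrightarrow> E_form R A e e' = \<zero>\<^bsub>H0.Q\<^esub>"
  "e \<in> carrier EE \<Longrightarrow> e' \<in> J R A \<Longrightarrow> E_form R A e e' = \<zero>\<^bsub>H0.Q\<^esub>"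
  by (rule J_form J_form2; assumption)+

lemma eps_form_eq: "e \<in> carrier EE \<Longrightarrow> e' \<in> carrier EE \<Longrightarrow>
    eps_form R A (EJ.cls e) (EJ.cls e') = E_form R A e e'"
  unfolding eps_form_def
  by (rule descend2_bilinear_cls[OF EJ.module_quot_axioms EJ.module_quot_axioms H0_module E_form_bilinear eps_form_kill])

lemma eps_bracket_kill:
  "e \<in> J R A \<Longrightarrow> e' \<in> carrier EE \<Longrightarrow> EJ.cls (E_bracket R A e e') = \<zero>\<^bsub>EJ.Q\<^esub>"
  "e \<in> carrier EE \<Longrightarrow> e' \<in> J R A \<Longrightarrow> EJ.cls (E_bracket R A e e') = \<zero>\<^bsub>EJ.Q\<^esub>"
  using J_ideal EJ.sub.a_Hcarr by (subst EJ.cls_eq_zero_iff; blast)+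

lemma eps_bracket_eq: "e \<in> carrier EE \<Longrightarrow> e' \<in> carrier EE \<Longrightarrow>
    eps_bracket R A (EJ.cls e) (EJ.cls e') = EJ.cls (E_bracket R A e e')"
  unfolding eps_bracket_def
  by (rule descend2_bilinear_cls[OF EJ.module_quot_axioms EJ.module_quot_axioms EJ.module_quotient
      bilinear_comp[OF E_bracket_bilinear EJ.cls_linear] eps_bracket_kill])

lemma E_bracket_closed: "e \<in> carrier EE \<Longrightarrow> e' \<in> carrier EE \<Longrightarrow> E_bracket R A e e' \<in> carrier EE"
  by (rule bilinearD(1)[OF E_bracket_bilinear])

end

section \<open>Transport along a corner embedding\<close>

text \<open>An embedding that is multiplicative but may fail to preserve the unit, together with a
  compatible Lie homomorphism on derivations.\<close>

locale corner = A: alg R A + B: alg R B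
  for R :: "'k ring" and A :: "('k, 'a) module" and B :: "('k, 'b) module" +
  fixes inc :: "'a \<Rightarrow> 'b" and ext :: "('a \<Rightarrow> 'a) \<Rightarrow> 'b \<Rightarrow> 'b"
  assumes inc_linear: "linear_map R A B inc"
    and inc_mult: "a \<in> carrier A \<Longrightarrow> b \<in> carrier A \<Longrightarrow> inc (a \<otimes>\<^bsub>A\<^esub> b) = inc a \<otimes>\<^bsub>B\<^esub> inc b"
    and ext_linear: "linear_map R (Der R A) (Der R B) ext"
    and ext_inc: "X \<in> carrier (Der R A) \<Longrightarrow> a \<in> carrier A \<Longrightarrow> ext X (inc a) = inc (X a)"
    and ext_comm: "X \<in> carrier (Der R A) \<Longrightarrow> Y \<in> carrier (Der R A) \<Longrightarrow>
      ext (der_commutator A X Y) = der_commutator B (ext X) (ext Y)"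
    and ext_Inn: "X \<in> Inn A \<Longrightarrow> ext X \<in> Inn B"
begin

sublocale inc: linear_map R A B inc by (rule inc_linear)
sublocale ext: linear_map R "Der R A" "Der R B" ext by (rule ext_linear)

section \<open>The induced maps on chains and homology\<close>

definition inc1 where
  "inc1 = tensor_lift (C1 R B) (\<lambda>a b. tensor R B B (inc a) (inc b))"

lemma inc_t_bilinear: "bilinear R A A (C1 R B) (\<lambda>a b. B.t (inc a) (inc b))"
  by (rule bilinear_precomp2[OF bilinear_precomp[OF B.t_bilinear inc_linear] inc_linear])

sublocale inc1: linear_map R "C1 R A" "C1 R B" inc1
  unfolding inc1_def by (rule A.C_lift_linear[OF B.C.module_axioms inc_t_bilinear])

lemma inc1_t: "a \<in> carrier A \<Longrightarrow> b \<in> carrier A \<Longrightarrow> inc1 (A.t a b) = B.t (inc a) (inc b)"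
  unfolding inc1_def by (rule A.C_lift_t[OF B.C.module_axioms inc_t_bilinear])

lemma b1_inc1: "w \<in> carrier A.C \<Longrightarrow> boundary1 B (inc1 w) = inc (boundary1 A w)"
  by (induction rule: A.C_induct)
    (simp_all add: inc1_t A.b1_t B.b1_t inc.diff inc_mult inc1.add A.b1.add B.b1.add inc.add)

lemma inc1_tri: "a \<in> carrier A \<Longrightarrow> b \<in> carrier A \<Longrightarrow> c \<in> carrier A \<Longrightarrow>
    inc1 (A.tri a b c) = B.tri (inc a) (inc b) (inc c)"
  by (simp add: A.tri_def B.tri_def inc1.add inc1.diff inc1_t inc_mult)

lemma inc1_Z: "w \<in> carrier A.Z \<Longrightarrow> inc1 w \<in> carrier B.Z"
  by (simp add: b1_inc1 inc.zero)

lemma inc1_B1: "w \<in> B1 R A \<Longrightarrow> inc1 w \<in> B1 R B"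
  by (induction rule: A.B1_induct) (simp_all add: inc1_tri B.tri_B1 inc1.add B.B1_add)

lemma inc_B0: "a \<in> B0 R A \<Longrightarrow> inc a \<in> B0 R B"
  by (auto simp: B0_def b1_inc1[symmetric])

lemma lie_inc1: "X \<in> carrier A.D \<Longrightarrow> w \<in> carrier A.C \<Longrightarrow>
    lie_chain R B (ext X) (inc1 w) = inc1 (lie_chain R A X w)"
  by (rotate_tac, induction rule: A.C_induct)
    (simp_all add: inc1_t A.lie_chain_t B.lie_chain_t ext_inc inc1.add A.lie_chain_add B.lie_chain_add)

lemma interior_inc1: "X \<in> carrier A.D \<Longrightarrow> w \<in> carrier A.C \<Longrightarrow>
    interior_chain B (ext X) (inc1 w) = inc (interior_chain A X w)"
  by (rotate_tac, induction rule: A.C_induct)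
    (simp_all add: inc1_t A.interior_chain_t B.interior_chain_t ext_inc inc_mult inc1.add inc.add
      A.interior_chain_add B.interior_chain_add)

text \<open>Writing \<open>inc a\<close> as the product of \<open>inc a\<close> and the idempotent \<open>inc 1\<close>, the Leibniz rule turns
  the unit of \<open>B\<close> into \<open>inc 1\<close>.\<close>

lemma connes_inc:
  assumes a: "a \<in> carrier A"
  shows "B.CB.cls (B.connes_chain (inc a)) = B.CB.cls (inc1 (A.connes_chain a))"
proof -
  have "B.q \<one>\<^bsub>B\<^esub> (inc a) = B.q \<one>\<^bsub>B\<^esub> (inc a \<otimes>\<^bsub>B\<^esub> inc \<one>\<^bsub>A\<^esub>)"
    using a by (simp flip: inc_mult)
  also have "\<dots> = B.q (inc a) (inc \<one>\<^bsub>A\<^esub>) \<oplus>\<^bsub>B.CB.Q\<^esub> B.q (inc \<one>\<^bsub>A\<^esub>) (inc a)"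
    using a by (simp add: B.q_mult_right)
  finally show ?thesis
    using a by (simp add: A.connes_chain_def B.connes_chain_def inc1.add inc1_t B.CB.proj.add B.q_one_right
        B.CB.proj.N.M.a_comm)
qed

definition "\<Psi>D = descend (\<lambda>X. B.HD.cls (ext X))"
definition "\<Psi>H = descend (\<lambda>w. B.H1.cls (inc1 w))"
definition "\<phi> = descend (\<lambda>a. B.H0.cls (inc a))"

lemma \<Psi>D_pre: "linear_map R A.D B.HD.Q (\<lambda>X. B.HD.cls (ext X))"
  by (rule linear_map_comp[OF ext_linear B.HD.cls_linear])
lemma \<Psi>D_kill: "X \<in> Inn A \<Longrightarrow> B.HD.cls (ext X) = \<zero>\<^bsub>B.HD.Q\<^esub>"
  by (simp add: B.HD.cls_eq_zero_iff A.Inn_D ext_Inn)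
lemma \<Psi>D_cls: "X \<in> carrier A.D \<Longrightarrow> \<Psi>D (A.HD.cls X) = B.HD.cls (ext X)"
  unfolding \<Psi>D_def by (rule A.HD.linear_descend(1)[OF \<Psi>D_pre \<Psi>D_kill])
sublocale \<Psi>D: linear_map R A.HD.Q B.HD.Q \<Psi>D
  unfolding \<Psi>D_def by (rule A.HD.linear_descend(2)[OF \<Psi>D_pre \<Psi>D_kill])

lemma \<Psi>H_pre: "linear_map R A.Z B.H1.Q (\<lambda>w. B.H1.cls (inc1 w))"
proof -
  have "linear_map R A.Z B.Z inc1"
    by (rule linear_mapI[OF A.Z.module_axioms B.Z.module_axioms inc1_Z]) (simp_all add: inc1.add inc1.smult)
  then show ?thesis by (rule linear_map_comp[OF _ B.H1.cls_linear])
qed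
lemma \<Psi>H_kill: "w \<in> B1 R A \<Longrightarrow> B.H1.cls (inc1 w) = \<zero>\<^bsub>B.H1.Q\<^esub>"
  using A.H1.sub.a_Hcarr inc1_Z inc1_B1 by (subst B.H1.cls_eq_zero_iff) blast+
lemma \<Psi>H_cls: "w \<in> carrier A.Z \<Longrightarrow> \<Psi>H (A.H1.cls w) = B.H1.cls (inc1 w)"
  unfolding \<Psi>H_def by (rule A.H1.linear_descend(1)[OF \<Psi>H_pre \<Psi>H_kill])
sublocale \<Psi>H: linear_map R A.H1.Q B.H1.Q \<Psi>H
  unfolding \<Psi>H_def by (rule A.H1.linear_descend(2)[OF \<Psi>H_pre \<Psi>H_kill])

lemma \<phi>_pre: "linear_map R A B.H0.Q (\<lambda>a. B.H0.cls (inc a))"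
  by (rule linear_map_comp[OF inc_linear B.H0.cls_linear])
lemma \<phi>_kill: "a \<in> B0 R A \<Longrightarrow> B.H0.cls (inc a) = \<zero>\<^bsub>B.H0.Q\<^esub>"
  using A.H0.sub.a_Hcarr inc_B0 by (subst B.H0.cls_eq_zero_iff) auto
lemma \<phi>_cls: "a \<in> carrier A \<Longrightarrow> \<phi> (A.H0.cls a) = B.H0.cls (inc a)"
  unfolding \<phi>_def by (rule A.H0.linear_descend(1)[OF \<phi>_pre \<phi>_kill])
sublocale \<phi>: linear_map R A.H0.Q B.H0.Q \<phi>
  unfolding \<phi>_def by (rule A.H0.linear_descend(2)[OF \<phi>_pre \<phi>_kill])

lemma \<Psi>_bracket: "\<xi> \<in> carrier A.HD.Q \<Longrightarrow> \<eta> \<in> carrier A.HD.Q \<Longrightarrow>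
    lie_bracket R B (\<Psi>D \<xi>) (\<Psi>D \<eta>) = \<Psi>D (lie_bracket R A \<xi> \<eta>)"
  by (auto simp: A.HD.carrier_Q \<Psi>D_cls A.lie_bracket_eq B.lie_bracket_eq A.comm_closed ext_comm)

lemma \<Psi>_lie:
  assumes "\<xi> \<in> carrier A.HD.Q" "\<alpha> \<in> carrier A.H1.Q"
  shows "lie_derivative R B (\<Psi>D \<xi>) (\<Psi>H \<alpha>) = \<Psi>H (lie_derivative R A \<xi> \<alpha>)"
proof -
  obtain X w where [simp]: "\<xi> = A.HD.cls X" "\<alpha> = A.H1.cls w" and c: "X \<in> carrier A.D" "w \<in> carrier A.Z"
    using assms by (auto simp: A.HD.carrier_Q A.H1.carrier_Q)
  then show ?thesis using A.lie_chain_Z[OF c] inc1_Z[OF c(2)]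
    by (simp add: \<Psi>D_cls \<Psi>H_cls A.lie_derivative_eq B.lie_derivative_eq lie_inc1)
qed

lemma \<Psi>_pairing:
  assumes "\<xi> \<in> carrier A.HD.Q" "\<alpha> \<in> carrier A.H1.Q"
  shows "pairing R B (\<Psi>D \<xi>) (\<Psi>H \<alpha>) = \<phi> (pairing R A \<xi> \<alpha>)"
proof -
  obtain X w where [simp]: "\<xi> = A.HD.cls X" "\<alpha> = A.H1.cls w" and c: "X \<in> carrier A.D" "w \<in> carrier A.Z"
    using assms by (auto simp: A.HD.carrier_Q A.H1.carrier_Q)
  then show ?thesis using inc1_Z[OF c(2)]
    by (simp add: \<Psi>D_cls \<Psi>H_cls \<phi>_cls A.pairing_eq B.pairing_eq interior_inc1)
qed

lemma \<Psi>_connes: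
  assumes "h \<in> carrier A.H0.Q"
  shows "connes_B R B (\<phi> h) = \<Psi>H (connes_B R A h)"
proof -
  obtain a where "h = A.H0.cls a" "a \<in> carrier A" using assms by (auto simp: A.H0.carrier_Q)
  then show ?thesis
    by (simp add: \<phi>_cls \<Psi>H_cls A.connes_eq B.connes_eq B.cls_Z connes_inc)
qed

definition "\<Psi>E e = (\<Psi>D (fst e), \<Psi>H (snd e))"

lemma \<Psi>E_linear: "linear_map R A.EE B.EE \<Psi>E"
  by (rule linear_mapI[OF A.EE.module_axioms B.EE.module_axioms])
    (auto simp: \<Psi>E_def A.E_eq B.E_eq \<Psi>D.add \<Psi>H.add \<Psi>D.smult \<Psi>H.smult)

sublocale \<Psi>E: linear_map R A.EE B.EE \<Psi>E by (rule \<Psi>E_linear)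

lemma \<Psi>E_form: "e \<in> carrier A.EE \<Longrightarrow> e' \<in> carrier A.EE \<Longrightarrow>
    E_form R B (\<Psi>E e) (\<Psi>E e') = \<phi> (E_form R A e e')"
  by (simp add: A.E_form_eq B.E_form_eq \<Psi>E_def \<Psi>_pairing \<phi>.add)

lemma \<Psi>E_bracket: "e \<in> carrier A.EE \<Longrightarrow> e' \<in> carrier A.EE \<Longrightarrow>
    E_bracket R B (\<Psi>E e) (\<Psi>E e') = \<Psi>E (E_bracket R A e e')"
  by (simp add: A.E_bracket_eq B.E_bracket_eq \<Psi>E_def \<Psi>_pairing \<Psi>_bracket \<Psi>_lie \<Psi>_connes \<Psi>H.add \<Psi>H.diff)

end

section \<open>Transport of Dirac structures\<close>

lemma dirac_structures_subset: "L \<in> dirac_structures R A \<Longrightarrow> L \<subseteq> carrier (eps R A)"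
  using subgroup.subset submodule.axioms(1) by (fastforce simp: dirac_structures_def)

text \<open>Every clause in the definition of a Dirac structure is expressed through the module operations,
  the bracket and the vanishing of the form, and each of these is preserved and reflected.\<close>

lemma dirac_structures_image:
  assumes "alg R A" "alg R B"
    and \<Psi>: "linear_map R (eps R A) (eps R B) \<Psi>" "bij_betw \<Psi> (carrier (eps R A)) (carrier (eps R B))"
    and \<phi>: "linear_map R (HH0 R A) (HH0 R B) \<phi>" "inj_on \<phi> (carrier (HH0 R A))"
    and br: "\<And>e e'. e \<in> carrier (eps R A) \<Longrightarrow> e' \<in> carrier (eps R A) \<Longrightarrow>
      \<Psi> (eps_bracket R A e e') = eps_bracket R B (\<Psi> e) (\<Psi> e')"
    and fm: "\<And>e e'. e \<in> carrier (eps R A) \<Longrightarrow> e' \<in> carrier (eps R A) \<Longrightarrow>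
      eps_form R B (\<Psi> e) (\<Psi> e') = \<phi> (eps_form R A e e')"
    and fc: "\<And>e e'. e \<in> carrier (eps R A) \<Longrightarrow> e' \<in> carrier (eps R A) \<Longrightarrow>
      eps_form R A e e' \<in> carrier (HH0 R A)"
    and L: "L \<subseteq> carrier (eps R A)"
  shows "\<Psi> ` L \<in> dirac_structures R B \<longleftrightarrow> L \<in> dirac_structures R A"
proof -
  interpret \<Psi>: linear_map R "eps R A" "eps R B" \<Psi> by fact
  interpret \<phi>: linear_map R "HH0 R A" "HH0 R B" \<phi> by fact
  have inj: "inj_on \<Psi> (carrier (eps R A))" and sur: "\<Psi> ` carrier (eps R A) = carrier (eps R B)"
    using \<Psi>(2) by (auto simp: bij_betw_def)
  have mem: "\<Psi> e \<in> \<Psi> ` L \<longleftrightarrow> e \<in> L" if "e \<in> carrier (eps R A)" for e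
    using inj L that by (auto simp: inj_on_def)
  have z: "eps_form R B (\<Psi> e) (\<Psi> e') = \<zero>\<^bsub>HH0 R B\<^esub> \<longleftrightarrow> eps_form R A e e' = \<zero>\<^bsub>HH0 R A\<^esub>"
    if "e \<in> carrier (eps R A)" "e' \<in> carrier (eps R A)" for e e'
    using fm[OF that] fc[OF that] \<phi>(2) \<phi>.zero by (metis \<phi>.M.M.zero_closed inj_onD)
  have 1: "carrier (eps R B) \<noteq> {\<zero>\<^bsub>eps R B\<^esub>} \<longleftrightarrow> carrier (eps R A) \<noteq> {\<zero>\<^bsub>eps R A\<^esub>}"
  proof -
    have "carrier (eps R B) = \<Psi> ` {\<zero>\<^bsub>eps R A\<^esub>} \<longleftrightarrow> carrier (eps R A) = {\<zero>\<^bsub>eps R A\<^esub>}"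
      unfolding sur[symmetric] by (rule inj_on_image_eq_iff[OF inj]) auto
    then show ?thesis by (simp add: \<Psi>.zero)
  qed
  have 2: "submodule (\<Psi> ` L) R (eps R B) \<longleftrightarrow> submodule L R (eps R A)"
  proof
    assume s: "submodule L R (eps R A)"
    have "linear_map R (eps R A\<lparr>carrier := L\<rparr>) (eps R B) \<Psi>"
      using L by (intro linear_mapI submodule.submodule_is_module[OF s] \<Psi>.M.module_axioms \<Psi>.N.module_axioms)
        (auto simp: \<Psi>.add \<Psi>.smult subset_iff)
    from linear_map.image_submodule[OF this] show "submodule (\<Psi> ` L) R (eps R B)" by simp
  next
    assume s: "submodule (\<Psi> ` L) R (eps R B)"
    note s' = \<Psi>.N.submoduleE[OF s]
    have "\<zero>\<^bsub>eps R B\<^esub> \<in> \<Psi> ` L"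
      using submodule.axioms(1)[OF s] subgroup.one_closed by fastforce
    then have "\<zero>\<^bsub>eps R A\<^esub> \<in> L" using mem[of "\<zero>\<^bsub>eps R A\<^esub>"] by (simp add: \<Psi>.zero)
    moreover have "\<ominus>\<^bsub>eps R A\<^esub> e \<in> L" if "e \<in> L" for e
      using mem[of "\<ominus>\<^bsub>eps R A\<^esub> e"] that L s'(3)[of "\<Psi> e"] by (auto simp: \<Psi>.neg)
    moreover have "e \<oplus>\<^bsub>eps R A\<^esub> e' \<in> L" if "e \<in> L" "e' \<in> L" for e e'
      using mem[of "e \<oplus>\<^bsub>eps R A\<^esub> e'"] that L s'(5)[of "\<Psi> e" "\<Psi> e'"] by (auto simp: \<Psi>.add subset_iff)
    moreover have "c \<odot>\<^bsub>eps R A\<^esub> e \<in> L" if "c \<in> carrier R" "e \<in> L" for c e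
      using mem[of "c \<odot>\<^bsub>eps R A\<^esub> e"] that L s'(4)[of c "\<Psi> e"] by (auto simp: \<Psi>.smult subset_iff)
    ultimately show "submodule L R (eps R A)" by (intro \<Psi>.M.submoduleI L)
  qed
  have 3: "isotropic R B (\<Psi> ` L) \<longleftrightarrow> isotropic R A L"
    using L z by (auto simp: isotropic_def subset_iff)
  have 4: "(\<forall>e\<in>carrier (eps R B). (\<forall>l\<in>\<Psi> ` L. eps_form R B e l = \<zero>\<^bsub>HH0 R B\<^esub>) \<longrightarrow> e \<in> \<Psi> ` L) \<longleftrightarrow>
      (\<forall>e\<in>carrier (eps R A). (\<forall>l\<in>L. eps_form R A e l = \<zero>\<^bsub>HH0 R A\<^esub>) \<longrightarrow> e \<in> L)"
    unfolding sur[symmetric] using L z mem by (simp add: subset_iff)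
  have 5: "(\<forall>l\<in>\<Psi> ` L. \<forall>l'\<in>\<Psi> ` L. eps_bracket R B l l' \<in> \<Psi> ` L) \<longleftrightarrow>
      (\<forall>l\<in>L. \<forall>l'\<in>L. eps_bracket R A l l' \<in> L)"
    if cl: "\<And>e e'. e \<in> carrier (eps R A) \<Longrightarrow> e' \<in> carrier (eps R A) \<Longrightarrow>
      eps_bracket R A e e' \<in> carrier (eps R A)"
    using L mem[OF cl] by (simp add: subset_iff br[symmetric])
  interpret A: alg R A by fact
  have "eps_bracket R A e e' \<in> carrier (eps R A)"
    if "e \<in> carrier (eps R A)" "e' \<in> carrier (eps R A)" for e e'
    using that A.E_bracket_closed
    by (auto simp: A.eps_eq A.EJ.carrier_Q A.eps_bracket_eq simp del: A.E_carrier)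
  from 1 2 3 4 5[OF this] show ?thesis
    by (simp add: dirac_structures_def maximally_isotropic_def)
qed

text \<open>The corner represents every class of derivations and every homology class of \<open>B\<close>, and it detects
  the vanishing of homology classes in degree 0.\<close>

locale morita = corner +
  assumes ext_surj: "Y \<in> carrier (Der R B) \<Longrightarrow> \<exists>X\<in>carrier (Der R A). Y \<ominus>\<^bsub>Der R B\<^esub> ext X \<in> Inn B"
    and inc1_surj: "w \<in> carrier (Z1 R B) \<Longrightarrow> \<exists>w'\<in>carrier (Z1 R A). w \<ominus>\<^bsub>C1 R B\<^esub> inc1 w' \<in> B1 R B"
    and inc_reflects: "a \<in> carrier A \<Longrightarrow> inc a \<in> B0 R B \<Longrightarrow> a \<in> B0 R A"
    and inc_surj: "b \<in> carrier B \<Longrightarrow> \<exists>a\<in>carrier A. b \<ominus>\<^bsub>B\<^esub> inc a \<in> B0 R B"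
begin

lemma \<phi>_inj:
  assumes "h \<in> carrier A.H0.Q" "\<phi> h = \<zero>\<^bsub>B.H0.Q\<^esub>" shows "h = \<zero>\<^bsub>A.H0.Q\<^esub>"
proof -
  obtain a where a: "a \<in> carrier A" "h = A.H0.cls a" using assms(1) unfolding A.H0.carrier_Q by blast
  then have "inc a \<in> B0 R B" using assms(2) by (simp add: \<phi>_cls B.H0.cls_eq_zero_iff)
  then show ?thesis using a inc_reflects by (simp add: A.H0.cls_eq_zero_iff)
qed

lemma \<phi>_surj:
  assumes "h \<in> carrier B.H0.Q" shows "\<exists>g\<in>carrier A.H0.Q. \<phi> g = h"
proof -
  obtain b where b: "b \<in> carrier B" "h = B.H0.cls b" using assms by (auto simp: B.H0.carrier_Q)
  obtain a where "a \<in> carrier A" "b \<ominus>\<^bsub>B\<^esub> inc a \<in> B0 R B" using inc_surj b by blast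
  with b show ?thesis
    by (intro bexI[of _ "A.H0.cls a"]) (auto simp: \<phi>_cls B.H0.cls_eq_iff[symmetric])
qed

lemma \<Psi>D_surj:
  assumes "h \<in> carrier B.HD.Q" shows "\<exists>g\<in>carrier A.HD.Q. \<Psi>D g = h"
proof -
  obtain Y where b: "Y \<in> carrier B.D" "h = B.HD.cls Y" using assms by (auto simp: B.HD.carrier_Q)
  obtain X where "X \<in> carrier A.D" "Y \<ominus>\<^bsub>B.D\<^esub> ext X \<in> Inn B" using ext_surj b by blast
  with b show ?thesis
    by (intro bexI[of _ "A.HD.cls X"]) (auto simp: \<Psi>D_cls B.HD.cls_eq_iff[symmetric])
qed

lemma \<Psi>H_surj:
  assumes "h \<in> carrier B.H1.Q" shows "\<exists>g\<in>carrier A.H1.Q. \<Psi>H g = h"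
proof -
  obtain w where b: "w \<in> carrier B.Z" "h = B.H1.cls w" using assms by (auto simp: B.H1.carrier_Q)
  obtain w' where w': "w' \<in> carrier A.Z" "w \<ominus>\<^bsub>B.C\<^esub> inc1 w' \<in> B1 R B" using inc1_surj b by blast
  then have "B.CB.cls w = B.CB.cls (inc1 w')" using b by (subst B.CB.cls_eq_iff) auto
  then have "\<Psi>H (A.H1.cls w') = h" using b w' by (simp add: \<Psi>H_cls B.cls_Z)
  then show ?thesis using A.H1.cls_closed[OF w'(1)] by blast
qed

lemma \<Psi>E_surj:
  assumes "f \<in> carrier B.EE" shows "\<exists>e\<in>carrier A.EE. \<Psi>E e = f"
proof -
  obtain \<xi> \<alpha> where "\<xi> \<in> carrier A.HD.Q" "\<Psi>D \<xi> = fst f" "\<alpha> \<in> carrier A.H1.Q" "\<Psi>H \<alpha> = snd f"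
    using \<Psi>D_surj[of "fst f"] \<Psi>H_surj[of "snd f"] assms by auto
  then show ?thesis by (intro bexI[of _ "(\<xi>, \<alpha>)"]) (auto simp: \<Psi>E_def)
qed

text \<open>The radical is defined by the form alone, and by surjectivity the form on \<open>B\<close> is tested by images
  of elements over \<open>A\<close>; so injectivity of \<open>\<phi>\<close> makes the map on the quotients injective.\<close>

lemma \<Psi>E_J_iff:
  assumes e: "e \<in> carrier A.EE"
  shows "\<Psi>E e \<in> J R B \<longleftrightarrow> e \<in> J R A"
proof -
  note [simp del] = A.E_carrier B.E_carrier
  have c: "E_form R A e e' \<in> carrier A.H0.Q" if "e' \<in> carrier A.EE" for e'
    using bilinearD(1)[OF A.E_form_bilinear] e that by simp
  have z: "\<phi> h = \<zero>\<^bsub>B.H0.Q\<^esub> \<longleftrightarrow> h = \<zero>\<^bsub>A.H0.Q\<^esub>" if "h \<in> carrier A.H0.Q" for h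
    using \<phi>_inj[OF that] \<phi>.zero by blast
  have "\<Psi>E e \<in> J R B \<longleftrightarrow> (\<forall>e'\<in>carrier A.EE. E_form R B (\<Psi>E e) (\<Psi>E e') = \<zero>\<^bsub>B.H0.Q\<^esub>)"
    unfolding J_def B.HH0_eq mem_Collect_eq using \<Psi>E_surj \<Psi>E.closed e by metis
  also have "\<dots> \<longleftrightarrow> (\<forall>e'\<in>carrier A.EE. E_form R A e e' = \<zero>\<^bsub>A.H0.Q\<^esub>)"
    by (rule ball_cong[OF refl]) (simp add: \<Psi>E_form[OF e] z c)
  also have "\<dots> \<longleftrightarrow> e \<in> J R A" unfolding J_def A.HH0_eq mem_Collect_eq using e by blast
  finally show ?thesis .
qed

definition "\<Psi> = descend (\<lambda>e. B.EJ.cls (\<Psi>E e))"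

lemma \<Psi>_pre: "linear_map R A.EE B.EJ.Q (\<lambda>e. B.EJ.cls (\<Psi>E e))"
  by (rule linear_map_comp[OF \<Psi>E_linear B.EJ.cls_linear])
lemma \<Psi>_kill: "e \<in> J R A \<Longrightarrow> B.EJ.cls (\<Psi>E e) = \<zero>\<^bsub>B.EJ.Q\<^esub>"
  using A.EJ.sub.a_Hcarr \<Psi>E_J_iff \<Psi>E.closed by (subst B.EJ.cls_eq_zero_iff) blast+
lemma \<Psi>_cls: "e \<in> carrier A.EE \<Longrightarrow> \<Psi> (A.EJ.cls e) = B.EJ.cls (\<Psi>E e)"
  unfolding \<Psi>_def by (rule A.EJ.linear_descend(1)[OF \<Psi>_pre \<Psi>_kill])
sublocale \<Psi>: linear_map R A.EJ.Q B.EJ.Q \<Psi>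
  unfolding \<Psi>_def by (rule A.EJ.linear_descend(2)[OF \<Psi>_pre \<Psi>_kill])

lemma \<phi>_bij: "bij_betw \<phi> (carrier A.H0.Q) (carrier B.H0.Q)"
  by (rule linear_bijI[OF \<phi>.linear_map_axioms \<phi>_inj \<phi>_surj])

lemma \<Psi>_bij: "bij_betw \<Psi> (carrier A.EJ.Q) (carrier B.EJ.Q)"
proof (rule linear_bijI[OF \<Psi>.linear_map_axioms])
  fix x assume x: "x \<in> carrier A.EJ.Q" "\<Psi> x = \<zero>\<^bsub>B.EJ.Q\<^esub>"
  then obtain e where e: "e \<in> carrier A.EE" "x = A.EJ.cls e" unfolding A.EJ.carrier_Q by blast
  then show "x = \<zero>\<^bsub>A.EJ.Q\<^esub>"
    using x \<Psi>E_J_iff[OF e(1)] \<Psi>E.closed[OF e(1)]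
    by (simp add: \<Psi>_cls A.EJ.cls_eq_zero_iff B.EJ.cls_eq_zero_iff del: A.E_carrier B.E_carrier)
next
  fix y assume y: "y \<in> carrier B.EJ.Q"
  then obtain f where f: "f \<in> carrier B.EE" "y = B.EJ.cls f" unfolding B.EJ.carrier_Q by blast
  obtain e where e: "e \<in> carrier A.EE" "\<Psi>E e = f" using \<Psi>E_surj[OF f(1)] by blast
  then show "\<exists>x\<in>carrier A.EJ.Q. \<Psi> x = y"
    using f \<Psi>_cls[OF e(1)] A.EJ.cls_closed[OF e(1)] by (intro bexI[of _ "A.EJ.cls e"]) simp_all
qed

lemma \<Psi>_eps_bracket:
  assumes "x \<in> carrier A.EJ.Q" "y \<in> carrier A.EJ.Q"
  shows "\<Psi> (eps_bracket R A x y) = eps_bracket R B (\<Psi> x) (\<Psi> y)"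
proof -
  obtain e where e: "e \<in> carrier A.EE" "x = A.EJ.cls e" using assms(1) unfolding A.EJ.carrier_Q by blast
  obtain f where f: "f \<in> carrier A.EE" "y = A.EJ.cls f" using assms(2) unfolding A.EJ.carrier_Q by blast
  show ?thesis
    using e f A.E_bracket_closed[OF e(1) f(1)] \<Psi>E.closed[OF e(1)] \<Psi>E.closed[OF f(1)]
    by (simp add: \<Psi>_cls A.eps_bracket_eq B.eps_bracket_eq \<Psi>E_bracket del: A.E_carrier B.E_carrier)
qed

lemma eps_form_closed:
  assumes "x \<in> carrier A.EJ.Q" "y \<in> carrier A.EJ.Q"
  shows "eps_form R A x y \<in> carrier A.H0.Q"
proof -
  obtain e where e: "e \<in> carrier A.EE" "x = A.EJ.cls e" using assms(1) unfolding A.EJ.carrier_Q by blast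
  obtain f where f: "f \<in> carrier A.EE" "y = A.EJ.cls f" using assms(2) unfolding A.EJ.carrier_Q by blast
  show ?thesis using e f bilinearD(1)[OF A.E_form_bilinear e(1) f(1)]
    by (simp add: A.eps_form_eq del: A.E_carrier)
qed

lemma \<Psi>_eps_form:
  assumes "x \<in> carrier A.EJ.Q" "y \<in> carrier A.EJ.Q"
  shows "eps_form R B (\<Psi> x) (\<Psi> y) = \<phi> (eps_form R A x y)"
proof -
  obtain e where e: "e \<in> carrier A.EE" "x = A.EJ.cls e" using assms(1) unfolding A.EJ.carrier_Q by blast
  obtain f where f: "f \<in> carrier A.EE" "y = A.EJ.cls f" using assms(2) unfolding A.EJ.carrier_Q by blast
  show ?thesis
    using e f \<Psi>E.closed[OF e(1)] \<Psi>E.closed[OF f(1)]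
    by (simp add: \<Psi>_cls A.eps_form_eq B.eps_form_eq \<Psi>E_form del: A.E_carrier B.E_carrier)
qed

lemma dirac_bij: "bij_betw (\<lambda>L. \<Psi> ` L) (dirac_structures R A) (dirac_structures R B)"
proof -
  note sub = dirac_structures_subset
  have img: "\<Psi> ` L \<in> dirac_structures R B \<longleftrightarrow> L \<in> dirac_structures R A" if "L \<subseteq> carrier (eps R A)" for L
    using that \<Psi>_eps_bracket \<Psi>_eps_form eps_form_closed \<phi>_bij \<Psi>_bij
    by (intro dirac_structures_image[where \<phi> = \<phi>] A.alg_axioms B.alg_axioms)
      (simp_all add: A.eps_eq B.eps_eq A.HH0_eq B.HH0_eq \<Psi>.linear_map_axioms \<phi>.linear_map_axioms bij_betw_def)
  have inj: "inj_on \<Psi> (carrier (eps R A))" and sur: "\<Psi> ` carrier (eps R A) = carrier (eps R B)"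
    using \<Psi>_bij by (auto simp: bij_betw_def A.eps_eq B.eps_eq)
  show ?thesis
  proof (rule bij_betwI')
    fix L L' assume "L \<in> dirac_structures R A" "L' \<in> dirac_structures R A"
    then show "\<Psi> ` L = \<Psi> ` L' \<longleftrightarrow> L = L'" using inj_on_image_eq_iff[OF inj sub sub] by blast
  next
    fix L assume L: "L \<in> dirac_structures R A"
    then show "\<Psi> ` L \<in> dirac_structures R B" using img[OF sub] by blast
  next
    fix K assume K: "K \<in> dirac_structures R B"
    then obtain L where "L \<subseteq> carrier (eps R A)" "K = \<Psi> ` L"
      using sub[OF K] unfolding sur[symmetric] by (auto simp: subset_image_iff)
    then show "\<exists>L\<in>dirac_structures R A. K = \<Psi> ` L" using img K by blast
  qed
qed

theorem courant_isomorphism: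
  "\<exists>\<Psi> \<phi>.
    \<Psi> \<in> module_iso R (eps R A) (eps R B) \<and>
    \<phi> \<in> module_iso R (HH0 R A) (HH0 R B) \<and>
    (\<forall>e1\<in>carrier (eps R A). \<forall>e2\<in>carrier (eps R A).
      \<Psi> (eps_bracket R A e1 e2) = eps_bracket R B (\<Psi> e1) (\<Psi> e2)) \<and>
    (\<forall>e1\<in>carrier (eps R A). \<forall>e2\<in>carrier (eps R A).
      eps_form R B (\<Psi> e1) (\<Psi> e2) = \<phi> (eps_form R A e1 e2)) \<and>
    bij_betw (\<lambda>L. \<Psi> ` L) (dirac_structures R A) (dirac_structures R B)"
  using \<Psi>_eps_bracket \<Psi>_eps_form \<Psi>_bij \<phi>_bij \<Psi>.hom \<phi>.hom dirac_bij
  by (intro exI[of _ \<Psi>] exI[of _ \<phi>]) (simp add: module_iso_def A.eps_eq B.eps_eq A.HH0_eq B.HH0_eq)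

end

section \<open>Full corners\<close>

text \<open>The elements \<open>v\<^sub>j b u\<^sub>k\<close> are to be read as the matrix entries of \<open>b\<close>; the decomposition of the unit
  recovers \<open>b\<close> from them.\<close>

locale full_corner = corner +
  fixes I :: "'i set" and u v :: "'i \<Rightarrow> 'c"
  assumes finite_I: "finite I"
    and u_closed: "j \<in> I \<Longrightarrow> u j \<in> carrier B"
    and v_closed: "j \<in> I \<Longrightarrow> v j \<in> carrier B"
    and unit_sum: "(\<Oplus>\<^bsub>B\<^esub>j\<in>I. u j \<otimes>\<^bsub>B\<^esub> v j) = \<one>\<^bsub>B\<^esub>"
    and entry: "j \<in> I \<Longrightarrow> k \<in> I \<Longrightarrow> b \<in> carrier B \<Longrightarrow> v j \<otimes>\<^bsub>B\<^esub> b \<otimes>\<^bsub>B\<^esub> u k \<in> inc ` carrier A"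
    and inc_inj: "inj_on inc (carrier A)"
begin

notation B.mul (infixl "\<cdot>" 70)

lemmas uv_closed [simp] = u_closed v_closed

lemma expand_left:
  assumes b: "b \<in> carrier B"
  shows "b = (\<Oplus>\<^bsub>B\<^esub>j\<in>I. b \<cdot> u j \<cdot> v j)"
proof -
  have "b = b \<cdot> (\<Oplus>\<^bsub>B\<^esub>j\<in>I. u j \<cdot> v j)" using b by (simp add: unit_sum)
  also have "\<dots> = (\<Oplus>\<^bsub>B\<^esub>j\<in>I. b \<cdot> (u j \<cdot> v j))"
    using b finite_I by (subst linear_map.finsum[OF B.linear_lmult]) auto
  also have "\<dots> = (\<Oplus>\<^bsub>B\<^esub>j\<in>I. b \<cdot> u j \<cdot> v j)"
    using b by (intro B.A.finsum_cong') (auto simp: B.A.m_assoc)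
  finally show ?thesis .
qed

text \<open>Since \<open>b u\<^sub>j v\<^sub>j\<close> and \<open>v\<^sub>j b u\<^sub>j\<close> differ by a commutator, modulo commutators an element equals the sum
  of its diagonal entries.\<close>

lemma inc_surj:
  assumes b: "b \<in> carrier B"
  shows "\<exists>a\<in>carrier A. b \<ominus>\<^bsub>B\<^esub> inc a \<in> B0 R B"
proof -
  have "\<forall>j\<in>I. \<exists>a\<in>carrier A. v j \<cdot> b \<cdot> u j = inc a" using entry b by blast
  then obtain d where d: "\<And>j. j \<in> I \<Longrightarrow> d j \<in> carrier A" "\<And>j. j \<in> I \<Longrightarrow> v j \<cdot> b \<cdot> u j = inc (d j)"
    by metis
  have "B.H0.cls b = B.H0.cls (\<Oplus>\<^bsub>B\<^esub>j\<in>I. b \<cdot> u j \<cdot> v j)" using expand_left[OF b] by simp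
  also have "\<dots> = (\<Oplus>\<^bsub>B.H0.Q\<^esub>j\<in>I. B.H0.cls (b \<cdot> u j \<cdot> v j))"
    using b finite_I by (intro B.H0.proj.finsum) auto
  also have "\<dots> = (\<Oplus>\<^bsub>B.H0.Q\<^esub>j\<in>I. B.H0.cls (inc (d j)))"
  proof (rule B.H0.proj.N.M.finsum_cong')
    fix j assume j: "j \<in> I"
    have "b \<cdot> u j \<cdot> v j \<ominus>\<^bsub>B\<^esub> v j \<cdot> (b \<cdot> u j) \<in> B0 R B" using b j by (simp add: B.B0_commutator)
    then show "B.H0.cls (b \<cdot> u j \<cdot> v j) = B.H0.cls (inc (d j))"
      using b j by (simp add: B.H0.cls_eq_iff B.A.m_assoc flip: d(2))
  qed (use d in auto)
  also have "\<dots> = B.H0.cls (inc (finsum A d I))"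
    using d finite_I by (subst inc.finsum) (auto simp: B.H0.proj.finsum)
  finally have "b \<ominus>\<^bsub>B\<^esub> inc (finsum A d I) \<in> B0 R B"
    using b d by (subst B.H0.cls_eq_iff[symmetric]) (auto intro!: A.A.finsum_closed)
  moreover have "finsum A d I \<in> carrier A" using d by (auto intro!: A.A.finsum_closed)
  ultimately show ?thesis by blast
qed

text \<open>The homotopy in degree 0: the boundary of a chain representing \<open>s m\<close> is \<open>m\<close> minus the sum of its
  diagonal entries.\<close>

definition s where "s m = (\<Oplus>\<^bsub>B.CB.Q\<^esub>j\<in>I. B.q (m \<cdot> u j) (v j))"

lemma s_linear: "linear_map R B B.CB.Q s"
proof (rule linear_mapI[OF B.M.module_axioms B.CB.module_quotient])
  show cl: "s m \<in> carrier B.CB.Q" if "m \<in> carrier B" for m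
    unfolding s_def using that by (intro B.CB.proj.N.M.finsum_closed) auto
  fix m n c assume m: "m \<in> carrier B"
  show "s (m \<oplus>\<^bsub>B\<^esub> n) = s m \<oplus>\<^bsub>B.CB.Q\<^esub> s n" if "n \<in> carrier B"
  proof -
    have "s (m \<oplus>\<^bsub>B\<^esub> n) = (\<Oplus>\<^bsub>B.CB.Q\<^esub>j\<in>I. B.q (m \<cdot> u j) (v j) \<oplus>\<^bsub>B.CB.Q\<^esub> B.q (n \<cdot> u j) (v j))"
      unfolding s_def using m that
      by (intro B.CB.proj.N.M.finsum_cong') (simp_all add: B.A.l_distr B.q_add_left Pi_iff)
    also have "\<dots> = s m \<oplus>\<^bsub>B.CB.Q\<^esub> s n"
      unfolding s_def using m that by (intro B.CB.proj.N.M.finsum_addf) auto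
    finally show ?thesis .
  qed
  show "s (c \<odot>\<^bsub>B\<^esub> m) = c \<odot>\<^bsub>B.CB.Q\<^esub> s m" if "c \<in> carrier R"
  proof -
    have "s (c \<odot>\<^bsub>B\<^esub> m) = (\<Oplus>\<^bsub>B.CB.Q\<^esub>j\<in>I. c \<odot>\<^bsub>B.CB.Q\<^esub> B.q (m \<cdot> u j) (v j))"
      unfolding s_def using m that
      by (intro B.CB.proj.N.M.finsum_cong')
        (simp_all add: B.smult_mult_left bilinearD(4)[OF B.q_bilinear] Pi_iff)
    also have "\<dots> = c \<odot>\<^bsub>B.CB.Q\<^esub> s m"
      unfolding s_def using m that finite_I
      by (intro B.CB.proj.N.finsum_smult_ldistr[symmetric]) auto
    finally show ?thesis .
  qed
qed

lemmas s_closed [simp] = linear_map.closed[OF s_linear]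
lemmas s_add = linear_map.add[OF s_linear]
lemmas s_diff = linear_map.diff[OF s_linear]
lemmas s_zero = linear_map.zero[OF s_linear]

text \<open>The Leibniz rule moves \<open>v\<^sub>j\<close> to the left factor, where the sum over \<open>j\<close> collapses to \<open>m\<close>.\<close>

lemma q_expand:
  assumes m: "m \<in> carrier B" and n: "n \<in> carrier B"
  shows "(\<Oplus>\<^bsub>B.CB.Q\<^esub>j\<in>I. B.q (m \<cdot> u j) (v j \<cdot> n)) = B.q m n \<oplus>\<^bsub>B.CB.Q\<^esub> s (n \<cdot> m)"
proof -
  have "(\<Oplus>\<^bsub>B.CB.Q\<^esub>j\<in>I. B.q (m \<cdot> u j) (v j \<cdot> n)) =
      (\<Oplus>\<^bsub>B.CB.Q\<^esub>j\<in>I. B.q (m \<cdot> u j \<cdot> v j) n \<oplus>\<^bsub>B.CB.Q\<^esub> B.q (n \<cdot> m \<cdot> u j) (v j))"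
    using m n by (intro B.CB.proj.N.M.finsum_cong') (auto simp: B.q_mult_right B.A.m_assoc)
  also have "\<dots> = (\<Oplus>\<^bsub>B.CB.Q\<^esub>j\<in>I. B.q (m \<cdot> u j \<cdot> v j) n) \<oplus>\<^bsub>B.CB.Q\<^esub> s (n \<cdot> m)"
    unfolding s_def using m n by (intro B.CB.proj.N.M.finsum_addf) auto
  also have "(\<Oplus>\<^bsub>B.CB.Q\<^esub>j\<in>I. B.q (m \<cdot> u j \<cdot> v j) n) = B.q (\<Oplus>\<^bsub>B\<^esub>j\<in>I. m \<cdot> u j \<cdot> v j) n"
    using m n finite_I
    by (intro linear_map.finsum[OF bilinear_left[OF B.M.module_axioms B.CB.module_quotient B.q_bilinear], symmetric]) auto
  finally show ?thesis using expand_left[OF m] by simp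
qed

text \<open>Expanding \<open>n\<close> as the sum of the elements \<open>n u\<^sub>k v\<^sub>k\<close> and moving \<open>v\<^sub>k\<close> around the cycle produces both
  factors of the corner chain as matrix entries.\<close>

lemma q_expand2:
  assumes m: "m \<in> carrier B" and n: "n \<in> carrier B"
  shows "B.q m n \<oplus>\<^bsub>B.CB.Q\<^esub> s (n \<cdot> m) =
    s (m \<cdot> n) \<oplus>\<^bsub>B.CB.Q\<^esub> (\<Oplus>\<^bsub>B.CB.Q\<^esub>k\<in>I. \<Oplus>\<^bsub>B.CB.Q\<^esub>j\<in>I. B.q (v k \<cdot> m \<cdot> u j) (v j \<cdot> n \<cdot> u k))"
proof -
  let ?S = "\<lambda>k. \<Oplus>\<^bsub>B.CB.Q\<^esub>j\<in>I. B.q (v k \<cdot> m \<cdot> u j) (v j \<cdot> n \<cdot> u k)"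
  have k: "B.q m (n \<cdot> u k \<cdot> v k) \<oplus>\<^bsub>B.CB.Q\<^esub> s (n \<cdot> u k \<cdot> v k \<cdot> m) = B.q (m \<cdot> n \<cdot> u k) (v k) \<oplus>\<^bsub>B.CB.Q\<^esub> ?S k"
    if k: "k \<in> I" for k
  proof -
    have "B.q m (n \<cdot> u k \<cdot> v k) \<oplus>\<^bsub>B.CB.Q\<^esub> s (n \<cdot> u k \<cdot> v k \<cdot> m) =
       (\<Oplus>\<^bsub>B.CB.Q\<^esub>j\<in>I. B.q (m \<cdot> u j) (v j \<cdot> (n \<cdot> u k \<cdot> v k)))"
      using m n k by (simp add: q_expand)
    also have "\<dots> = (\<Oplus>\<^bsub>B.CB.Q\<^esub>j\<in>I. B.q (m \<cdot> u j \<cdot> v j \<cdot> (n \<cdot> u k)) (v k) \<oplus>\<^bsub>B.CB.Q\<^esub> B.q (v k \<cdot> m \<cdot> u j) (v j \<cdot> n \<cdot> u k))"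
    proof (rule B.CB.proj.N.M.finsum_cong')
      fix j assume "j \<in> I"
      then show "B.q (m \<cdot> u j) (v j \<cdot> (n \<cdot> u k \<cdot> v k)) =
          B.q (m \<cdot> u j \<cdot> v j \<cdot> (n \<cdot> u k)) (v k) \<oplus>\<^bsub>B.CB.Q\<^esub> B.q (v k \<cdot> m \<cdot> u j) (v j \<cdot> n \<cdot> u k)"
        using B.q_mult_right[of "m \<cdot> u j" "v j \<cdot> n \<cdot> u k" "v k"] m n k by (simp add: B.A.m_assoc)
    qed (use m n k in auto)
    also have "\<dots> = (\<Oplus>\<^bsub>B.CB.Q\<^esub>j\<in>I. B.q (m \<cdot> u j \<cdot> v j \<cdot> (n \<cdot> u k)) (v k)) \<oplus>\<^bsub>B.CB.Q\<^esub> ?S k"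
      using m n k by (intro B.CB.proj.N.M.finsum_addf) auto
    also have "(\<Oplus>\<^bsub>B.CB.Q\<^esub>j\<in>I. B.q (m \<cdot> u j \<cdot> v j \<cdot> (n \<cdot> u k)) (v k)) =
        B.q ((\<Oplus>\<^bsub>B\<^esub>j\<in>I. m \<cdot> u j \<cdot> v j) \<cdot> (n \<cdot> u k)) (v k)"
      using m n k finite_I
      by (intro linear_map.finsum[OF linear_map_comp[OF B.linear_rmult
            bilinear_left[OF B.M.module_axioms B.CB.module_quotient B.q_bilinear]], symmetric]) auto
    also have "(\<Oplus>\<^bsub>B\<^esub>j\<in>I. m \<cdot> u j \<cdot> v j) \<cdot> (n \<cdot> u k) = m \<cdot> n \<cdot> u k"
      using expand_left[OF m] m n k by (simp add: B.A.m_assoc)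
    finally show ?thesis .
  qed
  have Sc: "?S k \<in> carrier B.CB.Q" if "k \<in> I" for k
    using m n that by (intro B.CB.proj.N.M.finsum_closed) auto
  have "B.q m n = (\<Oplus>\<^bsub>B.CB.Q\<^esub>k\<in>I. B.q m (n \<cdot> u k \<cdot> v k))"
    using m n finite_I expand_left[OF n]
      linear_map.finsum[OF bilinear_right[OF B.M.module_axioms B.CB.module_quotient B.q_bilinear m], of "\<lambda>k. n \<cdot> u k \<cdot> v k" I]
    by (simp add: Pi_iff)
  moreover have "s (n \<cdot> m) = (\<Oplus>\<^bsub>B.CB.Q\<^esub>k\<in>I. s (n \<cdot> u k \<cdot> v k \<cdot> m))"
    using m n finite_I expand_left[OF n]
      linear_map.finsum[OF linear_map_comp[OF B.linear_rmult[OF m] s_linear], of "\<lambda>k. n \<cdot> u k \<cdot> v k" I]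
    by (simp add: Pi_iff)
  ultimately have "B.q m n \<oplus>\<^bsub>B.CB.Q\<^esub> s (n \<cdot> m) =
      (\<Oplus>\<^bsub>B.CB.Q\<^esub>k\<in>I. B.q m (n \<cdot> u k \<cdot> v k) \<oplus>\<^bsub>B.CB.Q\<^esub> s (n \<cdot> u k \<cdot> v k \<cdot> m))"
    using m n by (subst B.CB.proj.N.M.finsum_addf) auto
  also have "\<dots> = (\<Oplus>\<^bsub>B.CB.Q\<^esub>k\<in>I. B.q (m \<cdot> n \<cdot> u k) (v k) \<oplus>\<^bsub>B.CB.Q\<^esub> ?S k)"
    using k Sc m n by (intro B.CB.proj.N.M.finsum_cong') auto
  also have "\<dots> = s (m \<cdot> n) \<oplus>\<^bsub>B.CB.Q\<^esub> (\<Oplus>\<^bsub>B.CB.Q\<^esub>k\<in>I. ?S k)"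
    unfolding s_def using Sc m n by (intro B.CB.proj.N.M.finsum_addf) auto
  finally show ?thesis .
qed

text \<open>On a pure tensor this is \<open>q_expand2\<close>, since the two values of \<open>s\<close> there combine to the value on
  the commutator. For cycles the correction term vanishes.\<close>

lemma chain_into_corner:
  assumes "w \<in> carrier B.C"
  shows "\<exists>w'\<in>carrier A.C. B.CB.cls w = B.CB.cls (inc1 w') \<oplus>\<^bsub>B.CB.Q\<^esub> s (boundary1 B w)"
  using assms
proof (induction rule: B.C_induct)
  case (pure m n)
  have "\<exists>a. \<forall>k\<in>I. \<forall>j\<in>I. a k j \<in> carrier A \<and> v k \<cdot> b \<cdot> u j = inc (a k j)" if "b \<in> carrier B" for b
  proof -
    have "\<forall>k\<in>I. \<forall>j\<in>I. v k \<cdot> b \<cdot> u j \<in> inc ` carrier A" using entry that by blast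
    then show ?thesis
      by (intro exI[of _ "\<lambda>k j. inv_into (carrier A) inc (v k \<cdot> b \<cdot> u j)"])
        (auto simp: f_inv_into_f intro!: inv_into_into)
  qed
  from this[OF pure(1)] this[OF pure(2)] obtain a b where
    a: "\<And>k j. k \<in> I \<Longrightarrow> j \<in> I \<Longrightarrow> a k j \<in> carrier A" "\<And>k j. k \<in> I \<Longrightarrow> j \<in> I \<Longrightarrow> v k \<cdot> m \<cdot> u j = inc (a k j)"
    and b: "\<And>k j. k \<in> I \<Longrightarrow> j \<in> I \<Longrightarrow> b k j \<in> carrier A" "\<And>k j. k \<in> I \<Longrightarrow> j \<in> I \<Longrightarrow> v k \<cdot> n \<cdot> u j = inc (b k j)"
    by blast
  \<comment> \<open>A representative in the corner of the double sum in \<open>q_expand2\<close>.\<close>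
  define w' where "w' = (\<Oplus>\<^bsub>A.C\<^esub>k\<in>I. \<Oplus>\<^bsub>A.C\<^esub>j\<in>I. A.t (a k j) (b j k))"
  have inner: "(\<Oplus>\<^bsub>A.C\<^esub>j\<in>I. A.t (a k j) (b j k)) \<in> carrier A.C" if "k \<in> I" for k
    using that a b by (intro A.C.M.finsum_closed) auto
  have w': "w' \<in> carrier A.C" unfolding w'_def using inner by (intro A.C.M.finsum_closed) auto
  have lin: "linear_map R A.C B.CB.Q (\<lambda>x. B.CB.cls (inc1 x))"
    by (rule linear_map_comp[OF inc1.linear_map_axioms B.CB.cls_linear])
  have cls_k: "B.CB.cls (inc1 (\<Oplus>\<^bsub>A.C\<^esub>j\<in>I. A.t (a k j) (b j k))) =
      (\<Oplus>\<^bsub>B.CB.Q\<^esub>j\<in>I. B.q (v k \<cdot> m \<cdot> u j) (v j \<cdot> n \<cdot> u k))" if "k \<in> I" for k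
  proof -
    have "B.CB.cls (inc1 (\<Oplus>\<^bsub>A.C\<^esub>j\<in>I. A.t (a k j) (b j k))) =
        (\<Oplus>\<^bsub>B.CB.Q\<^esub>j\<in>I. B.CB.cls (inc1 (A.t (a k j) (b j k))))"
      using that a b finite_I by (intro linear_map.finsum[OF lin]) auto
    also have "\<dots> = (\<Oplus>\<^bsub>B.CB.Q\<^esub>j\<in>I. B.q (v k \<cdot> m \<cdot> u j) (v j \<cdot> n \<cdot> u k))"
      using that pure a b by (intro B.CB.proj.N.M.finsum_cong') (simp_all add: inc1_t Pi_iff)
    finally show ?thesis .
  qed
  have cls_w': "B.CB.cls (inc1 w') =
      (\<Oplus>\<^bsub>B.CB.Q\<^esub>k\<in>I. \<Oplus>\<^bsub>B.CB.Q\<^esub>j\<in>I. B.q (v k \<cdot> m \<cdot> u j) (v j \<cdot> n \<cdot> u k))"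
  proof -
    have "B.CB.cls (inc1 w') = (\<Oplus>\<^bsub>B.CB.Q\<^esub>k\<in>I. B.CB.cls (inc1 (\<Oplus>\<^bsub>A.C\<^esub>j\<in>I. A.t (a k j) (b j k))))"
      unfolding w'_def using inner finite_I by (intro linear_map.finsum[OF lin]) auto
    also have "\<dots> = (\<Oplus>\<^bsub>B.CB.Q\<^esub>k\<in>I. \<Oplus>\<^bsub>B.CB.Q\<^esub>j\<in>I. B.q (v k \<cdot> m \<cdot> u j) (v j \<cdot> n \<cdot> u k))"
      using pure by (intro B.CB.proj.N.M.finsum_cong' refl cls_k)
        (auto intro!: B.CB.proj.N.M.finsum_closed)
    finally show ?thesis .
  qed
  have cancel: "x = z \<oplus>\<^bsub>B.CB.Q\<^esub> (y' \<ominus>\<^bsub>B.CB.Q\<^esub> y)" if "x \<oplus>\<^bsub>B.CB.Q\<^esub> y = y' \<oplus>\<^bsub>B.CB.Q\<^esub> z"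
    "x \<in> carrier B.CB.Q" "y \<in> carrier B.CB.Q" "y' \<in> carrier B.CB.Q" "z \<in> carrier B.CB.Q" for x y y' z
  proof -
    have "x = x \<oplus>\<^bsub>B.CB.Q\<^esub> y \<ominus>\<^bsub>B.CB.Q\<^esub> y" using that(2,3) by algebra
    also have "\<dots> = z \<oplus>\<^bsub>B.CB.Q\<^esub> (y' \<ominus>\<^bsub>B.CB.Q\<^esub> y)" unfolding that(1) using that(2-) by algebra
    finally show ?thesis .
  qed
  have "B.q m n = B.CB.cls (inc1 w') \<oplus>\<^bsub>B.CB.Q\<^esub> (s (m \<cdot> n) \<ominus>\<^bsub>B.CB.Q\<^esub> s (n \<cdot> m))"
    using q_expand2[OF pure] pure w' unfolding cls_w'[symmetric] by (intro cancel) auto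
  then show ?case using w' pure by (auto simp: B.b1_t s_diff)
next
  case (add w1 w2)
  from add(3,4) obtain a1 a2 where a: "a1 \<in> carrier A.C" "a2 \<in> carrier A.C"
    "B.CB.cls w1 = B.CB.cls (inc1 a1) \<oplus>\<^bsub>B.CB.Q\<^esub> s (boundary1 B w1)"
    "B.CB.cls w2 = B.CB.cls (inc1 a2) \<oplus>\<^bsub>B.CB.Q\<^esub> s (boundary1 B w2)" by blast
  have "(p \<oplus>\<^bsub>B.CB.Q\<^esub> x) \<oplus>\<^bsub>B.CB.Q\<^esub> (p' \<oplus>\<^bsub>B.CB.Q\<^esub> y) = (p \<oplus>\<^bsub>B.CB.Q\<^esub> p') \<oplus>\<^bsub>B.CB.Q\<^esub> (x \<oplus>\<^bsub>B.CB.Q\<^esub> y)"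
    if "p \<in> carrier B.CB.Q" "p' \<in> carrier B.CB.Q" "x \<in> carrier B.CB.Q" "y \<in> carrier B.CB.Q" for p p' x y
    using that by algebra
  from this[of "B.CB.cls (inc1 a1)" "B.CB.cls (inc1 a2)" "s (boundary1 B w1)" "s (boundary1 B w2)"]
  show ?case using a(1,2) add(1,2)
    by (intro bexI[of _ "a1 \<oplus>\<^bsub>A.C\<^esub> a2"])
      (simp_all add: B.CB.proj.add B.b1.add inc1.add s_add a(3,4))
qed

lemma inc1_surj:
  assumes w: "w \<in> carrier B.Z"
  shows "\<exists>w'\<in>carrier A.Z. w \<ominus>\<^bsub>B.C\<^esub> inc1 w' \<in> B1 R B"
proof -
  obtain w' where w': "w' \<in> carrier A.C" "B.CB.cls w = B.CB.cls (inc1 w')"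
    using chain_into_corner[of w] w by (auto simp: s_zero)
  then have d: "w \<ominus>\<^bsub>B.C\<^esub> inc1 w' \<in> B1 R B" using w by (simp add: B.CB.cls_eq_iff)
  \<comment> \<open>The corner chain is a cycle because \<open>inc\<close> is injective and commutes with the boundary.\<close>
  from B.b1_B1[OF d] have "inc (boundary1 A w') = inc \<zero>\<^bsub>A\<^esub>"
    using w w' by (simp add: B.b1.diff b1_inc1 inc.zero B.A.diff_eq_iff)
  then have "boundary1 A w' = \<zero>\<^bsub>A\<^esub>" using inc_inj w' by (auto dest: inj_onD)
  then show ?thesis using w' d by auto
qed

end

section \<open>Matrix algebras\<close>

lemma (in abelian_group) finsum_swap:
  assumes "finite I" "finite J'" "\<And>i j. i \<in> I \<Longrightarrow> j \<in> J' \<Longrightarrow> f i j \<in> carrier G"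
  shows "(\<Oplus>i\<in>I. \<Oplus>j\<in>J'. f i j) = (\<Oplus>j\<in>J'. \<Oplus>i\<in>I. f i j)"
  using assms(1,3)
proof (induction rule: finite_induct)
  case empty
  then show ?case by (simp add: finsum_empty finsum_zero)
next
  case (insert i I)
  have c: "(\<Oplus>j\<in>J'. f k j) \<in> carrier G" if "k \<in> insert i I" for k
    using that insert by (intro finsum_closed) auto
  have d: "(\<Oplus>k\<in>I. f k j) \<in> carrier G" if "j \<in> J'" for j
    using that insert by (intro finsum_closed) auto
  have "(\<Oplus>k\<in>insert i I. \<Oplus>j\<in>J'. f k j) = (\<Oplus>j\<in>J'. f i j) \<oplus> (\<Oplus>j\<in>J'. \<Oplus>k\<in>I. f k j)"
    using insert c by (subst finsum_insert) auto
  also have "\<dots> = (\<Oplus>j\<in>J'. f i j \<oplus> (\<Oplus>k\<in>I. f k j))"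
    using insert d by (intro finsum_addf[symmetric]) auto
  also have "\<dots> = (\<Oplus>j\<in>J'. \<Oplus>k\<in>insert i I. f k j)"
    using insert d by (intro finsum_cong' refl) (simp_all add: finsum_insert Pi_iff)
  finally show ?case .
qed

lemma (in abelian_group) finsum_delta:
  fixes i r :: nat
  assumes "i < r" "\<And>l. l < r \<Longrightarrow> f l \<in> carrier G"
  shows "(\<Oplus>l\<in>{..<r}. if l = i then f l else \<zero>) = f i"
  using finsum_singleton[of i "{..<r}" f] assms by (auto simp: Pi_iff eq_commute[of _ i] cong: if_cong)

locale matrices = alg R A for R :: "'k ring" and A :: "('k, 'a) module" +
  fixes r :: nat
  assumes r_pos: "0 < r"
begin

abbreviation MM where "MM \<equiv> matrix_algebra A r"

lemma carrier_MM: "M \<in> carrier MM \<longleftrightarrow> M \<in> {..<r} \<times> {..<r} \<rightarrow>\<^sub>E carrier A"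
  by (simp add: matrix_algebra_def)

lemma entry_closed [simp]: "M \<in> carrier MM \<Longrightarrow> i < r \<Longrightarrow> j < r \<Longrightarrow> M (i, j) \<in> carrier A"
  by (auto simp: carrier_MM)

lemma matrix_eqI:
  assumes "M \<in> carrier MM" "N \<in> carrier MM" "\<And>i j. i < r \<Longrightarrow> j < r \<Longrightarrow> M (i, j) = N (i, j)"
  shows "M = N"
  using assms by (intro PiE_ext[of M _ _ N]) (auto simp: carrier_MM)

lemma matrixI: "(\<And>i j. i < r \<Longrightarrow> j < r \<Longrightarrow> f (i, j) \<in> carrier A) \<Longrightarrow> (\<lambda>p\<in>{..<r} \<times> {..<r}. f p) \<in> carrier MM"
  by (auto simp: carrier_MM)

lemma mult_entry: "i < r \<Longrightarrow> j < r \<Longrightarrow> (M \<otimes>\<^bsub>MM\<^esub> N) (i, j) = (\<Oplus>\<^bsub>A\<^esub>l\<in>{..<r}. M (i, l) \<cdot> N (l, j))"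
  and add_entry: "i < r \<Longrightarrow> j < r \<Longrightarrow> (M \<oplus>\<^bsub>MM\<^esub> N) (i, j) = M (i, j) \<oplus>\<^bsub>A\<^esub> N (i, j)"
  and smult_entry: "i < r \<Longrightarrow> j < r \<Longrightarrow> (c \<odot>\<^bsub>MM\<^esub> M) (i, j) = c \<odot>\<^bsub>A\<^esub> M (i, j)"
  and zero_entry: "i < r \<Longrightarrow> j < r \<Longrightarrow> \<zero>\<^bsub>MM\<^esub> (i, j) = \<zero>\<^bsub>A\<^esub>"
  and one_entry: "i < r \<Longrightarrow> j < r \<Longrightarrow> \<one>\<^bsub>MM\<^esub> (i, j) = (if i = j then \<one>\<^bsub>A\<^esub> else \<zero>\<^bsub>A\<^esub>)"
  by (simp_all add: matrix_algebra_def)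

lemma MM_mult_closed: "M \<in> carrier MM \<Longrightarrow> N \<in> carrier MM \<Longrightarrow> M \<otimes>\<^bsub>MM\<^esub> N \<in> carrier MM"
  by (auto simp: carrier_MM matrix_algebra_def split: prod.splits intro!: A.finsum_closed)

lemma MM_closed:
  "M \<in> carrier MM \<Longrightarrow> N \<in> carrier MM \<Longrightarrow> M \<oplus>\<^bsub>MM\<^esub> N \<in> carrier MM"
  "c \<in> carrier R \<Longrightarrow> M \<in> carrier MM \<Longrightarrow> c \<odot>\<^bsub>MM\<^esub> M \<in> carrier MM"
  "\<zero>\<^bsub>MM\<^esub> \<in> carrier MM" "\<one>\<^bsub>MM\<^esub> \<in> carrier MM"
  by (auto simp: carrier_MM matrix_algebra_def PiE_iff split: prod.splits)

lemma MM_assoc: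
  assumes "M \<in> carrier MM" "N \<in> carrier MM" "P \<in> carrier MM"
  shows "M \<otimes>\<^bsub>MM\<^esub> N \<otimes>\<^bsub>MM\<^esub> P = M \<otimes>\<^bsub>MM\<^esub> (N \<otimes>\<^bsub>MM\<^esub> P)"
proof (rule matrix_eqI)
  fix i j assume ij: "i < r" "j < r"
  have "(M \<otimes>\<^bsub>MM\<^esub> N \<otimes>\<^bsub>MM\<^esub> P) (i, j) = (\<Oplus>\<^bsub>A\<^esub>k\<in>{..<r}. \<Oplus>\<^bsub>A\<^esub>l\<in>{..<r}. M (i, l) \<cdot> N (l, k) \<cdot> P (k, j))"
    using assms ij unfolding mult_entry[OF ij]
    by (intro A.finsum_cong' refl) (auto simp: mult_entry A.finsum_ldistr intro!: A.finsum_closed)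
  also have "\<dots> = (\<Oplus>\<^bsub>A\<^esub>l\<in>{..<r}. \<Oplus>\<^bsub>A\<^esub>k\<in>{..<r}. M (i, l) \<cdot> N (l, k) \<cdot> P (k, j))"
    using assms ij by (intro A.finsum_swap) auto
  also have "\<dots> = (M \<otimes>\<^bsub>MM\<^esub> (N \<otimes>\<^bsub>MM\<^esub> P)) (i, j)"
    using assms ij unfolding mult_entry[OF ij]
    by (intro A.finsum_cong' refl)
      (simp_all add: mult_entry A.finsum_rdistr Pi_iff A.finsum_closed,
       intro A.finsum_cong' refl, simp_all add: A.m_assoc Pi_iff)
  finally show "(M \<otimes>\<^bsub>MM\<^esub> N \<otimes>\<^bsub>MM\<^esub> P) (i, j) = (M \<otimes>\<^bsub>MM\<^esub> (N \<otimes>\<^bsub>MM\<^esub> P)) (i, j)" .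
qed (use assms in \<open>simp_all add: MM_mult_closed\<close>)

lemma MM_one_left:
  assumes "M \<in> carrier MM"
  shows "\<one>\<^bsub>MM\<^esub> \<otimes>\<^bsub>MM\<^esub> M = M"
proof (rule matrix_eqI)
  fix i j assume ij: "i < r" "j < r"
  have "(\<one>\<^bsub>MM\<^esub> \<otimes>\<^bsub>MM\<^esub> M) (i, j) = (\<Oplus>\<^bsub>A\<^esub>l\<in>{..<r}. if l = i then M (l, j) else \<zero>\<^bsub>A\<^esub>)"
    using assms ij unfolding mult_entry[OF ij]
    by (intro A.finsum_cong' refl) (auto simp: one_entry)
  also have "\<dots> = M (i, j)" using assms ij by (simp add: A.finsum_delta)
  finally show "(\<one>\<^bsub>MM\<^esub> \<otimes>\<^bsub>MM\<^esub> M) (i, j) = M (i, j)" .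
qed (use assms in \<open>simp_all add: MM_mult_closed MM_closed\<close>)

lemma MM_one_right:
  assumes "M \<in> carrier MM"
  shows "M \<otimes>\<^bsub>MM\<^esub> \<one>\<^bsub>MM\<^esub> = M"
proof (rule matrix_eqI)
  fix i j assume ij: "i < r" "j < r"
  have "(M \<otimes>\<^bsub>MM\<^esub> \<one>\<^bsub>MM\<^esub>) (i, j) = (\<Oplus>\<^bsub>A\<^esub>l\<in>{..<r}. if l = j then M (i, l) else \<zero>\<^bsub>A\<^esub>)"
    using assms ij unfolding mult_entry[OF ij]
    by (intro A.finsum_cong' refl) (auto simp: one_entry)
  also have "\<dots> = M (i, j)" using assms ij by (simp add: A.finsum_delta)
  finally show "(M \<otimes>\<^bsub>MM\<^esub> \<one>\<^bsub>MM\<^esub>) (i, j) = M (i, j)" .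
qed (use assms in \<open>simp_all add: MM_mult_closed MM_closed\<close>)

lemma MM_distr:
  assumes "M \<in> carrier MM" "N \<in> carrier MM" "P \<in> carrier MM"
  shows "(M \<oplus>\<^bsub>MM\<^esub> N) \<otimes>\<^bsub>MM\<^esub> P = M \<otimes>\<^bsub>MM\<^esub> P \<oplus>\<^bsub>MM\<^esub> N \<otimes>\<^bsub>MM\<^esub> P"
    and "P \<otimes>\<^bsub>MM\<^esub> (M \<oplus>\<^bsub>MM\<^esub> N) = P \<otimes>\<^bsub>MM\<^esub> M \<oplus>\<^bsub>MM\<^esub> P \<otimes>\<^bsub>MM\<^esub> N"
proof -
  show "(M \<oplus>\<^bsub>MM\<^esub> N) \<otimes>\<^bsub>MM\<^esub> P = M \<otimes>\<^bsub>MM\<^esub> P \<oplus>\<^bsub>MM\<^esub> N \<otimes>\<^bsub>MM\<^esub> P"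
  proof (rule matrix_eqI)
    fix i j assume ij: "i < r" "j < r"
    have "((M \<oplus>\<^bsub>MM\<^esub> N) \<otimes>\<^bsub>MM\<^esub> P) (i, j) = (\<Oplus>\<^bsub>A\<^esub>l\<in>{..<r}. M (i, l) \<cdot> P (l, j) \<oplus>\<^bsub>A\<^esub> N (i, l) \<cdot> P (l, j))"
      using assms ij unfolding mult_entry[OF ij]
      by (intro A.finsum_cong' refl) (auto simp: add_entry A.l_distr)
    then show "((M \<oplus>\<^bsub>MM\<^esub> N) \<otimes>\<^bsub>MM\<^esub> P) (i, j) = (M \<otimes>\<^bsub>MM\<^esub> P \<oplus>\<^bsub>MM\<^esub> N \<otimes>\<^bsub>MM\<^esub> P) (i, j)"
      using assms ij by (simp add: A.finsum_addf add_entry mult_entry)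
  qed (use assms in \<open>simp_all add: MM_mult_closed MM_closed\<close>)
  show "P \<otimes>\<^bsub>MM\<^esub> (M \<oplus>\<^bsub>MM\<^esub> N) = P \<otimes>\<^bsub>MM\<^esub> M \<oplus>\<^bsub>MM\<^esub> P \<otimes>\<^bsub>MM\<^esub> N"
  proof (rule matrix_eqI)
    fix i j assume ij: "i < r" "j < r"
    have "(P \<otimes>\<^bsub>MM\<^esub> (M \<oplus>\<^bsub>MM\<^esub> N)) (i, j) = (\<Oplus>\<^bsub>A\<^esub>l\<in>{..<r}. P (i, l) \<cdot> M (l, j) \<oplus>\<^bsub>A\<^esub> P (i, l) \<cdot> N (l, j))"
      using assms ij unfolding mult_entry[OF ij]
      by (intro A.finsum_cong' refl) (auto simp: add_entry A.r_distr)
    then show "(P \<otimes>\<^bsub>MM\<^esub> (M \<oplus>\<^bsub>MM\<^esub> N)) (i, j) = (P \<otimes>\<^bsub>MM\<^esub> M \<oplus>\<^bsub>MM\<^esub> P \<otimes>\<^bsub>MM\<^esub> N) (i, j)"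
      using assms ij by (simp add: A.finsum_addf add_entry mult_entry)
  qed (use assms in \<open>simp_all add: MM_mult_closed MM_closed\<close>)
qed

lemma MM_smult:
  assumes "c \<in> carrier R" "M \<in> carrier MM" "N \<in> carrier MM"
  shows "(c \<odot>\<^bsub>MM\<^esub> M) \<otimes>\<^bsub>MM\<^esub> N = c \<odot>\<^bsub>MM\<^esub> (M \<otimes>\<^bsub>MM\<^esub> N)"
    and "M \<otimes>\<^bsub>MM\<^esub> (c \<odot>\<^bsub>MM\<^esub> N) = c \<odot>\<^bsub>MM\<^esub> (M \<otimes>\<^bsub>MM\<^esub> N)"
proof -
  have s: "(c \<odot>\<^bsub>MM\<^esub> (M \<otimes>\<^bsub>MM\<^esub> N)) (i, j) = (\<Oplus>\<^bsub>A\<^esub>l\<in>{..<r}. c \<odot>\<^bsub>A\<^esub> (M (i, l) \<cdot> N (l, j)))"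
    if "i < r" "j < r" for i j
    using assms that by (simp add: smult_entry mult_entry M.finsum_smult_ldistr)
  show "(c \<odot>\<^bsub>MM\<^esub> M) \<otimes>\<^bsub>MM\<^esub> N = c \<odot>\<^bsub>MM\<^esub> (M \<otimes>\<^bsub>MM\<^esub> N)"
  proof (rule matrix_eqI)
    fix i j assume ij: "i < r" "j < r"
    show "((c \<odot>\<^bsub>MM\<^esub> M) \<otimes>\<^bsub>MM\<^esub> N) (i, j) = (c \<odot>\<^bsub>MM\<^esub> (M \<otimes>\<^bsub>MM\<^esub> N)) (i, j)"
      using assms ij unfolding mult_entry[OF ij] s[OF ij]
      by (intro A.finsum_cong' refl) (auto simp: smult_entry smult_mult_left)
  qed (use assms in \<open>simp_all add: MM_mult_closed MM_closed\<close>)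
  show "M \<otimes>\<^bsub>MM\<^esub> (c \<odot>\<^bsub>MM\<^esub> N) = c \<odot>\<^bsub>MM\<^esub> (M \<otimes>\<^bsub>MM\<^esub> N)"
  proof (rule matrix_eqI)
    fix i j assume ij: "i < r" "j < r"
    show "(M \<otimes>\<^bsub>MM\<^esub> (c \<odot>\<^bsub>MM\<^esub> N)) (i, j) = (c \<odot>\<^bsub>MM\<^esub> (M \<otimes>\<^bsub>MM\<^esub> N)) (i, j)"
      using assms ij unfolding mult_entry[OF ij] s[OF ij]
      by (intro A.finsum_cong' refl) (auto simp: smult_entry smult_mult_right)
  qed (use assms in \<open>simp_all add: MM_mult_closed MM_closed\<close>)
qed

lemma MM_abelian_group: "abelian_group MM"
proof (rule abelian_groupI)
  fix M assume M: "M \<in> carrier MM"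
  let ?N = "\<lambda>p\<in>{..<r} \<times> {..<r}. \<ominus>\<^bsub>A\<^esub> M p"
  have N: "?N \<in> carrier MM" using M by (intro matrixI) auto
  have "?N \<oplus>\<^bsub>MM\<^esub> M = \<zero>\<^bsub>MM\<^esub>"
    using M N by (intro matrix_eqI MM_closed) (auto simp: add_entry zero_entry A.l_neg)
  with N show "\<exists>N\<in>carrier MM. N \<oplus>\<^bsub>MM\<^esub> M = \<zero>\<^bsub>MM\<^esub>" by blast
qed (auto intro!: matrix_eqI simp: MM_closed, auto simp: MM_closed add_entry zero_entry A.a_ac)

lemma alg_MM: "alg R MM"
proof -
  have "ring MM"
    by (intro ringI MM_abelian_group monoidI)
       (simp_all add: MM_mult_closed MM_closed MM_assoc MM_one_left MM_one_right MM_distr)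
  moreover have "module R MM"
    by (rule moduleI[OF M.R.cring_axioms MM_abelian_group])
      (auto intro!: matrix_eqI simp: MM_closed,
       auto simp: MM_closed add_entry smult_entry M.smult_l_distr M.smult_r_distr M.smult_assoc1)
  ultimately show ?thesis
    by (simp add: alg_def alg_axioms_def MM_smult)
qed

end

sublocale matrices \<subseteq> B: alg R "matrix_algebra A r"
  by (rule alg_MM)

context matrices begin

lemma ev_MM_linear: "i < r \<Longrightarrow> j < r \<Longrightarrow> linear_map R MM A (\<lambda>M. M (i, j))"
  by (rule linear_mapI) (auto simp: add_entry smult_entry B.M.module_axioms M.module_axioms)

lemmas diff_entry = linear_map.diff[OF ev_MM_linear]
lemmas finsum_entry = linear_map.finsum[OF ev_MM_linear]

section \<open>Elementary matrices\<close>

definition el where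
  "el i j a = (\<lambda>(k, l)\<in>{..<r} \<times> {..<r}. if k = i \<and> l = j then a else \<zero>\<^bsub>A\<^esub>)"

lemma el_closed [simp]: "a \<in> carrier A \<Longrightarrow> el i j a \<in> carrier MM"
  by (auto simp: el_def carrier_MM)

lemma el_entry: "k < r \<Longrightarrow> l < r \<Longrightarrow> el i j a (k, l) = (if k = i \<and> l = j then a else \<zero>\<^bsub>A\<^esub>)"
  by (simp add: el_def)

lemma el_mult_left:
  assumes "k < r" "l < r" "j < r" "a \<in> carrier A" "N \<in> carrier MM"
  shows "(el i j a \<otimes>\<^bsub>MM\<^esub> N) (k, l) = (if k = i then a \<cdot> N (j, l) else \<zero>\<^bsub>A\<^esub>)"
proof -
  have "(el i j a \<otimes>\<^bsub>MM\<^esub> N) (k, l) =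
      (\<Oplus>\<^bsub>A\<^esub>m\<in>{..<r}. if m = j then (if k = i then a \<cdot> N (m, l) else \<zero>\<^bsub>A\<^esub>) else \<zero>\<^bsub>A\<^esub>)"
    unfolding mult_entry[OF assms(1,2)]
    using assms by (intro A.finsum_cong' refl) (auto simp: el_entry)
  also have "\<dots> = (if k = i then a \<cdot> N (j, l) else \<zero>\<^bsub>A\<^esub>)"
    using assms by (intro A.finsum_delta) auto
  finally show ?thesis .
qed

lemma el_mult_right:
  assumes "k < r" "l < r" "i < r" "a \<in> carrier A" "N \<in> carrier MM"
  shows "(N \<otimes>\<^bsub>MM\<^esub> el i j a) (k, l) = (if l = j then N (k, i) \<cdot> a else \<zero>\<^bsub>A\<^esub>)"
proof -
  have "(N \<otimes>\<^bsub>MM\<^esub> el i j a) (k, l) =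
      (\<Oplus>\<^bsub>A\<^esub>m\<in>{..<r}. if m = i then (if l = j then N (k, m) \<cdot> a else \<zero>\<^bsub>A\<^esub>) else \<zero>\<^bsub>A\<^esub>)"
    unfolding mult_entry[OF assms(1,2)]
    using assms by (intro A.finsum_cong' refl) (auto simp: el_entry)
  also have "\<dots> = (if l = j then N (k, i) \<cdot> a else \<zero>\<^bsub>A\<^esub>)"
    using assms by (intro A.finsum_delta) auto
  finally show ?thesis .
qed

lemma el_el:
  assumes "i < r" "j < r" "k < r" "a \<in> carrier A" "b \<in> carrier A"
  shows "el i j a \<otimes>\<^bsub>MM\<^esub> el k l b = (if j = k then el i l (a \<cdot> b) else \<zero>\<^bsub>MM\<^esub>)"
  using assms by (intro matrix_eqI) (auto simp: el_mult_left el_entry zero_entry)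

lemma el_add: "a \<in> carrier A \<Longrightarrow> b \<in> carrier A \<Longrightarrow> el i j (a \<oplus>\<^bsub>A\<^esub> b) = el i j a \<oplus>\<^bsub>MM\<^esub> el i j b"
  by (intro matrix_eqI) (auto simp: el_entry add_entry)

lemma el_smult: "c \<in> carrier R \<Longrightarrow> a \<in> carrier A \<Longrightarrow> el i j (c \<odot>\<^bsub>A\<^esub> a) = c \<odot>\<^bsub>MM\<^esub> el i j a"
  by (intro matrix_eqI) (auto simp: el_entry smult_entry)

abbreviation inc where "inc \<equiv> el 0 0"
abbreviation u where "u j \<equiv> el j 0 \<one>\<^bsub>A\<^esub>"
abbreviation v where "v j \<equiv> el 0 j \<one>\<^bsub>A\<^esub>"

lemma inc_linear: "linear_map R A MM inc"
  by (rule linear_mapI) (simp_all add: el_add el_smult M.module_axioms B.M.module_axioms)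

lemma inc_mult: "a \<in> carrier A \<Longrightarrow> b \<in> carrier A \<Longrightarrow> inc (a \<cdot> b) = inc a \<otimes>\<^bsub>MM\<^esub> inc b"
  using r_pos by (simp add: el_el)

lemma unit_sum: "(\<Oplus>\<^bsub>MM\<^esub>j\<in>{..<r}. u j \<otimes>\<^bsub>MM\<^esub> v j) = \<one>\<^bsub>MM\<^esub>"
proof (rule matrix_eqI)
  fix k l assume kl: "k < r" "l < r"
  have "(\<Oplus>\<^bsub>MM\<^esub>j\<in>{..<r}. u j \<otimes>\<^bsub>MM\<^esub> v j) (k, l) = (\<Oplus>\<^bsub>A\<^esub>j\<in>{..<r}. (u j \<otimes>\<^bsub>MM\<^esub> v j) (k, l))"
    using kl by (intro finsum_entry) auto
  also have "\<dots> = (\<Oplus>\<^bsub>A\<^esub>j\<in>{..<r}. if j = k then (if k = l then \<one>\<^bsub>A\<^esub> else \<zero>\<^bsub>A\<^esub>) else \<zero>\<^bsub>A\<^esub>)"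
    using kl r_pos by (intro A.finsum_cong' refl) (auto simp: el_el el_entry)
  also have "\<dots> = \<one>\<^bsub>MM\<^esub> (k, l)" using kl by (subst A.finsum_delta) (auto simp: one_entry)
  finally show "(\<Oplus>\<^bsub>MM\<^esub>j\<in>{..<r}. u j \<otimes>\<^bsub>MM\<^esub> v j) (k, l) = \<one>\<^bsub>MM\<^esub> (k, l)" .
qed (auto intro!: B.A.finsum_closed)

lemma corner_entry:
  assumes "j < r" "k < r" "M \<in> carrier MM"
  shows "v j \<otimes>\<^bsub>MM\<^esub> M \<otimes>\<^bsub>MM\<^esub> u k = inc (M (j, k))"
  using assms r_pos by (intro matrix_eqI) (auto simp: el_mult_left el_mult_right el_entry)

lemma inc_inj: "inj_on inc (carrier A)"
proof (rule inj_onI)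
  fix a b assume "inc a = inc b"
  then have "inc a (0, 0) = inc b (0, 0)" by simp
  then show "a = b" using r_pos by (simp add: el_entry)
qed

section \<open>The trace\<close>

definition tr where "tr M = (\<Oplus>\<^bsub>A\<^esub>i\<in>{..<r}. M (i, i))"

lemma tr_closed: "M \<in> carrier MM \<Longrightarrow> tr M \<in> carrier A"
  unfolding tr_def by (rule A.finsum_closed) auto

lemma tr_add: "M \<in> carrier MM \<Longrightarrow> N \<in> carrier MM \<Longrightarrow> tr (M \<oplus>\<^bsub>MM\<^esub> N) = tr M \<oplus>\<^bsub>A\<^esub> tr N"
  unfolding tr_def
  by (subst A.finsum_addf[symmetric], simp, simp, intro A.finsum_cong' refl) (simp_all add: add_entry Pi_iff)

lemma tr_inc: "a \<in> carrier A \<Longrightarrow> tr (inc a) = a"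
proof -
  assume a: "a \<in> carrier A"
  have "tr (inc a) = (\<Oplus>\<^bsub>A\<^esub>i\<in>{..<r}. if i = 0 then a else \<zero>\<^bsub>A\<^esub>)"
    unfolding tr_def using a by (intro A.finsum_cong' refl) (auto simp: el_entry)
  also have "\<dots> = a" using a r_pos by (intro A.finsum_delta) auto
  finally show ?thesis .
qed

lemma tr_neg: "M \<in> carrier MM \<Longrightarrow> tr (\<ominus>\<^bsub>MM\<^esub> M) = \<ominus>\<^bsub>A\<^esub> tr M"
proof -
  assume M: "M \<in> carrier MM"
  have "tr \<zero>\<^bsub>MM\<^esub> = \<zero>\<^bsub>A\<^esub>"
    using tr_add[of "\<zero>\<^bsub>MM\<^esub>" "\<zero>\<^bsub>MM\<^esub>"] tr_closed[of "\<zero>\<^bsub>MM\<^esub>"] by (simp add: A.add.l_cancel_one)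
  then show ?thesis
    using tr_add[of "\<ominus>\<^bsub>MM\<^esub> M" M] M tr_closed by (intro A.minus_equality[symmetric]) (auto simp: B.A.l_neg)
qed

lemma tr_commute:
  assumes "M \<in> carrier MM" "N \<in> carrier MM"
  shows "H0.cls (tr (M \<otimes>\<^bsub>MM\<^esub> N)) = H0.cls (tr (N \<otimes>\<^bsub>MM\<^esub> M))"
proof -
  have e: "H0.cls (tr (M \<otimes>\<^bsub>MM\<^esub> N)) = (\<Oplus>\<^bsub>H0.Q\<^esub>i\<in>{..<r}. \<Oplus>\<^bsub>H0.Q\<^esub>l\<in>{..<r}. H0.cls (M (i, l) \<cdot> N (l, i)))"
    if MN: "M \<in> carrier MM" "N \<in> carrier MM" for M N
  proof -
    have c: "(\<Oplus>\<^bsub>A\<^esub>l\<in>{..<r}. M (i, l) \<cdot> N (l, i)) \<in> carrier A" if "i < r" for i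
      using MN that by (intro A.finsum_closed) auto
    have "H0.cls (tr (M \<otimes>\<^bsub>MM\<^esub> N)) = H0.cls (\<Oplus>\<^bsub>A\<^esub>i\<in>{..<r}. \<Oplus>\<^bsub>A\<^esub>l\<in>{..<r}. M (i, l) \<cdot> N (l, i))"
      unfolding tr_def using MN c by (intro arg_cong[of _ _ H0.cls] A.finsum_cong' refl) (simp_all add: mult_entry Pi_iff)
    also have "\<dots> = (\<Oplus>\<^bsub>H0.Q\<^esub>i\<in>{..<r}. H0.cls (\<Oplus>\<^bsub>A\<^esub>l\<in>{..<r}. M (i, l) \<cdot> N (l, i)))"
      using c by (intro H0.proj.finsum) auto
    also have "\<dots> = (\<Oplus>\<^bsub>H0.Q\<^esub>i\<in>{..<r}. \<Oplus>\<^bsub>H0.Q\<^esub>l\<in>{..<r}. H0.cls (M (i, l) \<cdot> N (l, i)))"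
      using MN by (intro H0.proj.N.M.finsum_cong' refl)
        (simp_all add: H0.proj.finsum Pi_iff H0.proj.N.M.finsum_closed)
    finally show ?thesis .
  qed
  have q: "H0.cls (M (i, l) \<cdot> N (l, i)) = H0.cls (N (l, i) \<cdot> M (i, l))" if "i < r" "l < r" for i l
    using that assms by (simp add: H0.cls_eq_iff B0_commutator)
  have "(\<Oplus>\<^bsub>H0.Q\<^esub>i\<in>{..<r}. \<Oplus>\<^bsub>H0.Q\<^esub>l\<in>{..<r}. H0.cls (M (i, l) \<cdot> N (l, i))) =
      (\<Oplus>\<^bsub>H0.Q\<^esub>i\<in>{..<r}. \<Oplus>\<^bsub>H0.Q\<^esub>l\<in>{..<r}. H0.cls (N (l, i) \<cdot> M (i, l)))"
    using assms by (intro H0.proj.N.M.finsum_cong' refl) (simp_all add: q Pi_iff H0.proj.N.M.finsum_closed)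
  also have "\<dots> = (\<Oplus>\<^bsub>H0.Q\<^esub>l\<in>{..<r}. \<Oplus>\<^bsub>H0.Q\<^esub>i\<in>{..<r}. H0.cls (N (l, i) \<cdot> M (i, l)))"
    using assms by (intro H0.proj.N.M.finsum_swap) auto
  finally show ?thesis using assms by (simp only: e)
qed

text \<open>The trace of a commutator is a sum of commutators, and the trace is a left inverse of \<open>inc\<close>.\<close>

lemma inc_reflects:
  assumes a: "a \<in> carrier A" "inc a \<in> B0 R MM"
  shows "a \<in> B0 R A"
proof -
  obtain w where w: "w \<in> carrier B.C" "inc a = boundary1 MM w" using a(2) by (auto simp: B0_def)
  from w(1) have "tr (boundary1 MM w) \<in> B0 R A"
  proof (induction rule: B.C_induct)
    case (pure M N)
    then show ?case
      using tr_commute[of M N] tr_closed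
      by (simp add: B.b1_t a_minus_def[of MM] tr_add tr_neg H0.cls_eq_iff)
        (simp add: a_minus_def)
  next
    case (add x y)
    then show ?case by (simp add: B.b1.add tr_add B0_add)
  qed
  from this[folded w(2)] show ?thesis using a by (simp add: tr_inc)
qed

section \<open>Derivations of matrix algebras\<close>

definition ext where
  "ext X = (\<lambda>M\<in>carrier MM. \<lambda>p\<in>{..<r} \<times> {..<r}. X (M p))"

lemma ext_entry: "M \<in> carrier MM \<Longrightarrow> i < r \<Longrightarrow> j < r \<Longrightarrow> ext X M (i, j) = X (M (i, j))"
  by (simp add: ext_def)

lemma ext_apply_closed: "X \<in> carrier D \<Longrightarrow> M \<in> carrier MM \<Longrightarrow> ext X M \<in> carrier MM"
  unfolding ext_def by (simp add: matrixI)

lemma ext_closed: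
  assumes X: "X \<in> carrier D"
  shows "ext X \<in> carrier B.D"
proof -
  let ?f = "\<lambda>M. \<lambda>p\<in>{..<r} \<times> {..<r}. X (M p)"
  have c: "?f M \<in> carrier MM" if "M \<in> carrier MM" for M using X that by (simp add: matrixI)
  show ?thesis
    unfolding ext_def
  proof (rule B.DerI[OF c])
    fix M N assume MN: "M \<in> carrier MM" "N \<in> carrier MM"
    show "?f (M \<oplus>\<^bsub>MM\<^esub> N) = ?f M \<oplus>\<^bsub>MM\<^esub> ?f N"
      using MN X c by (intro matrix_eqI) (auto simp: MM_closed add_entry D_map_add)
    show "?f (M \<otimes>\<^bsub>MM\<^esub> N) = ?f M \<otimes>\<^bsub>MM\<^esub> N \<oplus>\<^bsub>MM\<^esub> M \<otimes>\<^bsub>MM\<^esub> ?f N"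
    proof (rule matrix_eqI)
      fix i j assume ij: "i < r" "j < r"
      have "X (\<Oplus>\<^bsub>A\<^esub>l\<in>{..<r}. M (i, l) \<cdot> N (l, j)) = (\<Oplus>\<^bsub>A\<^esub>l\<in>{..<r}. X (M (i, l) \<cdot> N (l, j)))"
        using MN ij by (intro linear_map.finsum[OF D_linear[OF X]]) auto
      also have "\<dots> = (\<Oplus>\<^bsub>A\<^esub>l\<in>{..<r}. X (M (i, l)) \<cdot> N (l, j) \<oplus>\<^bsub>A\<^esub> M (i, l) \<cdot> X (N (l, j)))"
        using MN ij X by (intro A.finsum_cong' refl) (simp_all add: D_mult Pi_iff)
      also have "\<dots> = (\<Oplus>\<^bsub>A\<^esub>l\<in>{..<r}. X (M (i, l)) \<cdot> N (l, j)) \<oplus>\<^bsub>A\<^esub> (\<Oplus>\<^bsub>A\<^esub>l\<in>{..<r}. M (i, l) \<cdot> X (N (l, j)))"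
        using MN ij X by (intro A.finsum_addf) auto
      also have "(\<Oplus>\<^bsub>A\<^esub>l\<in>{..<r}. X (M (i, l)) \<cdot> N (l, j)) = (?f M \<otimes>\<^bsub>MM\<^esub> N) (i, j)"
        unfolding mult_entry[OF ij] using MN ij X by (intro A.finsum_cong' refl) (auto simp: Pi_iff)
      also have "(\<Oplus>\<^bsub>A\<^esub>l\<in>{..<r}. M (i, l) \<cdot> X (N (l, j))) = (M \<otimes>\<^bsub>MM\<^esub> ?f N) (i, j)"
        unfolding mult_entry[OF ij] using MN ij X by (intro A.finsum_cong' refl) (auto simp: Pi_iff)
      finally show "?f (M \<otimes>\<^bsub>MM\<^esub> N) (i, j) = (?f M \<otimes>\<^bsub>MM\<^esub> N \<oplus>\<^bsub>MM\<^esub> M \<otimes>\<^bsub>MM\<^esub> ?f N) (i, j)"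
        using ij by (simp add: add_entry mult_entry)
    qed (use c MN in \<open>simp_all add: MM_mult_closed MM_closed\<close>)
  next
    fix a M assume M: "a \<in> carrier R" "M \<in> carrier MM"
    then show "?f (a \<odot>\<^bsub>MM\<^esub> M) = a \<odot>\<^bsub>MM\<^esub> ?f M"
      using X c by (intro matrix_eqI) (auto simp: MM_closed smult_entry D_map_smult)
  qed
qed

lemma ext_linear: "linear_map R D B.D ext"
proof (rule linear_mapI[OF D.module_axioms B.D.module_axioms ext_closed])
  fix X Y assume XY: "X \<in> carrier D" "Y \<in> carrier D"
  show "ext (X \<oplus>\<^bsub>D\<^esub> Y) = ext X \<oplus>\<^bsub>B.D\<^esub> ext Y"
  proof (rule B.D_eqI)
    fix M assume M: "M \<in> carrier MM"
    show "ext (X \<oplus>\<^bsub>D\<^esub> Y) M = (ext X \<oplus>\<^bsub>B.D\<^esub> ext Y) M"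
      using XY M by (intro matrix_eqI)
        (simp_all add: ext_apply_closed D_add_closed B.D_add MM_closed ext_entry add_entry, simp add: D_add)
  qed (use XY in \<open>simp_all add: ext_closed D_add_closed B.D_add_closed\<close>)
next
  fix c X assume X: "c \<in> carrier R" "X \<in> carrier D"
  show "ext (c \<odot>\<^bsub>D\<^esub> X) = c \<odot>\<^bsub>B.D\<^esub> ext X"
  proof (rule B.D_eqI)
    fix M assume M: "M \<in> carrier MM"
    show "ext (c \<odot>\<^bsub>D\<^esub> X) M = (c \<odot>\<^bsub>B.D\<^esub> ext X) M"
      using X M by (intro matrix_eqI)
        (simp_all add: ext_apply_closed D_smult_closed B.D_smult MM_closed ext_entry smult_entry, simp add: D_smult)
  qed (use X in \<open>simp_all add: ext_closed D_smult_closed B.D_smult_closed\<close>)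
qed

lemma ext_inc: "X \<in> carrier D \<Longrightarrow> a \<in> carrier A \<Longrightarrow> ext X (inc a) = inc (X a)"
  by (intro matrix_eqI) (auto simp: ext_apply_closed ext_entry el_entry linear_map.zero[OF D_linear])

lemma ext_comm:
  assumes XY: "X \<in> carrier D" "Y \<in> carrier D"
  shows "ext (der_commutator A X Y) = der_commutator MM (ext X) (ext Y)"
proof (rule B.D_eqI)
  fix M assume M: "M \<in> carrier MM"
  show "ext (der_commutator A X Y) M = der_commutator MM (ext X) (ext Y) M"
    using XY M by (intro matrix_eqI)
      (simp_all add: ext_apply_closed comm_closed B.comm_apply ext_entry diff_entry comm_apply)
qed (use XY in \<open>simp_all add: ext_closed comm_closed B.comm_closed\<close>)

text \<open>Scalar matrices: the entrywise commutator with \<open>a\<close> is the commutator with \<open>scal a\<close>.\<close>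

definition scal where
  "scal a = (\<lambda>(k, l)\<in>{..<r} \<times> {..<r}. if k = l then a else \<zero>\<^bsub>A\<^esub>)"

lemma scal_closed: "a \<in> carrier A \<Longrightarrow> scal a \<in> carrier MM"
  by (auto simp: scal_def carrier_MM)

lemma scal_mult:
  assumes "k < r" "l < r" "a \<in> carrier A" "N \<in> carrier MM"
  shows "(scal a \<otimes>\<^bsub>MM\<^esub> N) (k, l) = a \<cdot> N (k, l)" "(N \<otimes>\<^bsub>MM\<^esub> scal a) (k, l) = N (k, l) \<cdot> a"
proof -
  have "(scal a \<otimes>\<^bsub>MM\<^esub> N) (k, l) = (\<Oplus>\<^bsub>A\<^esub>m\<in>{..<r}. if m = k then a \<cdot> N (m, l) else \<zero>\<^bsub>A\<^esub>)"
    unfolding mult_entry[OF assms(1,2)]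
    using assms by (intro A.finsum_cong' refl) (auto simp: scal_def)
  then show "(scal a \<otimes>\<^bsub>MM\<^esub> N) (k, l) = a \<cdot> N (k, l)" using assms by (simp add: A.finsum_delta)
  have "(N \<otimes>\<^bsub>MM\<^esub> scal a) (k, l) = (\<Oplus>\<^bsub>A\<^esub>m\<in>{..<r}. if m = l then N (k, m) \<cdot> a else \<zero>\<^bsub>A\<^esub>)"
    unfolding mult_entry[OF assms(1,2)]
    using assms by (intro A.finsum_cong' refl) (auto simp: scal_def)
  then show "(N \<otimes>\<^bsub>MM\<^esub> scal a) (k, l) = N (k, l) \<cdot> a" using assms by (simp add: A.finsum_delta)
qed

lemma ext_Inn:
  assumes "X \<in> Inn A"
  shows "ext X \<in> Inn MM"
proof -
  obtain a where a: "a \<in> carrier A" "X = inner_derivation A a" using assms by (rule InnE)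
  have "ext X = inner_derivation MM (scal a)"
  proof (rule B.D_eqI)
    fix M assume M: "M \<in> carrier MM"
    show "ext X M = inner_derivation MM (scal a) M"
      using a M by (intro matrix_eqI)
        (simp_all add: ext_apply_closed inner_closed scal_closed B.inner_apply ext_entry diff_entry inner_apply scal_mult)
  qed (use a in \<open>simp_all add: ext_closed inner_closed B.inner_closed scal_closed\<close>)
  then show ?thesis using a by (simp add: Inn_def scal_closed)
qed

text \<open>The inner derivation by the sum of the elements \<open>Y(u\<^sub>j) v\<^sub>j\<close> agrees with \<open>Y\<close> on matrix units. The difference
  \<open>Y'\<close> kills the matrix units, hence commutes with taking the entries \<open>v\<^sub>k M u\<^sub>l\<close>; so it acts
  on all entries by the derivation that it induces on the corner.\<close>

lemma ext_surj:
  assumes Y: "Y \<in> carrier B.D"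
  shows "\<exists>X\<in>carrier D. Y \<ominus>\<^bsub>B.D\<^esub> ext X \<in> Inn MM"
proof -
  have [simp]: "Y M \<in> carrier MM" if "M \<in> carrier MM" for M using Y that by simp
  define w where "w = (\<Oplus>\<^bsub>MM\<^esub>j\<in>{..<r}. Y (u j) \<otimes>\<^bsub>MM\<^esub> v j)"
  have w: "w \<in> carrier MM" unfolding w_def by (rule B.A.finsum_closed) auto
  have right: "w \<otimes>\<^bsub>MM\<^esub> el k l \<one>\<^bsub>A\<^esub> = Y (u k) \<otimes>\<^bsub>MM\<^esub> v l" if kl: "k < r" "l < r" for k l
  proof -
    have "w \<otimes>\<^bsub>MM\<^esub> el k l \<one>\<^bsub>A\<^esub> = (\<Oplus>\<^bsub>MM\<^esub>j\<in>{..<r}. Y (u j) \<otimes>\<^bsub>MM\<^esub> v j \<otimes>\<^bsub>MM\<^esub> el k l \<one>\<^bsub>A\<^esub>)"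
      unfolding w_def by (rule linear_map.finsum[OF B.linear_rmult]) auto
    also have "\<dots> = (\<Oplus>\<^bsub>MM\<^esub>j\<in>{..<r}. if j = k then Y (u j) \<otimes>\<^bsub>MM\<^esub> v l else \<zero>\<^bsub>MM\<^esub>)"
      using kl r_pos by (intro B.A.finsum_cong' refl) (auto simp: B.A.m_assoc el_el)
    also have "\<dots> = Y (u k) \<otimes>\<^bsub>MM\<^esub> v l" using kl by (intro B.A.finsum_delta) auto
    finally show ?thesis .
  qed
  \<comment> \<open>Left multiplication by a matrix unit is moved inside \<open>Y\<close> with the Leibniz rule.\<close>
  have left: "el k l \<one>\<^bsub>A\<^esub> \<otimes>\<^bsub>MM\<^esub> w \<oplus>\<^bsub>MM\<^esub> Y (el k l \<one>\<^bsub>A\<^esub>) = Y (u k) \<otimes>\<^bsub>MM\<^esub> v l"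
    if kl: "k < r" "l < r" for k l
  proof -
    let ?e = "el k l \<one>\<^bsub>A\<^esub>"
    have "?e \<otimes>\<^bsub>MM\<^esub> w = (\<Oplus>\<^bsub>MM\<^esub>j\<in>{..<r}. ?e \<otimes>\<^bsub>MM\<^esub> (Y (u j) \<otimes>\<^bsub>MM\<^esub> v j))"
      unfolding w_def by (rule linear_map.finsum[OF B.linear_lmult]) auto
    moreover have "Y ?e = (\<Oplus>\<^bsub>MM\<^esub>j\<in>{..<r}. Y ?e \<otimes>\<^bsub>MM\<^esub> (u j \<otimes>\<^bsub>MM\<^esub> v j))"
    proof -
      have "Y ?e \<otimes>\<^bsub>MM\<^esub> (\<Oplus>\<^bsub>MM\<^esub>j\<in>{..<r}. u j \<otimes>\<^bsub>MM\<^esub> v j) =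
          (\<Oplus>\<^bsub>MM\<^esub>j\<in>{..<r}. Y ?e \<otimes>\<^bsub>MM\<^esub> (u j \<otimes>\<^bsub>MM\<^esub> v j))"
        by (rule linear_map.finsum[OF B.linear_lmult]) auto
      then show ?thesis by (simp add: unit_sum)
    qed
    ultimately have "?e \<otimes>\<^bsub>MM\<^esub> w \<oplus>\<^bsub>MM\<^esub> Y ?e =
       (\<Oplus>\<^bsub>MM\<^esub>j\<in>{..<r}. ?e \<otimes>\<^bsub>MM\<^esub> (Y (u j) \<otimes>\<^bsub>MM\<^esub> v j) \<oplus>\<^bsub>MM\<^esub> Y ?e \<otimes>\<^bsub>MM\<^esub> (u j \<otimes>\<^bsub>MM\<^esub> v j))"
      by (subst B.A.finsum_addf) auto
    also have "\<dots> = (\<Oplus>\<^bsub>MM\<^esub>j\<in>{..<r}. Y (?e \<otimes>\<^bsub>MM\<^esub> u j) \<otimes>\<^bsub>MM\<^esub> v j)"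
      using Y by (intro B.A.finsum_cong' refl) (simp_all add: B.D_mult B.A.l_distr B.A.m_assoc B.A.a_comm Pi_iff)
    also have "\<dots> = (\<Oplus>\<^bsub>MM\<^esub>j\<in>{..<r}. if j = l then Y (u k) \<otimes>\<^bsub>MM\<^esub> v j else \<zero>\<^bsub>MM\<^esub>)"
      using kl r_pos Y
      by (intro B.A.finsum_cong' refl) (auto simp: el_el linear_map.zero[OF B.D_linear])
    also have "\<dots> = Y (u k) \<otimes>\<^bsub>MM\<^esub> v l" using kl by (intro B.A.finsum_delta) auto
    finally show ?thesis .
  qed
  have D_diff: "(X \<ominus>\<^bsub>B.D\<^esub> Z) M = X M \<ominus>\<^bsub>MM\<^esub> Z M"
    if "X \<in> carrier B.D" "Z \<in> carrier B.D" "M \<in> carrier MM" for X Z M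
    using that by (simp add: a_minus_def B.D_add B.D_neg)
  let ?ad = "inner_derivation MM w"
  define Y' where "Y' = Y \<ominus>\<^bsub>B.D\<^esub> ?ad"
  have Y': "Y' \<in> carrier B.D" using Y w by (simp add: Y'_def B.inner_closed)
  have kills: "Y' (el k l \<one>\<^bsub>A\<^esub>) = \<zero>\<^bsub>MM\<^esub>" if kl: "k < r" "l < r" for k l
  proof -
    have "y \<ominus>\<^bsub>MM\<^esub> (p \<ominus>\<^bsub>MM\<^esub> q) = \<zero>\<^bsub>MM\<^esub>" if "q \<oplus>\<^bsub>MM\<^esub> y = p" "q \<in> carrier MM" "y \<in> carrier MM" for y p q
      unfolding that(1)[symmetric] using that(2,3) by algebra
    from this[OF left[OF kl]] show ?thesis
      using Y w kl by (simp add: Y'_def D_diff B.inner_closed B.inner_apply right)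
  qed
  define X where "X = (\<lambda>a\<in>carrier A. Y' (inc a) (0, 0))"
  have lin: "linear_map R A A (\<lambda>a. Y' (inc a) (0, 0))"
    by (rule linear_map_comp[OF linear_map_comp[OF inc_linear B.D_linear[OF Y']] ev_MM_linear[OF r_pos r_pos]])
  have X: "X \<in> carrier D"
    unfolding X_def
    by (rule DerI)
      (use Y' r_pos in \<open>simp_all add: linear_map.closed[OF lin] linear_map.add[OF lin] linear_map.smult[OF lin]
         inc_mult B.D_mult add_entry el_mult_left el_mult_right\<close>)
  have "Y' = ext X"
  proof (rule B.D_eqI[OF Y' ext_closed[OF X]])
    fix M assume M: "M \<in> carrier MM"
    show "Y' M = ext X M"
    proof (rule matrix_eqI)
      fix k l assume kl: "k < r" "l < r"
      have "Y' (v k \<otimes>\<^bsub>MM\<^esub> M \<otimes>\<^bsub>MM\<^esub> u l) = v k \<otimes>\<^bsub>MM\<^esub> Y' M \<otimes>\<^bsub>MM\<^esub> u l"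
        using Y' M kl r_pos by (simp add: B.D_mult kills)
      then have "Y' (inc (M (k, l))) = inc (Y' M (k, l))"
        using corner_entry[OF kl] M Y' by simp
      then have "Y' (inc (M (k, l))) (0, 0) = Y' M (k, l)"
        using r_pos by (simp add: el_entry)
      then show "Y' M (k, l) = ext X M (k, l)" using M kl by (simp add: ext_entry X_def)
    qed (use M X Y' in \<open>simp_all add: ext_apply_closed\<close>)
  qed
  moreover have "Y \<ominus>\<^bsub>B.D\<^esub> Y' = ?ad"
  proof -
    have ad: "?ad \<in> carrier B.D" using w by (rule B.inner_closed)
    show ?thesis unfolding Y'_def using Y ad by algebra
  qed
  ultimately show ?thesis using X w by (auto simp: Inn_def)
qed

sublocale FC: full_corner R A "matrix_algebra A r" "el 0 0" ext "{..<r}" "\<lambda>j. el j 0 \<one>\<^bsub>A\<^esub>" "\<lambda>j. el 0 j \<one>\<^bsub>A\<^esub>"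
proof unfold_locales
qed (use linear_map.hom[OF inc_linear] inc_mult linear_map.hom[OF ext_linear] ext_inc ext_comm ext_Inn unit_sum corner_entry inc_inj in auto)

end

lemma alg_if_assoc_algebra: "assoc_algebra R A \<Longrightarrow> alg R A"
  by (simp add: alg_def alg_axioms_def assoc_algebra_def assoc_algebra_axioms_def)

theorem theorem1p3:
  fixes R :: "'k ring" and A :: "('k, 'a) module" and r :: nat
  assumes "cring R"
    and "assoc_algebra R A"
    and "r \<ge> 1"
  shows "\<exists>\<Psi> \<phi>.
    \<Psi> \<in> module_iso R (eps R A) (eps R (matrix_algebra A r)) \<and>
    \<phi> \<in> module_iso R (HH0 R A) (HH0 R (matrix_algebra A r)) \<and>
    (\<forall>e1\<in>carrier (eps R A). \<forall>e2\<in>carrier (eps R A).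
      \<Psi> (eps_bracket R A e1 e2) = eps_bracket R (matrix_algebra A r) (\<Psi> e1) (\<Psi> e2)) \<and>
    (\<forall>e1\<in>carrier (eps R A). \<forall>e2\<in>carrier (eps R A).
      eps_form R (matrix_algebra A r) (\<Psi> e1) (\<Psi> e2) = \<phi> (eps_form R A e1 e2)) \<and>
    bij_betw (\<lambda>L. \<Psi> ` L) (dirac_structures R A) (dirac_structures R (matrix_algebra A r))"
proof -
  interpret matrices R A r
    using assms by (simp add: matrices_def matrices_axioms_def alg_if_assoc_algebra)
  interpret morita R A "matrix_algebra A r" "el 0 0" ext
    using FC.inc1_surj FC.inc_surj inc_reflects ext_surj by unfold_locales
  show ?thesis by (rule courant_isomorphism)
qed

end
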